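(* Let $\beta$ be an ordered partition of $N$ and suppose $\zeta\in(\mathfrak t')^*_\beta$ is $\beta$-generic with $\zeta(c)\ne0$. Then, as $\bar{\mathcal H}$-modules, $\mathcal Y_\beta(\zeta)=\bigoplus_{x\in X^\beta}\bar{\mathcal H}\cdot\varphi_x{\bf 1}_\zeta$, and for each $x\in X^\beta$ the summand $\bar{\mathcal H}\cdot\varphi_x{\bf 1}_\zeta$ is irreducible and isomorphic to $\bar{\mathcal Y}_{\beta(x)}(\overline{x(\zeta)})$ (via ${\bf 1}_{\overline{x(\zeta)}}\mapsto\varphi_x{\bf 1}_\zeta$), where $\overline{x(\zeta)}\in\bar{\mathfrak t}^*$ is the restriction of $x(\zeta)$ to $\bar{\mathfrak t}$.
   Context: Fix an integer $N\ge2$. Let $\bar{\mathfrak t}=\bigoplus_{i=1}^N\mathbb C\epsilon_i^\vee$, $\mathfrak t'=\bar{\mathfrak t}\oplus\mathbb Cc$, and let $\epsilon_1,\dots,\epsilon_N\in\bar{\mathfrak t}^*$ be the dual basis; regard $\bar{\mathfrak t}^*\subset(\mathfrak t')^*=\bar{\mathfrak t}^*\oplus\mathbb Cc^*$ with $\epsilon_i(c)=0$, $c^*(c)=1$, $c^*(\bar{\mathfrak t})=0$. Put $(\epsilon_i,\epsilon_j)=\delta_{ij}$ and, for $\zeta\in(\mathfrak t')^*$ and $\bar\alpha=\sum_ia_i\epsilon_i$, $(\zeta,\bar\alpha)=\sum_ia_i\zeta(\epsilon_i^\vee)$. Let $\bar R=\{\alpha_{ij}=\epsilon_i-\epsilon_j:i\ne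 j\}$, $\bar R_+=\{\alpha_{ij}:i<j\}$, $\alpha_i=\alpha_{i,i+1}$ ($1\le i\le N-1$), $\bar\Pi=\{\alpha_1,\dots,\alpha_{N-1}\}$. With a formal symbol $\delta$, the affine roots are $R=\{\bar\alpha+k\delta:\bar\alpha\in\bar R,k\in\mathbb Z\}$, $R_+=\{\bar\alpha+k\delta:\bar\alpha\in\bar R_+,k\ge0\}\cup\{-\bar\alpha+k\delta:\bar\alpha\in\bar R_+,k>0\}$, $R_-=R\setminus R_+$, and $\alpha_0=\delta-\alpha_{1N}$; indices $0,\dots,N-1$ are read modulo $N$. For $\alpha=\bar\alpha+k\delta\in R$ and $\zeta\in(\mathfrak t')^*$ set $(\zeta,\alpha)=(\zeta,\bar\alpha)+k\zeta(c)$; the coroot is $\alpha^\vee=\bar\alpha^\vee+kc\in\mathfrak t'$, where $(\epsilon_i-\epsilon_j)^\vee=\epsilon_i^\vee-\epsilon_j^\vee$, and $\alpha(\xi):=\bar\alpha(\xi)$ for $\xi\in\mathfrak t'$. Let $\bar P=\bigoplus_i\mathbb Z\epsilon_i$, $\bar P_-=\{\eta\in\bar P:(\eta,\alpha)\le0\ \forall\alpha\in\bar R_+\}$, $\bar W=\mathfrak S_N$ acting on indices ($w(\epsilon_i)=\epsilon_{w(i)}$, $w(\epsilon_i^\vee)=\epsilon^\vee_{w(i)}$, $w(c)=c$, $w(c^* )=c^*$), and $W=\bar W\ltimes\bar P$ with elements $wt_\eta$ and $wt_\eta w^{-1}=t_{w(\eta)}$. $W$ acts on $R$ by $w(\bar\alpha+k\delta)=w(\bar\alpha)+k\delta$,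 $t_\eta(\bar\alpha+k\delta)=\bar\alpha+(k-(\eta,\bar\alpha))\delta$; on $\mathfrak t'$ by $t_\eta(\xi)=\xi-\eta(\xi)c$; and on $(\mathfrak t')^*$ by the affine action $t_\eta(\zeta)=\zeta+\zeta(c)\eta$. For $\alpha=\bar\alpha+k\delta\in R$ let $s_\alpha=t_{-k\bar\alpha}s_{\bar\alpha}$, $s_i=s_{\alpha_i}$, $\pi=t_{\epsilon_1}s_1\cdots s_{N-1}$; $W$ is generated by $s_0,\dots,s_{N-1},\pi^{\pm1}$. $S(w)=R_+\cap w^{-1}(R_-)$, $l(w)=\#S(w)$, reduced expressions $w=\pi^ks_{j_1}\cdots s_{j_l}$ have $l=l(w)$. The degenerate double affine Hecke algebra $\mathcal H$ is the unital associative $\mathbb C$-algebra equal to $\mathbb C[W]\otimes S[\mathfrak t']$ as a vector space (via multiplication), in which $\mathbb C[W]$ and $S[\mathfrak t']$ are subalgebras and $s_i\xi-s_i(\xi)s_i=-\alpha_i(\xi)$ ($0\le i\le N-1$, $\xi\in\mathfrak t'$), $\pi\xi=\pi(\xi)\pi$. $\bar{\mathcal H}$ is the subalgebra generated by $\bar W$ and $\bar{\mathfrak t}$. Intertwiners: $\varphi_i=1+s_i\alpha_i^\vee$, $\varphi_\pi=\pi$, $\varphi_w=\varphi_\pi^k\varphi_{j_1}\cdots\varphi_{j_l}$ for a reduced expression $w=\pi^ks_{j_1}\cdots s_{j_l}$. An ordered partition $\gamma$ of $N$ gives blocks of consecutive indices of sizes $\gamma_1,\dots,\gamma_r$; $\bar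 R_\gamma=\{\alpha_{ij}:i,j\text{ in the same block}\}$, $\bar R_{\gamma,+}=\bar R_\gamma\cap\bar R_+$, $\bar\Pi_\gamma=\bar\Pi\cap\bar R_\gamma$, $\bar W_\gamma=\langle s_\alpha:\alpha\in\bar\Pi_\gamma\rangle$; $\mathcal H_\gamma$ (resp. $\bar{\mathcal H}_\gamma$) is the subalgebra generated by $S[\mathfrak t']$ (resp. $S[\bar{\mathfrak t}]$) and $\bar W_\gamma$. $(\mathfrak t')^*_\gamma=\{\zeta\in(\mathfrak t')^*:(\zeta,\alpha)=-1\ \forall\alpha\in\bar\Pi_\gamma\}$, and $\bar{\mathfrak t}^*_\gamma$ analogously in $\bar{\mathfrak t}^*$. For such $\zeta$, $\mathbb C1_\zeta$ is the one-dimensional module with $w1_\zeta=1_\zeta$ ($w\in\bar W_\gamma$), $\xi1_\zeta=\zeta(\xi)1_\zeta$; $\mathcal Y_\gamma(\zeta)=\mathcal H\otimes_{\mathcal H_\gamma}\mathbb C1_\zeta$, $\bar{\mathcal Y}_\gamma(\zeta)=\bar{\mathcal H}\otimes_{\bar{\mathcal H}_\gamma}\mathbb C1_\zeta$, with cyclic vector ${\bf 1}_\zeta=1\otimes1_\zeta$. $W^\gamma=\{w\in W:l(wu)\ge l(w)\ \forall u\in\bar W_\gamma\}$, $\bar W^\gamma=W^\gamma\cap\bar W$. A weight $\zeta\in(\mathfrak t')^*_\gamma$ is $\gamma$-generic if $(\zeta,\alpha)\notin\{1,0,-1\}$ for all $\alpha\in R_+\setminus\bar R_{\gamma,+}$.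 For $w\in W$, $\beta(w)$ is the ordered partition of $N$ with $\bar\Pi_{\beta(w)}=\bar\Pi\cap w(\bar R_{\beta,+})$. For $w\in\bar W^\beta$, $\eta_w\in\bar P_-$ is defined by $(\eta_w,\epsilon_1)=0$ and $(\eta_w,\alpha_i)=-1$ if $\alpha_i\in w(\bar R_+\setminus\bar R_{\beta,+})$, $0$ otherwise; $\bar P_-(w)=\{\eta+\eta_w:\eta\in\bar P_-\}$; $X^\beta=\{t_\eta w:w\in\bar W^\beta,\eta\in\bar P_-(w)\}$. *)

theory Defs
  imports Complex_Main "HOL-Combinatorics.Permutations" "HOL-Combinatorics.Transposition"
begin

text \<open>An element (sigma, eta) represents t_eta sigma, sigma a permutation of {1..N}
  (identity outside), eta = sum_i eta(i) eps_i (zero outside {1..N}).\<close>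

type_synonym W = "(nat \<Rightarrow> nat) \<times> (nat \<Rightarrow> int)"

definition inW :: "nat \<Rightarrow> W \<Rightarrow> bool" where
  "inW N w \<longleftrightarrow> fst w permutes {1..N} \<and> (\<forall>i. i \<notin> {1..N} \<longrightarrow> snd w i = 0)"

definition inWbar :: "nat \<Rightarrow> W \<Rightarrow> bool" where
  "inWbar N w \<longleftrightarrow> inW N w \<and> snd w = (\<lambda>_. 0)"

definition idW :: W where "idW = (id, \<lambda>_. 0)"

definition wmul :: "W \<Rightarrow> W \<Rightarrow> W" where
  "wmul u v = (fst u \<circ> fst v, \<lambda>i. snd u i + snd v (inv (fst u) i))"

definition winv :: "W \<Rightarrow> W" where
  "winv u = (inv (fst u), \<lambda>i. - snd u (fst u i))"

definition wpowi :: "W \<Rightarrow> int \<Rightarrow> W" where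
  "wpowi w k = (if 0 \<le> k then (wmul w ^^ nat k) idW else (wmul (winv w) ^^ nat (- k)) idW)"

definition transl :: "(nat \<Rightarrow> int) \<Rightarrow> W" where "transl eta = (id, eta)"

definition eps :: "nat \<Rightarrow> nat \<Rightarrow> int" where "eps i = (\<lambda>j. if j = i then 1 else 0)"

section \<open>Affine roots: (i,j,k) stands for eps_i - eps_j + k delta\<close>

type_synonym aroot = "nat \<times> nat \<times> int"

definition is_root :: "nat \<Rightarrow> aroot \<Rightarrow> bool" where
  "is_root N a \<longleftrightarrow> (case a of (i,j,k) \<Rightarrow> i \<in> {1..N} \<and> j \<in> {1..N} \<and> i \<noteq> j)"

definition pos_root :: "nat \<Rightarrow> aroot \<Rightarrow> bool" where
  "pos_root N a \<longleftrightarrow> is_root N a \<and>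
     (case a of (i,j,k) \<Rightarrow> (i < j \<and> 0 \<le> k) \<or> (j < i \<and> 0 < k))"

definition neg_root :: "nat \<Rightarrow> aroot \<Rightarrow> bool" where
  "neg_root N a \<longleftrightarrow> is_root N a \<and> \<not> pos_root N a"

text \<open>(t_eta sigma)(eps_i - eps_j + k delta) = eps_{sigma i} - eps_{sigma j} + (k - (eta, eps_{sigma i} - eps_{sigma j})) delta\<close>
definition wroot :: "W \<Rightarrow> aroot \<Rightarrow> aroot" where
  "wroot w a = (case a of (i,j,k) \<Rightarrow>
     (fst w i, fst w j, k - (snd w (fst w i) - snd w (fst w j))))"

definition Sset :: "nat \<Rightarrow> W \<Rightarrow> aroot set" where
  "Sset N w = {a. pos_root N a \<and> neg_root N (wroot w a)}"

definition len :: "nat \<Rightarrow> W \<Rightarrow> nat" where "len N w = card (Sset N w)"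

text \<open>s_alpha = t_{-k alpha_bar} s_{alpha_bar}\<close>
definition s_alpha :: "aroot \<Rightarrow> W" where
  "s_alpha a = (case a of (i,j,k) \<Rightarrow> (transpose i j, \<lambda>l. - k * (eps i l - eps j l)))"

text \<open>alpha_0 = delta - alpha_{1N} = eps_N - eps_1 + delta; alpha_i = eps_i - eps_{i+1}\<close>
definition simple_root :: "nat \<Rightarrow> nat \<Rightarrow> aroot" where
  "simple_root N i = (if i = 0 then (N, 1, 1) else (i, Suc i, 0))"

definition sW :: "nat \<Rightarrow> nat \<Rightarrow> W" where "sW N i = s_alpha (simple_root N i)"

definition piW :: "nat \<Rightarrow> W" where
  "piW N = wmul (transl (eps 1)) (foldr wmul (map (sW N) [1..<N]) idW)"

definition word :: "nat \<Rightarrow> int \<Rightarrow> nat list \<Rightarrow> W" where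
  "word N k js = wmul (wpowi (piW N) k) (foldr wmul (map (sW N) js) idW)"

definition reduced_expr :: "nat \<Rightarrow> W \<Rightarrow> int \<times> nat list \<Rightarrow> bool" where
  "reduced_expr N w e \<longleftrightarrow> (\<forall>j \<in> set (snd e). j < N) \<and> word N (fst e) (snd e) = w
      \<and> length (snd e) = len N w"

section \<open>t' and its dual: (a, b) = sum_i a_i eps_i^vee + b c ;  zeta = (z, z(c))\<close>

type_synonym tvec = "(nat \<Rightarrow> complex) \<times> complex"

definition act_t :: "nat \<Rightarrow> W \<Rightarrow> tvec \<Rightarrow> tvec" where
  "act_t N w xi = (let a' = (\<lambda>j. fst xi (inv (fst w) j))
     in (a', snd xi - (\<Sum>j\<in>{1..N}. of_int (snd w j) * a' j)))"

definition act_dual :: "W \<Rightarrow> tvec \<Rightarrow> tvec" where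
  "act_dual w zeta = (\<lambda>j. fst zeta (inv (fst w) j) + snd zeta * of_int (snd w j), snd zeta)"

definition zeta_eval :: "nat \<Rightarrow> tvec \<Rightarrow> tvec \<Rightarrow> complex" where
  "zeta_eval N zeta xi = (\<Sum>i\<in>{1..N}. fst zeta i * fst xi i) + snd zeta * snd xi"

definition pair :: "tvec \<Rightarrow> aroot \<Rightarrow> complex" where
  "pair zeta a = (case a of (i,j,k) \<Rightarrow> fst zeta i - fst zeta j + of_int k * snd zeta)"

text \<open>alpha(xi) := alpha_bar(xi)\<close>
definition rootval :: "aroot \<Rightarrow> tvec \<Rightarrow> complex" where
  "rootval a xi = (case a of (i,j,k) \<Rightarrow> fst xi i - fst xi j)"

definition coroot :: "aroot \<Rightarrow> tvec" where
  "coroot a = (case a of (i,j,k) \<Rightarrow>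
     (\<lambda>l. (if l = i then 1 else 0) - (if l = j then 1 else 0), of_int k))"

definition is_opart :: "nat \<Rightarrow> nat list \<Rightarrow> bool" where
  "is_opart N g \<longleftrightarrow> (\<forall>x \<in> set g. 0 < x) \<and> sum_list g = N"

definition in_block :: "nat list \<Rightarrow> nat \<Rightarrow> nat \<Rightarrow> bool" where
  "in_block g k i \<longleftrightarrow> sum_list (take k g) < i \<and> i \<le> sum_list (take (Suc k) g)"

definition same_block :: "nat list \<Rightarrow> nat \<Rightarrow> nat \<Rightarrow> bool" where
  "same_block g i j \<longleftrightarrow> (\<exists>k < length g. in_block g k i \<and> in_block g k j)"

text \<open>indices i (1 <= i < N) with alpha_i in Pi_gamma\<close>
definition Pi_g :: "nat \<Rightarrow> nat list \<Rightarrow> nat set" where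
  "Pi_g N g = {i. 1 \<le> i \<and> i < N \<and> same_block g i (Suc i)}"

definition Rbar_g_pos :: "nat \<Rightarrow> nat list \<Rightarrow> aroot set" where
  "Rbar_g_pos N g = {(i, j, 0) | i j. i \<in> {1..N} \<and> j \<in> {1..N} \<and> i < j \<and> same_block g i j}"

inductive_set Wbar_g :: "nat \<Rightarrow> nat list \<Rightarrow> W set" for N g where
  "idW \<in> Wbar_g N g"
| "i \<in> Pi_g N g \<Longrightarrow> w \<in> Wbar_g N g \<Longrightarrow> wmul (sW N i) w \<in> Wbar_g N g"

definition t_dual_g :: "nat \<Rightarrow> nat list \<Rightarrow> tvec \<Rightarrow> bool" where
  "t_dual_g N g zeta \<longleftrightarrow> (\<forall>i \<in> Pi_g N g. pair zeta (i, Suc i, 0) = -1)"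

definition generic :: "nat \<Rightarrow> nat list \<Rightarrow> tvec \<Rightarrow> bool" where
  "generic N g zeta \<longleftrightarrow>
     (\<forall>a. pos_root N a \<and> a \<notin> Rbar_g_pos N g \<longrightarrow> pair zeta a \<notin> {1, 0, -1})"

definition beta_of :: "nat \<Rightarrow> nat list \<Rightarrow> W \<Rightarrow> nat list" where
  "beta_of N b w = (THE g. is_opart N g \<and>
     Pi_g N g = {i. 1 \<le> i \<and> i < N \<and> (\<exists>a \<in> Rbar_g_pos N b. wroot w a = (i, Suc i, 0))})"

definition Wmin :: "nat \<Rightarrow> nat list \<Rightarrow> W set" where
  "Wmin N g = {w. inW N w \<and> (\<forall>u \<in> Wbar_g N g. len N w \<le> len N (wmul w u))}"

definition inP :: "nat \<Rightarrow> (nat \<Rightarrow> int) \<Rightarrow> bool" where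
  "inP N eta \<longleftrightarrow> (\<forall>i. i \<notin> {1..N} \<longrightarrow> eta i = 0)"

definition Pminus :: "nat \<Rightarrow> (nat \<Rightarrow> int) \<Rightarrow> bool" where
  "Pminus N eta \<longleftrightarrow> inP N eta \<and> (\<forall>i j. 1 \<le> i \<longrightarrow> i < j \<longrightarrow> j \<le> N \<longrightarrow> eta i - eta j \<le> 0)"

definition eta_w :: "nat \<Rightarrow> nat list \<Rightarrow> W \<Rightarrow> nat \<Rightarrow> int" where
  "eta_w N b w = (THE eta. inP N eta \<and> eta 1 = 0 \<and>
     (\<forall>i. 1 \<le> i \<and> i < N \<longrightarrow> eta i - eta (Suc i) =
        (if (\<exists>a. pos_root N a \<and> (\<exists>i' j'. a = (i', j', 0)) \<and> a \<notin> Rbar_g_pos N b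
                 \<and> wroot w a = (i, Suc i, 0)) then -1 else 0)))"

definition Xbeta :: "nat \<Rightarrow> nat list \<Rightarrow> W set" where
  "Xbeta N b = {wmul (transl (\<lambda>i. eta i + eta_w N b w i)) w | w eta.
       w \<in> Wmin N b \<and> inWbar N w \<and> Pminus N eta}"

definition Xlin :: "nat \<Rightarrow> (complex \<Rightarrow> 'h::ring_1) \<Rightarrow> (nat \<Rightarrow> 'h) \<Rightarrow> 'h \<Rightarrow> tvec \<Rightarrow> 'h" where
  "Xlin N sc Xe Xc xi = (\<Sum>i\<in>{1..N}. sc (fst xi i) * Xe i) + sc (snd xi) * Xc"

definition Xmono :: "nat \<Rightarrow> (nat \<Rightarrow> 'h::ring_1) \<Rightarrow> 'h \<Rightarrow> (nat \<Rightarrow> nat) \<Rightarrow> 'h" where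
  "Xmono N Xe Xc m = prod_list (map (\<lambda>i. Xe i ^ m i) [1..<N+1]) * Xc ^ m 0"

definition Monos :: "nat \<Rightarrow> (nat \<Rightarrow> nat) set" where
  "Monos N = {m. \<forall>i. N < i \<longrightarrow> m i = 0}"

definition DDAHA :: "nat \<Rightarrow> (complex \<Rightarrow> 'h::ring_1) \<Rightarrow> (W \<Rightarrow> 'h) \<Rightarrow> (nat \<Rightarrow> 'h) \<Rightarrow> 'h \<Rightarrow> bool" where
  "DDAHA N sc T Xe Xc \<longleftrightarrow>
     (\<forall>a b. sc (a + b) = sc a + sc b) \<and> (\<forall>a b. sc (a * b) = sc a * sc b) \<and> sc 1 = 1 \<and>
     (\<forall>a h. sc a * h = h * sc a) \<and>
     T idW = 1 \<and> (\<forall>u v. inW N u \<longrightarrow> inW N v \<longrightarrow> T (wmul u v) = T u * T v) \<and>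
     (\<forall>i \<in> {1..N}. \<forall>j \<in> {1..N}. Xe i * Xe j = Xe j * Xe i) \<and>
     (\<forall>i \<in> {1..N}. Xe i * Xc = Xc * Xe i) \<and>
     (\<forall>i < N. \<forall>xi. T (sW N i) * Xlin N sc Xe Xc xi
         - Xlin N sc Xe Xc (act_t N (sW N i) xi) * T (sW N i) = - sc (rootval (simple_root N i) xi)) \<and>
     (\<forall>xi. T (piW N) * Xlin N sc Xe Xc xi = Xlin N sc Xe Xc (act_t N (piW N) xi) * T (piW N)) \<and>
     (\<forall>F a. finite F \<and> F \<subseteq> {w. inW N w} \<times> Monos N \<and>
         (\<Sum>p\<in>F. sc (a p) * (T (fst p) * Xmono N Xe Xc (snd p))) = 0 \<longrightarrow> (\<forall>p\<in>F. a p = 0)) \<and>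
     (\<forall>h. \<exists>F a. finite F \<and> F \<subseteq> {w. inW N w} \<times> Monos N \<and>
         h = (\<Sum>p\<in>F. sc (a p) * (T (fst p) * Xmono N Xe Xc (snd p))))"

inductive_set subalg :: "(complex \<Rightarrow> 'h::ring_1) \<Rightarrow> 'h set \<Rightarrow> 'h set" for sc G where
  "sc a \<in> subalg sc G"
| "g \<in> G \<Longrightarrow> g \<in> subalg sc G"
| "x \<in> subalg sc G \<Longrightarrow> y \<in> subalg sc G \<Longrightarrow> x + y \<in> subalg sc G"
| "x \<in> subalg sc G \<Longrightarrow> y \<in> subalg sc G \<Longrightarrow> x * y \<in> subalg sc G"

definition Hbar :: "nat \<Rightarrow> (complex \<Rightarrow> 'h::ring_1) \<Rightarrow> (W \<Rightarrow> 'h) \<Rightarrow> (nat \<Rightarrow> 'h) \<Rightarrow> 'h \<Rightarrow> 'h set" where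
  "Hbar N sc T Xe Xc = subalg sc ({T w | w. inWbar N w} \<union> {Xlin N sc Xe Xc (a, 0) | a. True})"

inductive_set lideal :: "'h::ring_1 set \<Rightarrow> 'h set \<Rightarrow> 'h set" for A G where
  "0 \<in> lideal A G"
| "a \<in> A \<Longrightarrow> g \<in> G \<Longrightarrow> a * g \<in> lideal A G"
| "x \<in> lideal A G \<Longrightarrow> y \<in> lideal A G \<Longrightarrow> x + y \<in> lideal A G"

definition phi_s :: "nat \<Rightarrow> (complex \<Rightarrow> 'h::ring_1) \<Rightarrow> (W \<Rightarrow> 'h) \<Rightarrow> (nat \<Rightarrow> 'h) \<Rightarrow> 'h \<Rightarrow> nat \<Rightarrow> 'h" where
  "phi_s N sc T Xe Xc i = 1 + T (sW N i) * Xlin N sc Xe Xc (coroot (simple_root N i))"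

definition phi_w :: "nat \<Rightarrow> (complex \<Rightarrow> 'h::ring_1) \<Rightarrow> (W \<Rightarrow> 'h) \<Rightarrow> (nat \<Rightarrow> 'h) \<Rightarrow> 'h \<Rightarrow> W \<Rightarrow> 'h" where
  "phi_w N sc T Xe Xc w = (let e = (SOME e. reduced_expr N w e) in
     T (wpowi (piW N) (fst e)) * prod_list (map (phi_s N sc T Xe Xc) (snd e)))"

text \<open>Y_gamma(zeta) = H (x)_{H_gamma} C1_zeta  =  H / H.ker(chi_zeta); here the left ideal
  H.ker(chi_zeta) = lideal UNIV (generators of ker chi_zeta).\<close>
definition Jideal :: "nat \<Rightarrow> (complex \<Rightarrow> 'h::ring_1) \<Rightarrow> (W \<Rightarrow> 'h) \<Rightarrow> (nat \<Rightarrow> 'h) \<Rightarrow> 'h \<Rightarrow> nat list \<Rightarrow> tvec \<Rightarrow> 'h set" where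
  "Jideal N sc T Xe Xc g zeta = lideal UNIV
     ({T w - 1 | w. w \<in> Wbar_g N g} \<union> {Xlin N sc Xe Xc xi - sc (zeta_eval N zeta xi) | xi. True})"

text \<open>Ybar_gamma(zbar) = Hbar / Hbar.ker(chi_zbar), zbar in tbar^*\<close>
definition Jbar :: "nat \<Rightarrow> (complex \<Rightarrow> 'h::ring_1) \<Rightarrow> (W \<Rightarrow> 'h) \<Rightarrow> (nat \<Rightarrow> 'h) \<Rightarrow> 'h \<Rightarrow> nat list \<Rightarrow> (nat \<Rightarrow> complex) \<Rightarrow> 'h set" where
  "Jbar N sc T Xe Xc g zb = lideal (Hbar N sc T Xe Xc)
     ({T w - 1 | w. w \<in> Wbar_g N g} \<union>
      {Xlin N sc Xe Xc (a, 0) - sc (zeta_eval N (zb, 0) (a, 0)) | a. True})"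

text \<open>V/J (with J \<subseteq> V) is an irreducible A-module: nonzero, and every A-submodule
  U/J of V/J is 0 or V/J.\<close>
definition irred_quot :: "'h::ring_1 set \<Rightarrow> 'h set \<Rightarrow> 'h set \<Rightarrow> bool" where
  "irred_quot A J V \<longleftrightarrow> \<not> V \<subseteq> J \<and>
     (\<forall>U. J \<subseteq> U \<and> U \<subseteq> V \<and> (\<forall>u\<in>U. \<forall>v\<in>U. u + v \<in> U) \<and> (\<forall>a\<in>A. \<forall>u\<in>U. a * u \<in> U)
        \<longrightarrow> U = J \<or> U = V)"

end

theory Submission
  imports Defs
begin

text \<open>
  Modulo the left ideal J defining the standard module, phi_w 1 is a weight vector of weight
  w(zeta). Genericity and zeta(c) nonzero make the weights w(zeta), w in W, pairwise distinct, make
  every pairing of w(zeta) with a root nonzero, and make it equal to 1 or -1 only for roots of the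
  parabolic subsystem. Hence phi_i phi_i acts on phi_w 1 by a nonzero scalar whenever w and s_i w
  both lie in W^beta, and phi_w 1 is nonzero for w in W^beta, because 1 is not in J by the PBW
  theorem. A triangularity argument for the length filtration shows that the phi_w 1, w in W^beta,
  span; having distinct weights they form a basis, so all weight spaces have dimension at most one.
  This replaces the independence of phi_w from the reduced expression: phi_i phi_w 1 is a multiple
  of phi_{s_i w} 1, nonzero if s_i w is in W^beta and zero otherwise. The summands are therefore the
  connected components of W^beta under left multiplication by finite simple reflections, and each
  coset of the finite Weyl group meeting W^beta contains exactly one element of X^beta, the longest
  of its elements in W^beta. Applying the triangularity argument to the finite algebra shows that
  the annihilator of phi_x 1 is no larger than the ideal defining the induced module.
\<close>

declare split_paired_All [simp del] split_paired_Ex [simp del]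

lemma add_mult_le_if_increments_ge:
  fixes f :: "nat \<Rightarrow> 'a::linordered_idom"
  assumes "\<And>l. p \<le> l \<Longrightarrow> l < q \<Longrightarrow> f l + c \<le> f (Suc l)" and "p \<le> q"
  shows "f p + of_nat (q - p) * c \<le> f q"
proof -
  have "of_nat (q - p) * c = (\<Sum>l=p..<q. c)" by simp
  also have "\<dots> \<le> (\<Sum>l=p..<q. f (Suc l) - f l)"
    using assms(1) by (intro sum_mono) (auto simp: algebra_simps)
  also have "\<dots> = f q - f p" by (rule sum_Suc_diff'[OF assms(2)])
  finally show ?thesis by simp
qed

lemma wpowi_induct [case_names zero succ pred]:
  assumes "P 0 idW" and "\<And>k v. P k v \<Longrightarrow> P (k + 1) (wmul w v)"
    and "\<And>k v. P k v \<Longrightarrow> P (k - 1) (wmul (winv w) v)"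
  shows "P k (wpowi w k)"
proof -
  have nonneg: "P (int n) ((wmul w ^^ n) idW)" for n
  proof (induction n)
    case (Suc n)
    from assms(2)[OF this] show ?case by (simp add: add.commute)
  qed (simp add: assms(1))
  have nonpos: "P (- int n) ((wmul (winv w) ^^ n) idW)" for n
  proof (induction n)
    case (Suc n)
    from assms(3)[OF this] show ?case by (simp add: minus_diff_commute)
  qed (simp add: assms(1))
  show ?thesis using nonneg[of "nat k"] nonpos[of "nat (- k)"]
    by (cases "0 \<le> k") (simp_all add: wpowi_def)
qed

locale extended_affine_weyl =
  fixes N :: nat
  assumes N_ge_2: "2 \<le> N"
begin

subsection \<open>The extended affine Weyl group\<close>

lemma bij_fst_inW: "inW N w \<Longrightarrow> bij (fst w)"
  by (auto simp: inW_def intro: permutes_bij)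

lemma fst_inW_in_range_iff: "inW N w \<Longrightarrow> fst w i \<in> {1..N} \<longleftrightarrow> i \<in> {1..N}"
  unfolding inW_def by (metis permutes_in_image)

lemma fst_inW_eq_iff: "inW N w \<Longrightarrow> fst w i = fst w j \<longleftrightarrow> i = j"
  by (simp add: inj_eq bij_is_inj[OF bij_fst_inW])

lemma inv_fst_inW_f [simp]: "inW N w \<Longrightarrow> inv (fst w) (fst w i) = i"
  by (simp add: bij_is_inj[OF bij_fst_inW])

lemma fst_inW_inv_f [simp]: "inW N w \<Longrightarrow> fst w (inv (fst w) i) = i"
  by (simp add: surj_f_inv_f bij_is_surj[OF bij_fst_inW])

lemma inW_idW [simp]: "inW N idW"
  by (auto simp: inW_def idW_def)

lemma inW_winv [simp]: "inW N w \<Longrightarrow> inW N (winv w)"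
  using fst_inW_in_range_iff[of w] unfolding inW_def winv_def
  by (simp add: permutes_inv del: atLeastAtMost_iff One_nat_def)

lemma inv_fst_inW_in_range_iff: "inW N w \<Longrightarrow> inv (fst w) i \<in> {1..N} \<longleftrightarrow> i \<in> {1..N}"
  using fst_inW_in_range_iff[OF inW_winv] by (simp add: winv_def)

lemma inW_wmul [simp]:
  assumes "inW N u" "inW N v"
  shows "inW N (wmul u v)"
proof -
  have "snd u i + snd v (inv (fst u) i) = 0" if "i \<notin> {1..N}" for i
    using that assms inv_fst_inW_in_range_iff[OF assms(1), of i] unfolding inW_def by auto
  then show ?thesis
    using assms unfolding inW_def wmul_def by (auto intro: permutes_compose)
qed

lemma inv_fst_comp: "inW N u \<Longrightarrow> inW N v \<Longrightarrow> inv (fst u \<circ> fst v) = inv (fst v) \<circ> inv (fst u)"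
  using o_inv_distrib bij_fst_inW by blast

lemma wmul_assoc: "inW N u \<Longrightarrow> inW N v \<Longrightarrow> wmul (wmul u v) w = wmul u (wmul v w)"
  by (simp add: wmul_def inv_fst_comp comp_assoc fun_eq_iff)

lemma wmul_idW_left [simp]: "wmul idW w = w"
  by (simp add: wmul_def idW_def)

lemma wmul_idW_right [simp]: "wmul w idW = w"
  by (simp add: wmul_def idW_def)

lemma wmul_winv_right [simp]: "inW N w \<Longrightarrow> wmul w (winv w) = idW"
  by (simp add: wmul_def winv_def idW_def fun_eq_iff)

lemma wmul_winv_left [simp]:
  assumes "inW N w"
  shows "wmul (winv w) w = idW"
proof -
  have "inv (inv (fst w)) = fst w" using bij_fst_inW[OF assms] inv_inv_eq by blast
  then show ?thesis using assms by (simp add: wmul_def winv_def idW_def fun_eq_iff)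
qed

lemma wmul_winv_cancel [simp]:
  assumes "inW N u" "inW N w"
  shows "wmul u (wmul (winv u) w) = w" "wmul (winv u) (wmul u w) = w"
  by (simp_all add: wmul_assoc[symmetric] assms)

lemma wmul_right_cancel:
  "inW N u \<Longrightarrow> inW N v \<Longrightarrow> inW N w \<Longrightarrow> wmul v u = wmul w u \<longleftrightarrow> v = w"
  by (metis wmul_assoc wmul_winv_right wmul_idW_right)

lemma winv_unique: "inW N u \<Longrightarrow> inW N v \<Longrightarrow> wmul u v = idW \<Longrightarrow> v = winv u"
  by (metis wmul_winv_cancel(2) wmul_idW_right)

lemma winv_wmul: "inW N u \<Longrightarrow> inW N v \<Longrightarrow> winv (wmul u v) = wmul (winv v) (winv u)"
  by (rule winv_unique[symmetric]) (simp_all add: wmul_assoc)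

lemma winv_winv: "inW N u \<Longrightarrow> winv (winv u) = u"
  by (rule winv_unique[symmetric]) simp_all

lemma winv_idW [simp]: "winv idW = idW"
  by (rule winv_unique[symmetric]) simp_all

lemma inW_if_inWbar [simp]: "inWbar N w \<Longrightarrow> inW N w"
  by (simp add: inWbar_def)

lemma snd_inWbar: "inWbar N w \<Longrightarrow> snd w i = 0"
  by (simp add: inWbar_def)

lemma inWbar_wmul [simp]: "inWbar N u \<Longrightarrow> inWbar N v \<Longrightarrow> inWbar N (wmul u v)"
  unfolding inWbar_def using inW_wmul[of u v] by (simp add: wmul_def)

lemma inWbar_winv [simp]: "inWbar N u \<Longrightarrow> inWbar N (winv u)"
  unfolding inWbar_def using inW_winv[of u] by (simp add: winv_def)

lemma inWbar_idW [simp]: "inWbar N idW"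
  by (simp add: inWbar_def) (simp add: idW_def)

lemma finite_inWbar: "finite {w. inWbar N w}"
proof -
  have "{w. inWbar N w} \<subseteq> {p. p permutes {1..N}} \<times> {\<lambda>_. 0}"
    by (auto simp: inWbar_def inW_def)
  then show ?thesis by (rule finite_subset) (simp add: finite_permutations)
qed

subsection \<open>Affine roots\<close>

definition opp_root :: "aroot \<Rightarrow> aroot" where
  "opp_root a = (case a of (i,j,k) \<Rightarrow> (j,i,-k))"

lemma opp_root_opp_root [simp]: "opp_root (opp_root a) = a"
  by (cases a) (simp add: opp_root_def)

lemma wroot_opp_root: "wroot w (opp_root a) = opp_root (wroot w a)"
  by (cases a) (simp add: opp_root_def wroot_def)

lemma is_root_wroot [simp]: "inW N w \<Longrightarrow> is_root N (wroot w a) \<longleftrightarrow> is_root N a"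
  by (cases a) (simp add: wroot_def is_root_def fst_inW_in_range_iff fst_inW_eq_iff
      del: atLeastAtMost_iff One_nat_def)

lemma wroot_wmul: "inW N u \<Longrightarrow> wroot (wmul u v) a = wroot u (wroot v a)"
  by (cases a) (simp add: wroot_def wmul_def)

lemma wroot_idW [simp]: "wroot idW a = a"
  by (cases a) (simp add: wroot_def idW_def)

lemma wroot_winv_cancel [simp]:
  "inW N w \<Longrightarrow> wroot w (wroot (winv w) a) = a"
  "inW N w \<Longrightarrow> wroot (winv w) (wroot w a) = a"
  by (simp_all flip: wroot_wmul)

lemma wroot_winv:
  "inW N x \<Longrightarrow>
    wroot (winv x) (p,q,k) = (inv (fst x) p, inv (fst x) q, k + (snd x p - snd x q))"
  by (simp add: wroot_def winv_def)

lemma is_root_if_pos: "pos_root N a \<Longrightarrow> is_root N a"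
  by (simp add: pos_root_def)

lemma pos_root_opp_root [simp]: "pos_root N (opp_root a) \<longleftrightarrow> neg_root N a"
  by (cases a) (auto simp: pos_root_def neg_root_def opp_root_def is_root_def)

lemma neg_root_opp_root [simp]: "neg_root N (opp_root a) \<longleftrightarrow> pos_root N a"
  using pos_root_opp_root[of "opp_root a"] by simp

text \<open>The root (i,j,k) corresponds to the pair of integers (i, j + kN) up to a common shift by
  multiples of N, and the extended affine Weyl group to N-periodic permutations of the integers,
  which are determined by their window of values at 1, ..., N.\<close>

lemma pos_root_iff_less: "pos_root N (i,j,k) \<longleftrightarrow> is_root N (i,j,k) \<and> int i < int j + int N * k"
proof -
  consider (pos) "k \<ge> 1" | (zero) "k = 0" | (neg) "k \<le> -1" by linarith
  then show ?thesis
  proof cases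
    case pos
    then have "x < y + int N * k" if "x \<le> int N" "1 \<le> y" for x y
      using mult_left_mono[of 1 k "int N"] that by linarith
    with pos show ?thesis by (auto simp: pos_root_def is_root_def)
  next
    case neg
    then have "int N * k \<le> int N * (-1)" by (intro mult_left_mono) auto
    with neg show ?thesis by (auto simp: pos_root_def is_root_def)
  qed (auto simp: pos_root_def is_root_def)
qed

definition window :: "W \<Rightarrow> nat \<Rightarrow> int" where
  "window w i = int (fst w i) + int N * snd w (fst w i)"

lemma pos_root_wroot_iff:
  assumes "inW N w" "is_root N (i,j,k)"
  shows "pos_root N (wroot w (i,j,k)) \<longleftrightarrow> window w i < window w j + int N * k"
proof -
  have "is_root N (wroot w (i,j,k))" using assms by simp
  then show ?thesis by (simp add: wroot_def pos_root_iff_less window_def algebra_simps)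
qed

lemma window_idW [simp]: "window idW i = int i"
  by (simp add: window_def idW_def)

lemma window_wmul:
  "inW N u \<Longrightarrow> window (wmul u w) i = window u (fst w i) + int N * snd w (fst w i)"
  by (simp add: window_def wmul_def algebra_simps)

lemma window_eqD:
  assumes uv: "inW N u" "inW N v" and i: "i \<in> {1..N}" and eq: "window u i = window v i"
  shows "fst u i = fst v i" "snd u (fst u i) = snd v (fst v i)"
proof -
  have range: "fst u i \<in> {1..N}" "fst v i \<in> {1..N}" using fst_inW_in_range_iff uv i by auto
  have mult: "int (fst u i) - int (fst v i) = int N * (snd v (fst v i) - snd u (fst u i))"
    using eq by (simp add: window_def algebra_simps)
  then have "int N dvd int (fst u i) - int (fst v i)" by simp
  moreover have "\<bar>int (fst u i) - int (fst v i)\<bar> < int N" using range by auto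
  ultimately have "int (fst u i) - int (fst v i) = 0"
    using dvd_imp_le_int[of "int (fst u i) - int (fst v i)" "int N"] by force
  with mult N_ge_2 show "fst u i = fst v i" "snd u (fst u i) = snd v (fst v i)" by auto
qed

lemma window_inject:
  assumes uv: "inW N u" "inW N v" and eq: "\<And>i. i \<in> {1..N} \<Longrightarrow> window u i = window v i"
  shows "u = v"
proof -
  have "fst u i = fst v i" for i
  proof (cases "i \<in> {1..N}")
    case False
    then have "fst u i = i" "fst v i = i" using uv permutes_not_in unfolding inW_def by fast+
    then show ?thesis by simp
  qed (use window_eqD[OF uv] eq in blast)
  then have fst: "fst u = fst v" by blast
  moreover have "snd u i = snd v i" for i
  proof (cases "i \<in> {1..N}")
    case True
    then have "inv (fst u) i \<in> {1..N}" using inv_fst_inW_in_range_iff uv by blast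
    from window_eqD(2)[OF uv this eq[OF this]] show ?thesis using uv fst by simp
  qed (use uv in \<open>auto simp: inW_def\<close>)
  ultimately show ?thesis by (simp add: prod_eq_iff fun_eq_iff)
qed

subsection \<open>Simple reflections and the length function\<close>

abbreviation \<alpha> :: "nat \<Rightarrow> aroot" where "\<alpha> \<equiv> simple_root N"
abbreviation s :: "nat \<Rightarrow> W" where "s \<equiv> sW N"

lemmas simple_reflection_defs = sW_def s_alpha_def simple_root_def eps_def

lemma simple_root_finite: "1 \<le> i \<Longrightarrow> \<alpha> i = (i, Suc i, 0)"
  by (simp add: simple_root_def)

lemma pos_root_simple: "i < N \<Longrightarrow> pos_root N (\<alpha> i)"
  using N_ge_2 by (auto simp: simple_root_def is_root_def pos_root_def)

lemma is_root_simple [simp]: "i < N \<Longrightarrow> is_root N (\<alpha> i)"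
  by (rule is_root_if_pos[OF pos_root_simple])

lemma inW_s [simp]: "i < N \<Longrightarrow> inW N (s i)"
  using N_ge_2 by (auto simp: simple_reflection_defs inW_def intro!: permutes_swap_id)

lemma inWbar_s [simp]: "1 \<le> i \<Longrightarrow> i < N \<Longrightarrow> inWbar N (s i)"
  using inW_s[of i] by (auto simp: inWbar_def) (auto simp: simple_reflection_defs)

lemma s_s [simp]: "i < N \<Longrightarrow> wmul (s i) (s i) = idW"
  using N_ge_2
  by (auto simp: simple_reflection_defs wmul_def idW_def fun_eq_iff transpose_def)

lemma s_s_cancel [simp]: "i < N \<Longrightarrow> inW N w \<Longrightarrow> wmul (s i) (wmul (s i) w) = w"
  by (simp flip: wmul_assoc)

lemma s_s_cancel_right [simp]: "i < N \<Longrightarrow> inW N w \<Longrightarrow> wmul (wmul w (s i)) (s i) = w"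
  by (simp add: wmul_assoc)

lemma winv_s [simp]: "i < N \<Longrightarrow> winv (s i) = s i"
  by (rule winv_unique[symmetric]) simp_all

lemma wroot_s_simple_root: "i < N \<Longrightarrow> wroot (s i) (\<alpha> i) = opp_root (\<alpha> i)"
  using N_ge_2 by (auto simp: simple_reflection_defs wroot_def opp_root_def)

lemma pos_root_wroot_s:
  assumes "i < N" "pos_root N a" "a \<noteq> \<alpha> i"
  shows "pos_root N (wroot (s i) a)"
proof -
  obtain p q k where a: "a = (p,q,k)" by (cases a)
  have "is_root N (wroot (s i) a)" using assms is_root_if_pos by simp
  moreover have "p \<in> {1..N}" "q \<in> {1..N}" "(p < q \<and> 0 \<le> k) \<or> (q < p \<and> 0 < k)"
    using assms(2) by (auto simp: a pos_root_def is_root_def)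
  ultimately show ?thesis using assms(3) N_ge_2 unfolding a
    by (cases "i = 0")
      (auto simp: simple_reflection_defs wroot_def pos_root_def transpose_def split: if_splits)
qed

lemma neg_root_wroot_s_iff:
  assumes i: "i < N" and a: "is_root N a"
  shows "neg_root N (wroot (s i) a) \<longleftrightarrow> a = \<alpha> i \<or> (neg_root N a \<and> a \<noteq> opp_root (\<alpha> i))"
proof -
  consider (simple) "a = \<alpha> i" | (opp) "a = opp_root (\<alpha> i)"
    | (pos) "pos_root N a" "a \<noteq> \<alpha> i" | (neg) "neg_root N a" "a \<noteq> opp_root (\<alpha> i)"
    using a by (auto simp: neg_root_def)
  then show ?thesis
  proof cases
    case pos
    then show ?thesis using pos_root_wroot_s[OF i] by (simp add: neg_root_def)
  next
    case neg
    then have "opp_root a \<noteq> \<alpha> i" by (metis opp_root_opp_root)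
    from pos_root_wroot_s[OF i _ this] neg pos_root_simple[OF i]
    show ?thesis by (auto simp: wroot_opp_root neg_root_def)
  next
    case opp
    moreover have "opp_root (\<alpha> i) \<noteq> \<alpha> i"
      using pos_root_simple[OF i] neg_root_opp_root[of "\<alpha> i"] by (metis neg_root_def)
    ultimately show ?thesis using pos_root_simple[OF i]
      by (simp add: wroot_s_simple_root[OF i] wroot_opp_root neg_root_def)
  qed (use pos_root_simple[OF i] in \<open>simp add: wroot_s_simple_root[OF i]\<close>)
qed

lemma finite_Sset:
  assumes "inW N w"
  shows "finite (Sset N w)"
proof -
  define M where "M = (\<Sum>i\<in>{1..N}. \<bar>snd w i\<bar>)"
  have le_M: "\<bar>snd w i\<bar> \<le> M" if "i \<in> {1..N}" for i
    unfolding M_def using that by (intro member_le_sum) auto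
  have "Sset N w \<subseteq> {1..N} \<times> {1..N} \<times> {0..2*M}"
  proof
    fix a assume a: "a \<in> Sset N w"
    obtain i j k where ijk: "a = (i,j,k)" by (cases a)
    have range: "i \<in> {1..N}" "j \<in> {1..N}" "0 \<le> k"
      using a by (auto simp: Sset_def ijk pos_root_def is_root_def)
    have "k - (snd w (fst w i) - snd w (fst w j)) \<le> 0"
      using a by (auto simp: Sset_def ijk neg_root_def pos_root_def is_root_def wroot_def)
    moreover have "\<bar>snd w (fst w i)\<bar> \<le> M" "\<bar>snd w (fst w j)\<bar> \<le> M"
      using le_M fst_inW_in_range_iff assms range by auto
    ultimately show "a \<in> {1..N} \<times> {1..N} \<times> {0..2*M}" using range by (auto simp: ijk)
  qed
  then show ?thesis by (rule finite_subset) auto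
qed

lemma len_idW [simp]: "len N idW = 0"
  unfolding len_def Sset_def by (auto simp: neg_root_def card_eq_0_iff)

lemma len_s_wmul_if_pos:
  assumes w: "inW N w" and i: "i < N" and pos: "pos_root N (wroot (winv w) (\<alpha> i))"
  shows "len N (wmul (s i) w) = Suc (len N w)"
proof -
  let ?b = "wroot (winv w) (\<alpha> i)"
  have eq_b: "wroot w a = \<alpha> i \<longleftrightarrow> a = ?b" for a
    using w by (metis wroot_winv_cancel)
  have "wroot w a \<noteq> opp_root (\<alpha> i)" if "pos_root N a" for a
  proof
    assume "wroot w a = opp_root (\<alpha> i)"
    then have "a = opp_root ?b" using w by (metis wroot_winv_cancel(2) wroot_opp_root)
    then show False using that pos by (simp add: neg_root_def)
  qed
  then have "Sset N (wmul (s i) w) = insert ?b (Sset N w)"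
    using w i pos by (auto simp: Sset_def wroot_wmul neg_root_wroot_s_iff is_root_if_pos eq_b)
  moreover have "?b \<notin> Sset N w" using w i pos_root_simple by (simp add: Sset_def neg_root_def)
  ultimately show ?thesis unfolding len_def using finite_Sset[OF w] by simp
qed

lemma len_s_wmul_if_neg:
  assumes w: "inW N w" and i: "i < N" and neg: "neg_root N (wroot (winv w) (\<alpha> i))"
  shows "len N w = Suc (len N (wmul (s i) w))"
proof -
  have "pos_root N (wroot (winv (wmul (s i) w)) (\<alpha> i))"
    using w i neg by (simp add: winv_wmul wroot_wmul wroot_s_simple_root wroot_opp_root)
  from len_s_wmul_if_pos[OF _ i this] show ?thesis using w i by simp
qed

lemma len_s_wmul_le: "inW N w \<Longrightarrow> i < N \<Longrightarrow> len N (wmul (s i) w) \<le> Suc (len N w)"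
  using len_s_wmul_if_pos[of w i] len_s_wmul_if_neg[of w i] by (fastforce simp: neg_root_def)

lemma len_winv:
  assumes w: "inW N w"
  shows "len N (winv w) = len N w"
proof -
  have "bij_betw (\<lambda>a. opp_root (wroot w a)) (Sset N w) (Sset N (winv w))"
    by (rule bij_betw_byWitness[where f' = "\<lambda>a. opp_root (wroot (winv w) a)"])
      (use w in \<open>auto simp: Sset_def wroot_opp_root\<close>)
  then show ?thesis unfolding len_def by (metis bij_betw_same_card)
qed

lemma len_wmul_s_if_neg:
  assumes w: "inW N w" and i: "i < N" and neg: "neg_root N (wroot w (\<alpha> i))"
  shows "len N w = Suc (len N (wmul w (s i)))"
proof -
  have "len N (winv w) = Suc (len N (wmul (s i) (winv w)))"
    using len_s_wmul_if_neg[of "winv w" i] w i neg by (simp add: winv_winv)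
  also have "wmul (s i) (winv w) = winv (wmul w (s i))" using w i by (simp add: winv_wmul)
  finally show ?thesis using w i by (simp add: len_winv)
qed

subsection \<open>Reduced expressions\<close>

definition simple_prod :: "nat list \<Rightarrow> W" where
  "simple_prod js = foldr wmul (map s js) idW"

abbreviation pi_pow :: "int \<Rightarrow> W" where "pi_pow \<equiv> wpowi (piW N)"

lemma simple_prod_Nil [simp]: "simple_prod [] = idW"
  by (simp add: simple_prod_def)

lemma simple_prod_Cons [simp]: "simple_prod (i # js) = wmul (s i) (simple_prod js)"
  by (simp add: simple_prod_def)

lemma inW_simple_prod [simp]: "set js \<subseteq> {..<N} \<Longrightarrow> inW N (simple_prod js)"
  by (induction js) auto

lemma inWbar_simple_prod: "set js \<subseteq> {1..<N} \<Longrightarrow> inWbar N (simple_prod js)"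
  by (induction js) auto

lemma simple_prod_snoc:
  "set js \<subseteq> {..<N} \<Longrightarrow> i < N \<Longrightarrow> simple_prod (js @ [i]) = wmul (simple_prod js) (s i)"
  by (induction js) (auto simp: wmul_assoc)

lemma word_eq_simple_prod: "word N k js = wmul (pi_pow k) (simple_prod js)"
  by (simp add: word_def simple_prod_def)

lemma len_simple_prod_le: "set js \<subseteq> {..<N} \<Longrightarrow> len N (simple_prod js) \<le> length js"
proof (induction js)
  case (Cons i js)
  then show ?case using len_s_wmul_le[of "simple_prod js" i] by force
qed simp

lemma reduced_simple_prod_ConsD:
  assumes range: "set (i # js) \<subseteq> {..<N}"
    and reduced: "len N (simple_prod (i # js)) = length (i # js)"
  shows "len N (simple_prod js) = length js"
    and "neg_root N (wroot (winv (simple_prod (i # js))) (\<alpha> i))"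
proof -
  have i: "i < N" and js: "set js \<subseteq> {..<N}" using range by auto
  show len_js: "len N (simple_prod js) = length js"
    using len_simple_prod_le[OF js] len_s_wmul_le[of "simple_prod js" i] reduced i js by simp
  show "neg_root N (wroot (winv (simple_prod (i # js))) (\<alpha> i))"
  proof (rule ccontr)
    assume "\<not> ?thesis"
    then have "pos_root N (wroot (winv (simple_prod (i # js))) (\<alpha> i))"
      using i js by (simp add: neg_root_def)
    from len_s_wmul_if_pos[OF _ i this] show False using reduced len_js i js by simp
  qed
qed

lemma simple_prod_upt:
  assumes "1 \<le> n" "n \<le> N"
  shows "simple_prod [1..<n] =
    ((\<lambda>j. if j = n then 1 else if 1 \<le> j \<and> j < n then Suc j else j), \<lambda>_. 0)"
  using assms
proof (induction n rule: dec_induct)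
  case base
  show ?case by (auto simp: idW_def fun_eq_iff)
next
  case (step n)
  then have "simple_prod [1..<Suc n] = wmul (simple_prod [1..<n]) (s n)"
    using simple_prod_snoc[of "[1..<n]" n] by (auto simp: subset_iff)
  then show ?case using step
    by (auto simp: wmul_def simple_reflection_defs fun_eq_iff transpose_def)
qed

lemma piW_eq: "piW N = ((\<lambda>j. if j = N then 1 else if 1 \<le> j \<and> j < N then Suc j else j), eps 1)"
proof -
  have "piW N = wmul (transl (eps 1)) (simple_prod [1..<N])" by (simp add: piW_def simple_prod_def)
  then show ?thesis using simple_prod_upt[of N] N_ge_2 by (simp add: wmul_def transl_def)
qed

lemma inW_piW [simp]: "inW N (piW N)"
proof -
  have "inW N (transl (eps 1))" using N_ge_2 by (auto simp: transl_def inW_def eps_def)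
  moreover have "inW N (simple_prod [1..<N])" by (rule inW_simple_prod) auto
  ultimately show ?thesis unfolding piW_def using inW_wmul by (simp add: simple_prod_def)
qed

lemma window_piW_wmul:
  assumes "inW N w" "i \<in> {1..N}"
  shows "window (wmul (piW N) w) i = window w i + 1"
proof -
  have "window (piW N) j = int j + 1" if "j \<in> {1..N}" for j
    using that by (auto simp: window_def piW_eq eps_def)
  then show ?thesis
    using assms fst_inW_in_range_iff[of w i] window_wmul[OF inW_piW, of w i]
    by (simp add: window_def[of w])
qed

lemma inW_pi_pow [simp]: "inW N (pi_pow k)"
  by (induction k rule: wpowi_induct) simp_all

lemma window_pi_pow:
  assumes i: "i \<in> {1..N}"
  shows "window (pi_pow k) i = int i + k"
proof -
  have "inW N (pi_pow k) \<and> window (pi_pow k) i = int i + k"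
  proof (induction k rule: wpowi_induct)
    case (pred k v)
    then have "window v i = window (wmul (winv (piW N)) v) i + 1"
      using window_piW_wmul[of "wmul (winv (piW N)) v" i] i by simp
    with pred show ?case by simp
  qed (use i in \<open>simp_all add: window_piW_wmul\<close>)
  then show ?thesis ..
qed

lemma pi_pow_0 [simp]: "pi_pow 0 = idW"
  by (simp add: wpowi_def)

lemma pos_root_wroot_pi_pow:
  assumes "is_root N a"
  shows "pos_root N (wroot (pi_pow k) a) \<longleftrightarrow> pos_root N a"
proof -
  obtain p q l where pql: "a = (p,q,l)" by (cases a)
  have range: "p \<in> {1..N}" "q \<in> {1..N}" using assms by (auto simp: pql is_root_def)
  show ?thesis
    using pos_root_wroot_iff[of "pi_pow k" p q l] assms
    by (simp add: pql pos_root_iff_less window_pi_pow[OF range(1)] window_pi_pow[OF range(2)])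
qed

lemma len_pi_pow_wmul: "inW N w \<Longrightarrow> len N (wmul (pi_pow k) w) = len N w"
  unfolding len_def Sset_def
  by (rule arg_cong[of _ _ card])
    (auto simp: wroot_wmul neg_root_def pos_root_wroot_pi_pow dest: is_root_if_pos)

text \<open>An increasing window whose values stay within one period consists of consecutive integers.\<close>

lemma eq_pi_pow_if_simple_roots_pos:
  assumes w: "inW N w" and pos: "\<And>i. i < N \<Longrightarrow> pos_root N (wroot w (\<alpha> i))"
  shows "w = pi_pow (window w 1 - 1)"
proof (rule window_inject[OF w inW_pi_pow])
  fix i assume i: "i \<in> {1..N}"
  have step: "window w l + 1 \<le> window w (Suc l)" if "1 \<le> l" "l < N" for l
    using pos[of l] that pos_root_wroot_iff[OF w, of l "Suc l" 0] is_root_simple[of l]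
    by (simp add: simple_root_def)
  have "window w N < window w 1 + int N"
    using pos[of 0] N_ge_2 pos_root_wroot_iff[OF w, of N 1 1] is_root_simple[of 0]
    by (simp add: simple_root_def)
  moreover have "window w 1 + int (i - 1) \<le> window w i"
    using add_mult_le_if_increments_ge[of 1 i "window w" 1] step i by simp
  moreover have "window w i + int (N - i) \<le> window w N"
    using add_mult_le_if_increments_ge[of i N "window w" 1] step i by simp
  ultimately have "window w i = int i + (window w 1 - 1)" using i by simp
  then show "window w i = window (pi_pow (window w 1 - 1)) i" by (simp only: window_pi_pow[OF i])
qed

lemma simple_prod_factorization:
  assumes w: "inW N w" and I: "I \<subseteq> {..<N}"
  obtains v js where "inW N v" "set js \<subseteq> I" "w = wmul v (simple_prod js)"
    "len N w = len N v + length js" "\<And>i. i \<in> I \<Longrightarrow> pos_root N (wroot v (\<alpha> i))"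
proof -
  have "\<exists>v js. inW N v \<and> set js \<subseteq> I \<and> w = wmul v (simple_prod js) \<and>
    len N w = len N v + length js \<and> (\<forall>i\<in>I. pos_root N (wroot v (\<alpha> i)))"
    using w
  proof (induction "len N w" arbitrary: w rule: less_induct)
    case less
    show ?case
    proof (cases "\<exists>i\<in>I. neg_root N (wroot w (\<alpha> i))")
      case True
      then obtain i where i: "i \<in> I" "i < N" "neg_root N (wroot w (\<alpha> i))" using I by blast
      have len: "len N w = Suc (len N (wmul w (s i)))"
        using len_wmul_s_if_neg less.prems i by blast
      then obtain v js where v: "inW N v" "\<forall>i\<in>I. pos_root N (wroot v (\<alpha> i))"
        and js: "set js \<subseteq> I" "wmul w (s i) = wmul v (simple_prod js)"
          "len N (wmul w (s i)) = len N v + length js"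
        using less.hyps[of "wmul w (s i)"] less.prems i by auto
      have "set js \<subseteq> {..<N}" using js(1) I by blast
      then have "wmul v (simple_prod (js @ [i])) = w"
        using i v(1) less.prems js(2)
        by (metis inW_simple_prod s_s_cancel_right simple_prod_snoc wmul_assoc)
      moreover have "set (js @ [i]) \<subseteq> I" using js(1) i by simp
      moreover have "len N w = len N v + length (js @ [i])" using len js(3) by simp
      ultimately show ?thesis using v by blast
    next
      case False
      then have "\<forall>i\<in>I. pos_root N (wroot w (\<alpha> i))" using less.prems I by (auto simp: neg_root_def)
      then show ?thesis using less.prems by (intro exI[of _ w] exI[of _ "[]"]) simp
    qed
  qed
  then show ?thesis using that by blast
qed

lemma reduced_expr_exists:
  assumes "inW N w"
  shows "\<exists>e. reduced_expr N w e"
proof -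
  obtain v js where v: "inW N v" "\<And>i. i \<in> {..<N} \<Longrightarrow> pos_root N (wroot v (\<alpha> i))"
    and js: "set js \<subseteq> {..<N}" "w = wmul v (simple_prod js)" "len N w = len N v + length js"
    using simple_prod_factorization[OF assms subset_refl] by metis
  define k where "k = window v 1 - 1"
  have v_eq: "v = pi_pow k" unfolding k_def using eq_pi_pow_if_simple_roots_pos v by blast
  then have "len N v = 0" using len_pi_pow_wmul[of idW k] by simp
  then have "reduced_expr N w (k, js)"
    using js by (auto simp: reduced_expr_def word_eq_simple_prod v_eq)
  then show ?thesis ..
qed

lemma eq_idW_if_finite_simple_roots_pos:
  assumes w: "inWbar N w" and pos: "\<And>i. i \<in> {1..<N} \<Longrightarrow> pos_root N (wroot w (\<alpha> i))"
  shows "w = idW"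
proof -
  have iw: "inW N w" using w by simp
  have "pos_root N (wroot w (\<alpha> 0))"
    using is_root_wroot[OF iw, of "\<alpha> 0"] N_ge_2
    by (auto simp: simple_root_def wroot_def snd_inWbar[OF w] pos_root_def is_root_def)
  then have "pos_root N (wroot w (\<alpha> i))" if "i < N" for i using pos that by (cases "i = 0") auto
  note w_eq = eq_pi_pow_if_simple_roots_pos[OF iw this]
  have "window w i = int i + (window w 1 - 1)" if "i \<in> {1..N}" for i
    using window_pi_pow[OF that] w_eq by metis
  from this[of N] have "int (fst w N) = int N + (int (fst w 1) - 1)"
    using N_ge_2 by (simp add: window_def snd_inWbar[OF w])
  moreover have "fst w 1 \<ge> 1" "fst w N \<le> N"
    using fst_inW_in_range_iff[OF iw, of 1] fst_inW_in_range_iff[OF iw, of N] N_ge_2 by auto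
  ultimately have "window w 1 = 1" by (simp add: window_def snd_inWbar[OF w])
  then show ?thesis using w_eq by simp
qed

lemma reduced_expr_finite_exists:
  assumes w: "inWbar N w"
  shows "\<exists>js. set js \<subseteq> {1..<N} \<and> reduced_expr N w (0, js)"
proof -
  have "{1..<N} \<subseteq> {..<N}" by auto
  then obtain v js where v: "inW N v" "\<And>i. i \<in> {1..<N} \<Longrightarrow> pos_root N (wroot v (\<alpha> i))"
    and js: "set js \<subseteq> {1..<N}" "w = wmul v (simple_prod js)" "len N w = len N v + length js"
    using simple_prod_factorization[OF inW_if_inWbar[OF w]] by metis
  have u: "inWbar N (simple_prod js)" using inWbar_simple_prod js(1) .
  then have "v = wmul w (winv (simple_prod js))" using js(2) v(1) by (simp add: wmul_assoc)
  then have "inWbar N v" using w u by simp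
  then have "v = idW" using eq_idW_if_finite_simple_roots_pos v(2) by blast
  then have "reduced_expr N w (0, js)" using js by (auto simp: reduced_expr_def word_eq_simple_prod)
  then show ?thesis using js(1) by blast
qed

end

subsection \<open>Ordered partitions\<close>

fun cut_points :: "nat list \<Rightarrow> nat set" where
  "cut_points [] = {}"
| "cut_points [a] = {}"
| "cut_points (a # b # g) = insert a ((+) a ` cut_points (b # g))"

lemma same_block_Cons:
  "same_block (a # g) i j \<longleftrightarrow>
    (1 \<le> i \<and> i \<le> a \<and> 1 \<le> j \<and> j \<le> a) \<or> (a < i \<and> a < j \<and> same_block g (i - a) (j - a))"
proof -
  have "same_block (a # g) i j \<longleftrightarrow> (in_block (a # g) 0 i \<and> in_block (a # g) 0 j)
      \<or> (\<exists>k < length g. in_block (a # g) (Suc k) i \<and> in_block (a # g) (Suc k) j)"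
    unfolding same_block_def by (auto simp: less_Suc_eq_0_disj)
  moreover have "in_block (a # g) 0 l \<longleftrightarrow> 1 \<le> l \<and> l \<le> a" for l
    by (auto simp: in_block_def)
  moreover have "in_block (a # g) (Suc k) l \<longleftrightarrow> a < l \<and> in_block g k (l - a)" for k l
    by (auto simp: in_block_def)
  ultimately show ?thesis by (auto simp: same_block_def)
qed

lemma same_block_iff_no_cut_point:
  assumes "1 \<le> i" "i < j" "j \<le> sum_list g"
  shows "same_block g i j \<longleftrightarrow> {i..<j} \<inter> cut_points g = {}"
  using assms
proof (induction g arbitrary: i j rule: cut_points.induct)
  case (3 a b g)
  consider (head) "j \<le> a" | (cut) "i \<le> a" "a < j" | (tail) "a < i" by linarith
  then show ?case
  proof cases
    case tail
    have "same_block (a # b # g) i j \<longleftrightarrow> same_block (b # g) (i - a) (j - a)"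
      using tail "3.prems" by (subst same_block_Cons) auto
    also have "\<dots> \<longleftrightarrow> {i - a..<j - a} \<inter> cut_points (b # g) = {}"
      using tail "3.prems" by (intro "3.IH") auto
    also have "\<dots> \<longleftrightarrow> (+) a ` ({i - a..<j - a} \<inter> cut_points (b # g)) = {}" by blast
    also have "(+) a ` ({i - a..<j - a} \<inter> cut_points (b # g))
        = {i..<j} \<inter> (+) a ` cut_points (b # g)"
      using tail "3.prems" by (subst image_Int) auto
    also have "\<dots> = {i..<j} \<inter> cut_points (a # b # g)" using tail by auto
    finally show ?thesis .
  qed (use "3.prems" in \<open>auto simp: same_block_Cons[of a]\<close>)
qed (auto simp: same_block_Cons)

lemma Pi_g_eq_cut_points:
  assumes "is_opart N g"
  shows "Pi_g N g = {1..<N} - cut_points g"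
proof -
  have "same_block g i (Suc i) \<longleftrightarrow> i \<notin> cut_points g" if "1 \<le> i" "i < N" for i
    using same_block_iff_no_cut_point[of i "Suc i" g] that assms
    by (auto simp: is_opart_def less_Suc_eq_le)
  then show ?thesis by (auto simp: Pi_g_def)
qed

lemma cut_points_subset: "\<forall>x\<in>set g. 0 < x \<Longrightarrow> cut_points g \<subseteq> {1..<sum_list g}"
  by (induction g rule: cut_points.induct) fastforce+

lemma cut_points_eq:
  assumes "is_opart N g"
  shows "cut_points g = {1..<N} - Pi_g N g"
  using Pi_g_eq_cut_points[OF assms] cut_points_subset[of g] assms by (auto simp: is_opart_def)

lemma ex_opart_cut_points:
  assumes "1 \<le> N" "D \<subseteq> {1..<N}"
  shows "\<exists>g. is_opart N g \<and> cut_points g = D"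
  using assms
proof (induction N arbitrary: D rule: less_induct)
  case (less N)
  show ?case
  proof (cases "D = {}")
    case True
    then have "is_opart N [N] \<and> cut_points [N] = D" using less.prems by (simp add: is_opart_def)
    then show ?thesis by blast
  next
    case False
    define a where "a = Min D"
    have fin: "finite D" using less.prems(2) finite_subset by blast
    have a: "a \<in> D" "1 \<le> a" "a < N"
      using Min_in[OF fin False] less.prems(2) by (auto simp: a_def)
    define D' where "D' = {d. 1 \<le> d \<and> a + d \<in> D}"
    have shift: "insert a ((+) a ` D') = D"
    proof (intro equalityI subsetI)
      fix d assume d: "d \<in> D"
      then have "a \<le> d" unfolding a_def using fin by (rule Min_le[rotated])
      then have "d = a \<or> d - a \<in> D' \<and> d = a + (d - a)" using d by (auto simp: D'_def)
      then show "d \<in> insert a ((+) a ` D')" by blast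
    qed (use a in \<open>auto simp: D'_def\<close>)
    have "N - a < N" "1 \<le> N - a" using a by auto
    moreover have "D' \<subseteq> {1..<N - a}"
    proof
      fix d assume "d \<in> D'"
      then have "1 \<le> d" "a + d < N" using less.prems(2) by (auto simp: D'_def)
      then show "d \<in> {1..<N - a}" by simp
    qed
    ultimately obtain g where g: "is_opart (N - a) g" "cut_points g = D'"
      using less.IH[of "N - a" D'] by blast
    obtain b t where bt: "g = b # t" using g(1) a by (cases g) (auto simp: is_opart_def)
    have "is_opart N (a # g)" using g(1) a by (auto simp: is_opart_def)
    moreover have "cut_points (a # g) = D" using g(2) shift by (simp add: bt)
    ultimately show ?thesis by blast
  qed
qed

lemma opart_eqI: "is_opart N g \<Longrightarrow> is_opart N g' \<Longrightarrow> cut_points g = cut_points g' \<Longrightarrow> g = g'"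
proof (induction g arbitrary: N g' rule: cut_points.induct)
  case 1
  then show ?case by (cases g') (auto simp: is_opart_def)
next
  case (2 a)
  then show ?case by (cases g' rule: cut_points.cases) (auto simp: is_opart_def)
next
  case (3 a b t)
  obtain a' b' t' where g': "g' = a' # b' # t'"
    using "3.prems" by (cases g' rule: cut_points.cases) (auto simp: is_opart_def)
  have pos: "cut_points (b # t) \<subseteq> {1..}" "cut_points (b' # t') \<subseteq> {1..}"
    using cut_points_subset[of "b # t"] cut_points_subset[of "b' # t'"] "3.prems"(1,2)
    by (auto simp: is_opart_def g')
  have eq: "insert a ((+) a ` cut_points (b # t)) = insert a' ((+) a' ` cut_points (b' # t'))"
    using "3.prems"(3) by (simp add: g')
  then have "a \<ge> a'" "a' \<ge> a" by auto
  then have head: "a' = a" by simp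
  have "a \<notin> (+) a ` cut_points (b # t)" "a \<notin> (+) a ` cut_points (b' # t')" using pos by auto
  then have "(+) a ` cut_points (b # t) = (+) a ` cut_points (b' # t')"
    using eq unfolding head by (simp add: insert_ident)
  then have "cut_points (b # t) = cut_points (b' # t')" by (simp add: inj_image_eq_iff)
  moreover have "is_opart (N - a) (b # t)" "is_opart (N - a) (b' # t')"
    using "3.prems"(1,2) by (auto simp: is_opart_def g' head)
  ultimately have "b # t = b' # t'" using "3.IH" by blast
  then show ?case by (simp add: g' head)
qed

lemma ex1_opart_Pi_g:
  assumes "1 \<le> N" "D \<subseteq> {1..<N}"
  shows "\<exists>!g. is_opart N g \<and> Pi_g N g = D"
proof (rule ex_ex1I)
  obtain g where g: "is_opart N g" "cut_points g = {1..<N} - D"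
    using ex_opart_cut_points[of N "{1..<N} - D"] assms(1) by auto
  then show "\<exists>g. is_opart N g \<and> Pi_g N g = D"
    using Pi_g_eq_cut_points[OF g(1)] assms(2) by blast
next
  fix g g' assume "is_opart N g \<and> Pi_g N g = D" "is_opart N g' \<and> Pi_g N g' = D"
  then show "g = g'" using cut_points_eq opart_eqI by metis
qed

lemma Pi_g_range: "j \<in> Pi_g N g \<Longrightarrow> 1 \<le> j \<and> j < N"
  by (simp add: Pi_g_def)

context extended_affine_weyl
begin

lemma Pi_g_beta_of:
  "Pi_g N (beta_of N b w) = {i. 1 \<le> i \<and> i < N \<and> (\<exists>a\<in>Rbar_g_pos N b. wroot w a = \<alpha> i)}"
proof -
  let ?D = "{i. 1 \<le> i \<and> i < N \<and> (\<exists>a\<in>Rbar_g_pos N b. wroot w a = (i, Suc i, 0))}"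
  have "\<exists>!g. is_opart N g \<and> Pi_g N g = ?D" using N_ge_2 by (intro ex1_opart_Pi_g) auto
  from theI'[OF this] have "Pi_g N (beta_of N b w) = ?D" unfolding beta_of_def by blast
  then show ?thesis by (auto simp: simple_root_finite)
qed

lemma s_in_Wbar_g: "j \<in> Pi_g N g \<Longrightarrow> s j \<in> Wbar_g N g"
  by (metis Wbar_g.intros wmul_idW_right)

lemma inWbar_Wbar_g: "u \<in> Wbar_g N g \<Longrightarrow> inWbar N u"
  by (induction rule: Wbar_g.induct) (auto dest: Pi_g_range)

lemma ex_neg_simple_root_between:
  assumes w: "inW N w" and pq: "1 \<le> p" "p < q" "q \<le> N" and neg: "\<not> pos_root N (wroot w (p,q,0))"
  shows "\<exists>l. p \<le> l \<and> l < q \<and> neg_root N (wroot w (\<alpha> l))"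
proof (rule ccontr)
  assume none: "\<not> ?thesis"
  have "window w l + 1 \<le> window w (Suc l)" if "p \<le> l" "l < q" for l
  proof -
    have "pos_root N (wroot w (\<alpha> l))" using none that w pq by (auto simp: neg_root_def)
    then show ?thesis
      using pos_root_wroot_iff[OF w, of l "Suc l" 0] that pq
      by (simp add: simple_root_finite is_root_def)
  qed
  then have "window w p + int (q - p) \<le> window w q"
    using add_mult_le_if_increments_ge[of p q "window w" 1] pq by simp
  then show False using neg pq pos_root_wroot_iff[OF w, of p q 0] by (simp add: is_root_def)
qed

end

subsection \<open>Minimal coset representatives of a standard parabolic subgroup\<close>

locale parabolic = extended_affine_weyl +
  fixes \<beta> :: "nat list"
  assumes opart: "is_opart N \<beta>"
begin

abbreviation Pi\<^sub>\<beta> :: "nat set" where "Pi\<^sub>\<beta> \<equiv> Pi_g N \<beta>"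
abbreviation R\<^sub>\<beta> :: "aroot set" where "R\<^sub>\<beta> \<equiv> Rbar_g_pos N \<beta>"

definition block :: "nat \<Rightarrow> nat" where
  "block i = card ({1..<i} - Pi\<^sub>\<beta>)"

lemma block_mono: "i \<le> j \<Longrightarrow> block i \<le> block j"
  unfolding block_def by (rule card_mono) auto

lemma block_eq_iff:
  assumes "1 \<le> i" "i < j"
  shows "block i = block j \<longleftrightarrow> {i..<j} \<subseteq> Pi\<^sub>\<beta>"
proof -
  have split: "{1..<j} - Pi\<^sub>\<beta> = ({1..<i} - Pi\<^sub>\<beta>) \<union> ({i..<j} - Pi\<^sub>\<beta>)" using assms by auto
  have "block j = block i + card ({i..<j} - Pi\<^sub>\<beta>)"
    unfolding block_def split by (rule card_Un_disjoint) auto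
  then show ?thesis by auto
qed

lemma Rbar_g_pos_iff:
  "(p,q,k) \<in> R\<^sub>\<beta> \<longleftrightarrow> k = 0 \<and> 1 \<le> p \<and> p < q \<and> q \<le> N \<and> block p = block q"
proof -
  have "same_block \<beta> p q \<longleftrightarrow> block p = block q" if "1 \<le> p" "p < q" "q \<le> N"
  proof -
    have "same_block \<beta> p q \<longleftrightarrow> {p..<q} \<inter> cut_points \<beta> = {}"
      using that opart by (intro same_block_iff_no_cut_point) (auto simp: is_opart_def)
    also have "\<dots> \<longleftrightarrow> {p..<q} \<subseteq> Pi\<^sub>\<beta>"
      using that by (auto simp: Pi_g_eq_cut_points[OF opart])
    also have "\<dots> \<longleftrightarrow> block p = block q" using block_eq_iff that by simp
    finally show ?thesis .
  qed
  then show ?thesis by (auto simp: Rbar_g_pos_def)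
qed

lemma simple_root_in_R: "j \<in> Pi\<^sub>\<beta> \<Longrightarrow> \<alpha> j \<in> R\<^sub>\<beta>"
  using Pi_g_range[of j N \<beta>] block_eq_iff[of j "Suc j"]
  by (auto simp: simple_root_finite Rbar_g_pos_iff)

lemma pos_root_if_in_R: "a \<in> R\<^sub>\<beta> \<Longrightarrow> pos_root N a"
  by (cases a) (auto simp: Rbar_g_pos_iff pos_root_def is_root_def)

lemma wroot_s_outside_R:
  assumes i: "i \<in> Pi\<^sub>\<beta>" and a: "pos_root N a" "a \<notin> R\<^sub>\<beta>"
  shows "pos_root N (wroot (s i) a)" "wroot (s i) a \<notin> R\<^sub>\<beta>"
proof -
  have range: "1 \<le> i" "i < N" using Pi_g_range[OF i] by auto
  have "a \<noteq> \<alpha> i" using a simple_root_in_R[OF i] by auto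
  then show "pos_root N (wroot (s i) a)" using pos_root_wroot_s a range by blast
  obtain p q k where pqk: "a = (p,q,k)" by (cases a)
  have block: "block (transpose i (Suc i) l) = block l" for l
    using simple_root_in_R[OF i] range
    by (auto simp: transpose_def simple_root_finite Rbar_g_pos_iff)
  have s_pqk: "wroot (s i) (p,q,k) = (transpose i (Suc i) p, transpose i (Suc i) q, k)"
    using range by (simp add: wroot_def simple_reflection_defs)
  show "wroot (s i) a \<notin> R\<^sub>\<beta>"
    using a by (auto simp: s_pqk pqk Rbar_g_pos_iff block pos_root_def is_root_def)
qed

lemma wroot_winv_Wbar_g_outside_R:
  assumes "u \<in> Wbar_g N \<beta>" "pos_root N a" "a \<notin> R\<^sub>\<beta>"
  shows "pos_root N (wroot (winv u) a) \<and> wroot (winv u) a \<notin> R\<^sub>\<beta>"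
  using assms
proof (induction arbitrary: a rule: Wbar_g.induct)
  case (2 i w)
  have "i < N" "inW N w" using Pi_g_range[OF 2(1)] inWbar_Wbar_g[OF 2(2)] by auto
  then have "wroot (winv (wmul (s i) w)) a = wroot (winv w) (wroot (s i) a)"
    by (simp add: winv_wmul wroot_wmul)
  then show ?case using 2 wroot_s_outside_R[OF 2(1)] by simp
qed simp

lemma ex_neg_simple_root:
  assumes w: "inW N w" and a: "a \<in> R\<^sub>\<beta>" "\<not> pos_root N (wroot w a)"
  shows "\<exists>j\<in>Pi\<^sub>\<beta>. neg_root N (wroot w (\<alpha> j))"
proof -
  obtain p q k where pqk: "a = (p,q,k)" by (cases a)
  then have "k = 0" "1 \<le> p" "p < q" "q \<le> N" "{p..<q} \<subseteq> Pi\<^sub>\<beta>"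
    using a(1) block_eq_iff[of p q] by (auto simp: Rbar_g_pos_iff)
  then show ?thesis using ex_neg_simple_root_between[OF w, of p q] a(2) pqk by auto
qed

lemma Wmin_iff: "w \<in> Wmin N \<beta> \<longleftrightarrow> inW N w \<and> (\<forall>a\<in>R\<^sub>\<beta>. pos_root N (wroot w a))"
proof (intro iffI conjI ballI)
  assume w: "w \<in> Wmin N \<beta>"
  then show inW: "inW N w" by (simp add: Wmin_def)
  fix a assume a: "a \<in> R\<^sub>\<beta>"
  show "pos_root N (wroot w a)"
  proof (rule ccontr)
    assume "\<not> pos_root N (wroot w a)"
    then obtain j where j: "j \<in> Pi\<^sub>\<beta>" "neg_root N (wroot w (\<alpha> j))"
      using ex_neg_simple_root[OF inW a] by blast
    then have "len N w = Suc (len N (wmul w (s j)))"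
      using len_wmul_s_if_neg[OF inW] Pi_g_range by blast
    then show False using w s_in_Wbar_g[OF j(1)] by (auto simp: Wmin_def)
  qed
next
  assume w: "inW N w \<and> (\<forall>a\<in>R\<^sub>\<beta>. pos_root N (wroot w a))"
  have "len N w \<le> len N (wmul w u)" if u: "u \<in> Wbar_g N \<beta>" for u
  proof -
    have iu: "inW N u" using inWbar_Wbar_g[OF u] by simp
    have "wroot (winv u) a \<in> Sset N (wmul w u)" if a: "a \<in> Sset N w" for a
    proof -
      have pos: "pos_root N a" and neg: "neg_root N (wroot w a)" using a by (simp_all add: Sset_def)
      then have "a \<notin> R\<^sub>\<beta>" using w unfolding neg_root_def by blast
      then show ?thesis using wroot_winv_Wbar_g_outside_R[OF u pos] neg w iu
        by (simp add: Sset_def wroot_wmul)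
    qed
    moreover have "inj_on (wroot (winv u)) (Sset N w)"
      by (rule inj_on_inverseI[of _ "wroot u"]) (simp add: iu)
    ultimately show ?thesis unfolding len_def
      using w iu
      by (intro card_inj_on_le[of "wroot (winv u)"] image_subsetI finite_Sset inW_wmul) auto
  qed
  then show "w \<in> Wmin N \<beta>" using w by (simp add: Wmin_def)
qed

lemma inW_Wmin [simp]: "w \<in> Wmin N \<beta> \<Longrightarrow> inW N w"
  by (simp add: Wmin_def)

lemma WminI: "inW N w \<Longrightarrow> (\<And>a. a \<in> R\<^sub>\<beta> \<Longrightarrow> pos_root N (wroot w a)) \<Longrightarrow> w \<in> Wmin N \<beta>"
  unfolding Wmin_iff by blast

lemma WminD: "w \<in> Wmin N \<beta> \<Longrightarrow> a \<in> R\<^sub>\<beta> \<Longrightarrow> pos_root N (wroot w a)"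
  unfolding Wmin_iff by blast

lemma idW_in_Wmin: "idW \<in> Wmin N \<beta>"
  using pos_root_if_in_R by (intro WminI) auto

lemma opp_root_wroot_winv_notin_R:
  assumes y: "y \<in> Wmin N \<beta>" and i: "i < N"
  shows "opp_root (wroot (winv y) (\<alpha> i)) \<notin> R\<^sub>\<beta>"
proof
  assume "opp_root (wroot (winv y) (\<alpha> i)) \<in> R\<^sub>\<beta>"
  from WminD[OF y this] show False
    using y pos_root_simple[OF i] by (simp add: wroot_opp_root neg_root_def)
qed

lemma s_wmul_in_Wmin_iff:
  assumes y: "y \<in> Wmin N \<beta>" and i: "i < N"
  shows "wmul (s i) y \<in> Wmin N \<beta> \<longleftrightarrow> wroot (winv y) (\<alpha> i) \<notin> R\<^sub>\<beta>"
proof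
  have iy: "inW N y" using y by simp
  assume "wmul (s i) y \<in> Wmin N \<beta>"
  from WminD[OF this, of "wroot (winv y) (\<alpha> i)"] show "wroot (winv y) (\<alpha> i) \<notin> R\<^sub>\<beta>"
    using iy i pos_root_simple[OF i] by (auto simp: wroot_wmul wroot_s_simple_root neg_root_def)
next
  have iy: "inW N y" using y by simp
  assume notin: "wroot (winv y) (\<alpha> i) \<notin> R\<^sub>\<beta>"
  show "wmul (s i) y \<in> Wmin N \<beta>"
  proof (rule WminI)
    fix a assume a: "a \<in> R\<^sub>\<beta>"
    then have "wroot y a \<noteq> \<alpha> i" using notin iy by (metis wroot_winv_cancel(2))
    then show "pos_root N (wroot (wmul (s i) y) a)"
      using pos_root_wroot_s[OF i WminD[OF y a]] i by (simp add: wroot_wmul)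
  qed (use iy i in simp)
qed

lemma s_wmul_in_Wmin_if_neg:
  assumes x: "x \<in> Wmin N \<beta>" and u: "inW N u" "wmul u x \<in> Wmin N \<beta>"
    and i: "i < N" "neg_root N (wroot (winv u) (\<alpha> i))"
  shows "wmul (s i) (wmul u x) \<in> Wmin N \<beta>"
proof -
  have "wroot x (wroot (winv (wmul u x)) (\<alpha> i)) = wroot (winv u) (\<alpha> i)"
    using u(1) x by (simp add: winv_wmul wroot_wmul)
  then have "wroot (winv (wmul u x)) (\<alpha> i) \<notin> R\<^sub>\<beta>"
    using WminD[OF x] i(2) by (fastforce simp: neg_root_def)
  then show ?thesis using s_wmul_in_Wmin_iff[OF u(2) i(1)] by blast
qed

text \<open>A sum of two roots in the parabolic subsystem cannot be sent to a simple root, because both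
  summands are sent to positive roots.\<close>

lemma simple_root_if_image_simple:
  assumes x: "x \<in> Wmin N \<beta>" and i: "1 \<le> i" "i < N" and in_R: "wroot (winv x) (\<alpha> i) \<in> R\<^sub>\<beta>"
  shows "\<exists>j\<in>Pi\<^sub>\<beta>. wroot (winv x) (\<alpha> i) = \<alpha> j"
proof -
  obtain p q k where pqk: "wroot (winv x) (\<alpha> i) = (p,q,k)" by (cases "wroot (winv x) (\<alpha> i)")
  have ix: "inW N x" using x by simp
  have pq: "k = 0" "1 \<le> p" "p < q" "q \<le> N" "block p = block q"
    using in_R by (auto simp: pqk Rbar_g_pos_iff)
  have "q = Suc p"
  proof (rule ccontr)
    assume ne: "q \<noteq> Suc p"
    have "block (Suc p) = block p"
      using block_mono[of p "Suc p"] block_mono[of "Suc p" q] pq by simp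
    then have "(p, Suc p, 0) \<in> R\<^sub>\<beta>" "(Suc p, q, 0) \<in> R\<^sub>\<beta>"
      using pq ne by (simp_all add: Rbar_g_pos_iff)
    then have "pos_root N (wroot x (p, Suc p, 0))" "pos_root N (wroot x (Suc p, q, 0))"
      using WminD[OF x] by blast+
    then have "window x p < window x (Suc p)" "window x (Suc p) < window x q"
      using pos_root_wroot_iff[OF ix] pq ne by (simp_all add: is_root_def)
    moreover have "wroot x (p,q,0) = \<alpha> i" using pqk pq(1) ix by (metis wroot_winv_cancel(1))
    then have "window x q = window x p + 1"
      by (auto simp: simple_root_finite[OF i(1)] wroot_def window_def)
    ultimately show False by simp
  qed
  then have "wroot (winv x) (\<alpha> i) = \<alpha> p" "p \<in> Pi\<^sub>\<beta>"
    using pq block_eq_iff[of p q] by (auto simp: pqk simple_root_finite)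
  then show ?thesis by blast
qed

subsection \<open>The representatives \<open>X\<^sup>\<beta>\<close>\<close>

text \<open>The image of the negative roots under the longest element of the parabolic subgroup; it is
  again a system of positive roots.\<close>

definition flipped_roots :: "aroot set" where
  "flipped_roots = R\<^sub>\<beta> \<union> {a. neg_root N a \<and> opp_root a \<notin> R\<^sub>\<beta>}"

lemma flipped_roots_iff:
  "(p,q,k) \<in> flipped_roots \<longleftrightarrow> is_root N (p,q,k) \<and>
    (k < 0 \<or> k = 0 \<and> (block q < block p \<or> block p = block q \<and> p < q))"
  using block_mono[of p q] block_mono[of q p]
  unfolding flipped_roots_def neg_root_def pos_root_def
  by (auto simp: Rbar_g_pos_iff opp_root_def is_root_def)

lemma flipped_roots_add:
  assumes "(p,q,k) \<in> flipped_roots" "(q,r,l) \<in> flipped_roots" "p \<noteq> r"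
  shows "(p,r,k + l) \<in> flipped_roots"
  using assms by (auto simp: flipped_roots_iff is_root_def)

lemma flipped_roots_face:
  assumes "(p,q,k) \<in> flipped_roots" "(q,r,l) \<in> flipped_roots" "(p,r,k + l) \<in> R\<^sub>\<beta>"
  shows "(p,q,k) \<in> R\<^sub>\<beta>" "(q,r,l) \<in> R\<^sub>\<beta>"
  using assms by (auto simp: flipped_roots_iff Rbar_g_pos_iff is_root_def)

lemma opp_root_notin_flipped_roots: "a \<in> flipped_roots \<Longrightarrow> opp_root a \<notin> flipped_roots"
  by (cases a) (auto simp: flipped_roots_iff opp_root_def)

definition finite_part :: "W \<Rightarrow> W" where
  "finite_part x = (fst x, \<lambda>_. 0)"

lemma inWbar_finite_part [simp]: "inW N x \<Longrightarrow> inWbar N (finite_part x)"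
  by (simp add: inWbar_def inW_def finite_part_def)

lemma Wmin_finite_part_iff:
  assumes x: "inW N x" and mono: "\<And>i. 1 \<le> i \<Longrightarrow> i < N \<Longrightarrow> snd x i \<le> snd x (Suc i)"
  shows "finite_part x \<in> Wmin N \<beta> \<longleftrightarrow> x \<in> Wmin N \<beta>"
proof -
  have "pos_root N (wroot (finite_part x) a) \<longleftrightarrow> pos_root N (wroot x a)" if a: "a \<in> R\<^sub>\<beta>" for a
  proof -
    obtain p q k where pqk: "a = (p,q,k)" by (cases a)
    have k: "k = 0" using a by (simp add: pqk Rbar_g_pos_iff)
    have "is_root N (wroot x a)" using x is_root_if_pos[OF pos_root_if_in_R[OF a]] by simp
    then have root: "fst x p \<in> {1..N}" "fst x q \<in> {1..N}" "fst x p \<noteq> fst x q"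
      by (auto simp: pqk wroot_def is_root_def)
    have "snd x i \<le> snd x j" if "1 \<le> i" "i \<le> j" "j \<le> N" for i j
      using add_mult_le_if_increments_ge[of i j "snd x" 0] mono that by simp
    then have "fst x p \<le> fst x q \<Longrightarrow> snd x (fst x p) \<le> snd x (fst x q)"
      and "fst x q \<le> fst x p \<Longrightarrow> snd x (fst x q) \<le> snd x (fst x p)" using root by auto
    then show ?thesis using root
      by (auto simp: pqk k finite_part_def wroot_def pos_root_def is_root_def)
  qed
  then show ?thesis using x by (auto simp: Wmin_iff)
qed

lemma wroot_winv_finite_part:
  assumes "inW N x"
  shows "wroot (winv (finite_part x)) (i,j,k) = (inv (fst x) i, inv (fst x) j, k)"
  using wroot_winv[OF inW_if_inWbar[OF inWbar_finite_part[OF assms]]] by (simp add: finite_part_def)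

lemma ex1_inP_increments:
  "\<exists>!\<eta>. inP N \<eta> \<and> \<eta> 1 = 0 \<and> (\<forall>i. 1 \<le> i \<and> i < N \<longrightarrow> \<eta> i - \<eta> (Suc i) = d i)"
proof (rule ex1I)
  let ?\<eta> = "\<lambda>i. if i \<in> {1..N} then - (\<Sum>j=1..<i. d j) else 0"
  show "inP N ?\<eta> \<and> ?\<eta> 1 = 0 \<and> (\<forall>i. 1 \<le> i \<and> i < N \<longrightarrow> ?\<eta> i - ?\<eta> (Suc i) = d i)"
    by (auto simp: inP_def)
  fix \<eta> assume \<eta>: "inP N \<eta> \<and> \<eta> 1 = 0 \<and> (\<forall>i. 1 \<le> i \<and> i < N \<longrightarrow> \<eta> i - \<eta> (Suc i) = d i)"
  have "\<eta> i = - (\<Sum>j=1..<i. d j)" if "1 \<le> i" "i \<le> N" for i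
  proof -
    have "\<eta> i - \<eta> 1 = (\<Sum>j=1..<i. \<eta> (Suc j) - \<eta> j)" by (rule sum_Suc_diff'[OF that(1), symmetric])
    also have "\<dots> = (\<Sum>j=1..<i. - d j)"
    proof (rule sum.cong)
      fix j assume "j \<in> {1..<i}"
      then have "\<eta> j - \<eta> (Suc j) = d j" using \<eta> that by simp
      then show "\<eta> (Suc j) - \<eta> j = - d j" by simp
    qed simp
    finally show ?thesis using \<eta> by (simp add: sum_negf)
  qed
  then show "\<eta> = ?\<eta>" using \<eta> by (auto simp: inP_def)
qed

lemma eta_w_props:
  assumes w: "inWbar N w"
  shows "inP N (eta_w N \<beta> w)"
    "\<And>i. 1 \<le> i \<Longrightarrow> i < N \<Longrightarrow> eta_w N \<beta> w (Suc i) = eta_w N \<beta> w i +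
      (if pos_root N (wroot (winv w) (\<alpha> i)) \<and> wroot (winv w) (\<alpha> i) \<notin> R\<^sub>\<beta> then 1 else 0)"
proof -
  let ?C = "\<lambda>i. \<exists>a. pos_root N a \<and> (\<exists>i' j'. a = (i',j',0)) \<and> a \<notin> R\<^sub>\<beta> \<and> wroot w a = (i, Suc i, 0)"
  have C_iff: "?C i \<longleftrightarrow> pos_root N (wroot (winv w) (\<alpha> i)) \<and> wroot (winv w) (\<alpha> i) \<notin> R\<^sub>\<beta>"
    if "1 \<le> i" for i
  proof -
    have "wroot w a = (i, Suc i, 0) \<longleftrightarrow> a = wroot (winv w) (\<alpha> i)" for a
      using w wroot_winv_cancel[of w] by (metis inW_if_inWbar simple_root_finite[OF that])
    moreover have "\<exists>i' j'. wroot (winv w) (\<alpha> i) = (i',j',0)"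
      using w by (simp add: simple_root_finite[OF that] wroot_winv snd_inWbar)
    ultimately show ?thesis by auto
  qed
  have "inP N (eta_w N \<beta> w) \<and> eta_w N \<beta> w 1 = 0 \<and> (\<forall>i. 1 \<le> i \<and> i < N \<longrightarrow>
      eta_w N \<beta> w i - eta_w N \<beta> w (Suc i) = (if ?C i then - 1 else 0))"
    unfolding eta_w_def by (rule theI'[OF ex1_inP_increments])
  then have "inP N (eta_w N \<beta> w)" and increment: "\<And>i. 1 \<le> i \<Longrightarrow> i < N \<Longrightarrow>
      eta_w N \<beta> w i - eta_w N \<beta> w (Suc i) = (if ?C i then - 1 else 0)" by blast+
  then show "inP N (eta_w N \<beta> w)" by blast
  show "eta_w N \<beta> w (Suc i) = eta_w N \<beta> w i +
      (if pos_root N (wroot (winv w) (\<alpha> i)) \<and> wroot (winv w) (\<alpha> i) \<notin> R\<^sub>\<beta> then 1 else 0)"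
    if "1 \<le> i" "i < N" for i
    using increment[OF that] unfolding C_iff[OF that(1)] by (simp split: if_splits)
qed

lemma wroot_winv_flipped_iff:
  assumes x: "inW N x" and w: "finite_part x \<in> Wmin N \<beta>" and i: "1 \<le> i" "i < N"
  defines "\<eta> \<equiv> eta_w N \<beta> (finite_part x)"
  shows "wroot (winv x) (\<alpha> i) \<in> flipped_roots \<longleftrightarrow> snd x i - \<eta> i \<le> snd x (Suc i) - \<eta> (Suc i)"
proof -
  let ?w = "finite_part x"
  let ?p = "inv (fst x) i" and ?q = "inv (fst x) (Suc i)" and ?k = "snd x i - snd x (Suc i)"
  have w_\<alpha>: "wroot (winv ?w) (\<alpha> i) = (?p,?q,0)" and x_\<alpha>: "wroot (winv x) (\<alpha> i) = (?p,?q,?k)"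
    using x i wroot_winv_finite_part wroot_winv by (simp_all add: simple_root_finite)
  have root: "is_root N (?p,?q,0)" using is_root_wroot[of "winv ?w" "\<alpha> i"] x i w_\<alpha> by simp
  have "(?q,?p,0) \<notin> R\<^sub>\<beta>"
    using opp_root_wroot_winv_notin_R[OF w i(2)] by (simp add: w_\<alpha> opp_root_def)
  then have "(?p,?q,0) \<in> flipped_roots \<longleftrightarrow> \<not> (pos_root N (?p,?q,0) \<and> (?p,?q,0) \<notin> R\<^sub>\<beta>)"
    using root pos_root_if_in_R[of "(?p,?q,0)"]
    by (auto simp: flipped_roots_def neg_root_def opp_root_def)
  moreover have "(?p,?q,?k) \<in> flipped_roots \<longleftrightarrow> ?k < 0 \<or> ?k = 0 \<and> (?p,?q,0) \<in> flipped_roots"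
    using root by (auto simp: flipped_roots_iff is_root_def)
  moreover have "\<eta> (Suc i) = \<eta> i + (if pos_root N (?p,?q,0) \<and> (?p,?q,0) \<notin> R\<^sub>\<beta> then 1 else 0)"
    using eta_w_props(2)[OF inWbar_finite_part[OF x] i] by (simp add: \<eta>_def w_\<alpha>)
  ultimately show ?thesis unfolding x_\<alpha> by (auto split: if_splits)
qed

lemma Pminus_iff: "Pminus N \<eta> \<longleftrightarrow> inP N \<eta> \<and> (\<forall>i. 1 \<le> i \<and> i < N \<longrightarrow> \<eta> i \<le> \<eta> (Suc i))"
proof -
  have "\<eta> i \<le> \<eta> j" if "\<forall>i. 1 \<le> i \<and> i < N \<longrightarrow> \<eta> i \<le> \<eta> (Suc i)" "1 \<le> i" "i < j" "j \<le> N" for i j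
    using add_mult_le_if_increments_ge[of i j \<eta> 0] that by simp
  then show ?thesis by (auto simp: Pminus_def)
qed

lemma Xbeta_iff_Pminus:
  "x \<in> Xbeta N \<beta> \<longleftrightarrow> inW N x \<and> finite_part x \<in> Wmin N \<beta> \<and>
    Pminus N (\<lambda>i. snd x i - eta_w N \<beta> (finite_part x) i)"
proof
  assume "x \<in> Xbeta N \<beta>"
  then obtain w \<eta> where x: "x = wmul (transl (\<lambda>i. \<eta> i + eta_w N \<beta> w i)) w"
    and w: "w \<in> Wmin N \<beta>" "inWbar N w" and \<eta>: "Pminus N \<eta>"
    unfolding Xbeta_def by blast
  have x_eq: "x = (fst w, \<lambda>i. \<eta> i + eta_w N \<beta> w i)"
    using w(2) by (simp add: x wmul_def transl_def snd_inWbar)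
  moreover have "finite_part x = w"
    using w(2) by (simp add: x_eq finite_part_def inWbar_def prod_eq_iff)
  moreover have "inW N x"
    using w(2) \<eta> eta_w_props(1)[OF w(2)] by (auto simp: x_eq inW_def inWbar_def Pminus_def inP_def)
  ultimately show "inW N x \<and> finite_part x \<in> Wmin N \<beta> \<and>
      Pminus N (\<lambda>i. snd x i - eta_w N \<beta> (finite_part x) i)" using w(1) \<eta> by simp
next
  let ?w = "finite_part x"
  assume x: "inW N x \<and> ?w \<in> Wmin N \<beta> \<and> Pminus N (\<lambda>i. snd x i - eta_w N \<beta> ?w i)"
  moreover have "x = wmul (transl (\<lambda>i. (snd x i - eta_w N \<beta> ?w i) + eta_w N \<beta> ?w i)) ?w"
    by (simp add: wmul_def transl_def finite_part_def)
  ultimately show "x \<in> Xbeta N \<beta>" unfolding Xbeta_def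
    by (intro CollectI exI[of _ ?w] exI[of _ "\<lambda>i. snd x i - eta_w N \<beta> ?w i"]) simp
qed

lemma Xbeta_iff:
  "x \<in> Xbeta N \<beta> \<longleftrightarrow>
    x \<in> Wmin N \<beta> \<and> (\<forall>i. 1 \<le> i \<and> i < N \<longrightarrow> wroot (winv x) (\<alpha> i) \<in> flipped_roots)"
proof (cases "inW N x")
  case x: True
  let ?w = "finite_part x" and ?\<eta> = "eta_w N \<beta> (finite_part x)"
  have \<eta>_mono: "?\<eta> i \<le> ?\<eta> (Suc i)" if "1 \<le> i" "i < N" for i
    using eta_w_props(2)[OF inWbar_finite_part[OF x] that] by simp
  have "inP N (\<lambda>i. snd x i - ?\<eta> i)"
    using x eta_w_props(1)[OF inWbar_finite_part[OF x]] by (simp add: inP_def inW_def)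
  then have Pminus: "Pminus N (\<lambda>i. snd x i - ?\<eta> i) \<longleftrightarrow>
      (\<forall>i. 1 \<le> i \<and> i < N \<longrightarrow> wroot (winv x) (\<alpha> i) \<in> flipped_roots)" if "?w \<in> Wmin N \<beta>"
    using wroot_winv_flipped_iff[OF x that] by (auto simp: Pminus_iff)
  have "?w \<in> Wmin N \<beta> \<longleftrightarrow> x \<in> Wmin N \<beta>"
    if "(\<forall>i. 1 \<le> i \<and> i < N \<longrightarrow> wroot (winv x) (\<alpha> i) \<in> flipped_roots) \<or> Pminus N (\<lambda>i. snd x i - ?\<eta> i)"
  proof (rule Wmin_finite_part_iff[OF x])
    fix i assume i: "1 \<le> i" "i < N"
    from that show "snd x i \<le> snd x (Suc i)"
    proof
      assume "\<forall>i. 1 \<le> i \<and> i < N \<longrightarrow> wroot (winv x) (\<alpha> i) \<in> flipped_roots"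
      then show ?thesis
        using i by (auto simp: simple_root_finite wroot_winv[OF x] flipped_roots_iff)
    next
      assume "Pminus N (\<lambda>i. snd x i - ?\<eta> i)"
      then have "snd x i - ?\<eta> i \<le> snd x (Suc i) - ?\<eta> (Suc i)" using i by (simp add: Pminus_iff)
      then show ?thesis using \<eta>_mono[OF i] by simp
    qed
  qed
  then show ?thesis using Pminus x unfolding Xbeta_iff_Pminus by blast
qed (auto simp: Xbeta_iff_Pminus)

lemma Wmin_if_Xbeta: "x \<in> Xbeta N \<beta> \<Longrightarrow> x \<in> Wmin N \<beta>"
  by (simp add: Xbeta_iff)

lemma wroot_winv_Xbeta_flipped:
  assumes x: "x \<in> Xbeta N \<beta>" and pq: "1 \<le> p" "p < q" "q \<le> N"
  shows "wroot (winv x) (p,q,0) \<in> flipped_roots"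
proof -
  have ix: "inW N x" using Wmin_if_Xbeta[OF x] by simp
  have simple: "wroot (winv x) (l, Suc l, 0) \<in> flipped_roots" if "1 \<le> l" "l < N" for l
    using x that by (metis Xbeta_iff simple_root_finite)
  have "Suc p \<le> q" using pq by simp
  then show ?thesis using pq(3)
  proof (induction q rule: dec_induct)
    case (step q)
    have "inv (fst x) p \<noteq> inv (fst x) (Suc q)"
      using fst_inW_inv_f[OF ix] step by (metis Suc_n_not_le_n le_SucI)
    then show ?case
      using flipped_roots_add[of "inv (fst x) p" "inv (fst x) q" "snd x p - snd x q"
          "inv (fst x) (Suc q)" "snd x q - snd x (Suc q)"] step simple[of q]
      by (simp add: wroot_winv[OF ix])
  qed (use simple pq in simp)
qed

lemma Xbeta_face:
  assumes x: "x \<in> Xbeta N \<beta>" and pq: "1 \<le> p" "p \<le> l" "l < q" "q \<le> N"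
    and in_R: "wroot (winv x) (p,q,0) \<in> R\<^sub>\<beta>"
  shows "wroot (winv x) (l, Suc l, 0) \<in> R\<^sub>\<beta>"
proof -
  have ix: "inW N x" using Wmin_if_Xbeta[OF x] by simp
  note face = flipped_roots_face[of "inv (fst x) i" "inv (fst x) j" _ "inv (fst x) k" for i j k]
  note flipped = wroot_winv_Xbeta_flipped[OF x, unfolded wroot_winv[OF ix]]
  have "wroot (winv x) (l,q,0) \<in> R\<^sub>\<beta>"
    using face(2)[of p l _ q] flipped[of p l] flipped[of l q] in_R pq
    by (cases "p = l") (auto simp: wroot_winv[OF ix])
  then show ?thesis
    using face(1)[of l "Suc l" _ q] flipped[of l "Suc l"] flipped[of "Suc l" q] pq
    by (cases "Suc l = q") (auto simp: wroot_winv[OF ix])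
qed

lemma Xbeta_unique_in_coset:
  assumes x: "x \<in> Xbeta N \<beta>" and u: "inWbar N u" and ux: "wmul u x \<in> Xbeta N \<beta>"
  shows "u = idW"
proof (rule ccontr)
  assume "u \<noteq> idW"
  then have "winv u \<noteq> idW" using u by (metis inW_if_inWbar winv_winv winv_idW)
  then obtain i where i: "1 \<le> i" "i < N" and "\<not> pos_root N (wroot (winv u) (\<alpha> i))"
    using eq_idW_if_finite_simple_roots_pos[of "winv u"] u by auto
  have iu: "inW N u" and ix: "inW N x" using u Wmin_if_Xbeta[OF x] by simp_all
  let ?p = "inv (fst u) i" and ?q = "inv (fst u) (Suc i)"
  have u_\<alpha>: "wroot (winv u) (\<alpha> i) = (?p,?q,0)"
    using u by (simp add: simple_root_finite[OF i(1)] wroot_winv[OF iu] snd_inWbar)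
  then have "is_root N (?p,?q,0)" using is_root_wroot[of "winv u" "\<alpha> i"] iu i by simp
  then have pq: "1 \<le> ?q" "?q < ?p" "?p \<le> N"
    using \<open>\<not> pos_root N _\<close> by (auto simp: u_\<alpha> pos_root_def is_root_def)
  have "wroot (winv (wmul u x)) (\<alpha> i) = opp_root (wroot (winv x) (?q,?p,0))"
    using iu ix
    by (simp add: winv_wmul wroot_wmul u_\<alpha> flip: wroot_opp_root) (simp add: opp_root_def)
  then show False
    using ux i opp_root_notin_flipped_roots[OF wroot_winv_Xbeta_flipped[OF x pq]]
    unfolding Xbeta_iff by metis
qed

lemma wmul_Xbeta_inject:
  assumes x: "x \<in> Xbeta N \<beta>" "x' \<in> Xbeta N \<beta>" and u: "inWbar N u" "inWbar N u'"
    and eq: "wmul u x = wmul u' x'"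
  shows "x = x'" "u = u'"
proof -
  have inW: "inW N x" "inW N x'" "inW N u" "inW N u'" using x u Wmin_if_Xbeta by auto
  have x': "x' = wmul (wmul (winv u') u) x" using inW eq by (simp add: wmul_assoc)
  then have "wmul (winv u') u = idW" using Xbeta_unique_in_coset[OF x(1)] x(2) u by simp
  then show "x = x'" using x' by simp
  then show "u = u'" using inW eq wmul_right_cancel by metis
qed

lemma ex_neg_simple_root_beta_of:
  assumes x: "x \<in> Xbeta N \<beta>" and u: "inWbar N u" and ux: "wmul u x \<notin> Wmin N \<beta>"
  shows "\<exists>j\<in>Pi_g N (beta_of N \<beta> x). neg_root N (wroot u (\<alpha> j))"
proof -
  have ix: "inW N x" and iu: "inW N u" using Wmin_if_Xbeta[OF x] u by simp_all
  obtain a where a: "a \<in> R\<^sub>\<beta>" "\<not> pos_root N (wroot (wmul u x) a)"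
    using ux ix iu by (auto simp: Wmin_iff)
  obtain p q k where x_a: "wroot x a = (p,q,k)" by (cases "wroot x a")
  have pos: "pos_root N (p,q,k)" using WminD[OF Wmin_if_Xbeta[OF x] a(1)] by (simp add: x_a)
  have neg: "\<not> pos_root N (wroot u (p,q,k))" using a(2) iu by (simp add: wroot_wmul x_a)
  have "is_root N (wroot u (p,q,k))" using is_root_if_pos[OF pos] iu by simp
  then have k: "k = 0"
    using neg pos by (auto simp: wroot_def snd_inWbar[OF u] pos_root_def is_root_def)
  then have pq: "1 \<le> p" "p < q" "q \<le> N" using pos by (auto simp: pos_root_def is_root_def)
  then obtain l where l: "p \<le> l" "l < q" "neg_root N (wroot u (\<alpha> l))"
    using ex_neg_simple_root_between[OF iu, of p q] neg k by auto
  have "wroot (winv x) (p,q,0) \<in> R\<^sub>\<beta>" using a(1) x_a k ix by (metis wroot_winv_cancel(2))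
  from Xbeta_face[OF x pq(1) l(1,2) pq(3) this]
  have "wroot (winv x) (\<alpha> l) \<in> R\<^sub>\<beta>" using l pq by (simp add: simple_root_finite)
  then have "l \<in> Pi_g N (beta_of N \<beta> x)"
    unfolding Pi_g_beta_of using l pq ix by (auto intro!: bexI[of _ "wroot (winv x) (\<alpha> l)"])
  then show ?thesis using l(3) by blast
qed

lemma ex_s_wmul_in_Wmin_longer:
  assumes y: "y \<in> Wmin N \<beta>" "y \<notin> Xbeta N \<beta>"
  shows "\<exists>i. 1 \<le> i \<and> i < N \<and> wmul (s i) y \<in> Wmin N \<beta> \<and> len N (wmul (s i) y) = Suc (len N y)"
proof -
  obtain i where i: "1 \<le> i" "i < N" and notin: "wroot (winv y) (\<alpha> i) \<notin> flipped_roots"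
    using y by (auto simp: Xbeta_iff)
  then have "pos_root N (wroot (winv y) (\<alpha> i))"
    using opp_root_wroot_winv_notin_R[OF y(1) i(2)] y(1) i
    by (auto simp: flipped_roots_def neg_root_def)
  then have "len N (wmul (s i) y) = Suc (len N y)" using len_s_wmul_if_pos y(1) i by simp
  moreover have "wmul (s i) y \<in> Wmin N \<beta>"
    using s_wmul_in_Wmin_iff[OF y(1) i(2)] notin by (simp add: flipped_roots_def)
  ultimately show ?thesis using i by blast
qed

lemma Wmin_climb_induct [consumes 1, case_names Xbeta step]:
  assumes w: "w \<in> Wmin N \<beta>"
    and Xbeta: "\<And>x. x \<in> Xbeta N \<beta> \<Longrightarrow> P x"
    and step: "\<And>w i. w \<in> Wmin N \<beta> \<Longrightarrow> 1 \<le> i \<Longrightarrow> i < N \<Longrightarrow> wmul (s i) w \<in> Wmin N \<beta> \<Longrightarrow>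
        P (wmul (s i) w) \<Longrightarrow> P w"
  shows "P w"
proof -
  define C where "C = (\<lambda>u. wmul u w) ` {u. inWbar N u}"
  define M where "M = Max (len N ` C)"
  have "finite C" unfolding C_def using finite_inWbar by simp
  then have le_M: "len N y \<le> M" if "y \<in> C" for y unfolding M_def using that by simp
  have s_C: "wmul (s i) y \<in> C" if y: "y \<in> C" and i: "1 \<le> i" "i < N" for y i
  proof -
    obtain u where u: "inWbar N u" "y = wmul u w" using y unfolding C_def by blast
    then have "wmul (s i) y = wmul (wmul (s i) u) w" using i w by (simp add: wmul_assoc)
    then show ?thesis unfolding C_def using u(1) i by simp
  qed
  have "P y" if "y \<in> C" "y \<in> Wmin N \<beta>" for y
    using that
  proof (induction "M - len N y" arbitrary: y rule: less_induct)
    case less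
    show ?case
    proof (cases "y \<in> Xbeta N \<beta>")
      case False
      then obtain i where i: "1 \<le> i" "i < N" "wmul (s i) y \<in> Wmin N \<beta>"
        and len: "len N (wmul (s i) y) = Suc (len N y)"
        using ex_s_wmul_in_Wmin_longer less.prems(2) by blast
      have C: "wmul (s i) y \<in> C" using s_C less.prems(1) i by blast
      then have "M - len N (wmul (s i) y) < M - len N y" using le_M len by fastforce
      from less.hyps[OF this C i(3)] show ?thesis using step less.prems(2) i by blast
    qed (use Xbeta in blast)
  qed
  moreover have "w \<in> C"
    unfolding C_def by (rule image_eqI[of _ _ idW]) simp_all
  ultimately show ?thesis using w by blast
qed

end

context extended_affine_weyl
begin

subsection \<open>The dual actions on t' and its dual\<close>

lemma sum_inv_fst_inW:
  assumes "inW N w"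
  shows "(\<Sum>j\<in>{1..N}. f (inv (fst w) j)) = (\<Sum>j\<in>{1..N}. f j)"
proof -
  have "inv (fst w) permutes {1..N}" using assms permutes_inv unfolding inW_def by blast
  from sum.permute[OF this, of f] show ?thesis by (simp add: comp_def)
qed

lemma act_t_wmul:
  assumes "inW N u" "inW N v"
  shows "act_t N (wmul u v) xi = act_t N u (act_t N v xi)"
proof -
  let ?f = "\<lambda>j. of_int (snd v j) * fst xi (inv (fst v) j)"
  have "(\<Sum>j\<in>{1..N}. ?f (inv (fst u) j)) = (\<Sum>j\<in>{1..N}. ?f j)"
    by (rule sum_inv_fst_inW[OF assms(1)])
  then show ?thesis
    using inv_fst_comp[OF assms]
    by (simp add: act_t_def wmul_def Let_def distrib_right sum.distrib)
qed

lemma act_t_idW [simp]: "act_t N idW xi = xi"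
  by (simp add: act_t_def idW_def)

lemma act_t_winv_cancel [simp]:
  "inW N w \<Longrightarrow> act_t N w (act_t N (winv w) xi) = xi"
  "inW N w \<Longrightarrow> act_t N (winv w) (act_t N w xi) = xi"
  by (simp_all flip: act_t_wmul)

lemma act_t_s_s [simp]: "i < N \<Longrightarrow> act_t N (s i) (act_t N (s i) xi) = xi"
  by (simp flip: act_t_wmul)

lemma act_dual_idW [simp]: "act_dual idW z = z"
  by (simp add: act_dual_def idW_def)

lemma act_dual_wmul:
  "inW N u \<Longrightarrow> inW N v \<Longrightarrow> act_dual (wmul u v) z = act_dual u (act_dual v z)"
  by (simp add: act_dual_def wmul_def inv_fst_comp algebra_simps)

lemma zeta_eval_act:
  assumes "inW N w"
  shows "zeta_eval N (act_dual w z) (act_t N w xi) = zeta_eval N z xi"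
proof -
  have "(\<Sum>j\<in>{1..N}. (\<lambda>j. fst z j * fst xi j) (inv (fst w) j)) = (\<Sum>j\<in>{1..N}. fst z j * fst xi j)"
    by (rule sum_inv_fst_inW[OF assms])
  then show ?thesis
    by (simp add: zeta_eval_def act_dual_def act_t_def Let_def sum.distrib algebra_simps
        sum_distrib_left)
qed

lemma zeta_eval_act_dual_wmul:
  assumes "inW N u" "inW N y"
  shows "zeta_eval N (act_dual (wmul u y) z) xi
    = zeta_eval N (act_dual y z) (act_t N (winv u) xi)"
  using zeta_eval_act[OF assms(1), of "act_dual y z" "act_t N (winv u) xi"] assms
  by (simp add: act_dual_wmul)

lemma zeta_eval_coroot:
  assumes "is_root N a"
  shows "zeta_eval N z (coroot a) = pair z a"
proof -
  obtain i j k where ijk: "a = (i,j,k)" by (cases a)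
  have "i \<in> {1..N}" "j \<in> {1..N}" using assms by (auto simp: ijk is_root_def)
  then show ?thesis
    by (simp add: ijk zeta_eval_def coroot_def pair_def right_diff_distrib sum_subtractf
        if_distrib[of "(*) _"] cong: if_cong)
qed

lemma pair_act_dual: "inW N w \<Longrightarrow> pair (act_dual w z) a = pair z (wroot (winv w) a)"
  by (cases a) (simp add: wroot_winv pair_def act_dual_def algebra_simps)

lemma pair_opp_root: "pair z (opp_root a) = - pair z a"
  by (cases a) (simp add: pair_def opp_root_def)

lemma sum_affine_reflection:
  fixes f :: "nat \<Rightarrow> complex"
  shows "(\<Sum>j\<in>{1..N}. of_int (- 1 * (eps N j - eps 1 j)) * f (transpose N 1 j)) = f N - f 1"
proof -
  have "of_int (- 1 * (eps N j - eps 1 j)) * f (transpose N 1 j)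
      = (if j = 1 then f N else 0) - (if j = N then f 1 else 0)" for j
    using N_ge_2 by (cases "j = 1"; cases "j = N") (simp_all add: eps_def)
  then show ?thesis using N_ge_2 by (simp add: sum_subtractf)
qed

lemma act_t_s:
  assumes "i < N"
  shows "fst (act_t N (s i) xi) j = fst xi j - rootval (\<alpha> i) xi * fst (coroot (\<alpha> i)) j"
    "snd (act_t N (s i) xi) = snd xi - rootval (\<alpha> i) xi * snd (coroot (\<alpha> i))"
proof -
  note defs = act_t_def Let_def sW_def s_alpha_def simple_root_def rootval_def coroot_def
  show "fst (act_t N (s i) xi) j = fst xi j - rootval (\<alpha> i) xi * fst (coroot (\<alpha> i)) j"
    using assms N_ge_2 by (cases "i = 0") (simp_all add: defs transpose_def)
  show "snd (act_t N (s i) xi) = snd xi - rootval (\<alpha> i) xi * snd (coroot (\<alpha> i))"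
    using sum_affine_reflection[of "fst xi"] unfolding defs by (cases "i = 0") simp_all
qed

lemma zeta_eval_act_t_s:
  assumes "i < N"
  shows "zeta_eval N z (act_t N (s i) xi) = zeta_eval N z xi - rootval (\<alpha> i) xi * pair z (\<alpha> i)"
  unfolding zeta_eval_coroot[OF is_root_simple[OF assms], symmetric]
  by (simp add: zeta_eval_def act_t_s[OF assms] right_diff_distrib sum_subtractf
      sum_distrib_left distrib_left mult.left_commute)

end

subsection \<open>Spans and eigenvectors modulo a subspace\<close>

context vector_space
begin

lemma span_image_mod_subspace:
  assumes J: "subspace J" and m: "m \<in> span (f ` S \<union> J)"
  shows "\<exists>F a. finite F \<and> F \<subseteq> S \<and> m - (\<Sum>w\<in>F. scale (a w) (f w)) \<in> J"
proof -
  have "span J = J" using J by simp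
  then obtain x j where xj: "m = x + j" "x \<in> span (f ` S)" "j \<in> J"
    using m unfolding span_Un by blast
  obtain t a where t: "finite t" "t \<subseteq> f ` S" "x = (\<Sum>y\<in>t. scale (a y) y)"
    using xj(2) by (auto simp: span_explicit)
  obtain F where F: "F \<subseteq> S" "inj_on f F" "t = f ` F"
    using t(2) by (auto simp: subset_image_inj)
  then have "m - (\<Sum>w\<in>F. scale (a (f w)) (f w)) \<in> J"
    using xj by (simp add: t(3) sum.reindex)
  moreover have "finite F" using F t(1) finite_image_iff by blast
  ultimately show ?thesis using F(1) by (intro exI[of _ F] exI[of _ "\<lambda>w. a (f w)"]) simp
qed

lemma sum_scale_eigenvalue_diff_in_subspace:
  assumes U: "subspace U" and linear: "Vector_Spaces.linear scale scale f"
    and stable: "\<And>u. u \<in> U \<Longrightarrow> f u \<in> U"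
    and eigen: "\<And>p. p \<in> P \<Longrightarrow> f (v p) - scale (ev p) (v p) \<in> U"
    and sum: "(\<Sum>p\<in>P. v p) \<in> U"
  shows "(\<Sum>p\<in>P. scale (ev p - c) (v p)) \<in> U"
proof -
  interpret f: Vector_Spaces.linear scale scale f by (rule linear)
  have "f (\<Sum>p\<in>P. v p) - scale c (\<Sum>p\<in>P. v p) \<in> U"
    by (intro subspace_diff[OF U] subspace_scale[OF U] stable sum)
  from subspace_diff[OF U this subspace_sum[OF U eigen]]
  have "f (\<Sum>p\<in>P. v p) - scale c (\<Sum>p\<in>P. v p) - (\<Sum>p\<in>P. f (v p) - scale (ev p) (v p)) \<in> U" .
  then show ?thesis by (simp add: f.sum scale_sum_right sum_subtractf scale_left_diff_distrib)
qed

lemma eigencomponents_in_subspace: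
  assumes U: "subspace U"
    and linear: "\<And>k. Vector_Spaces.linear scale scale (f k)"
    and stable: "\<And>k u. u \<in> U \<Longrightarrow> f k u \<in> U"
    and P: "finite P"
    and eigen: "\<And>p k. p \<in> P \<Longrightarrow> f k (v p) - scale (ev p k) (v p) \<in> U"
    and separated: "\<And>p q. p \<in> P \<Longrightarrow> q \<in> P \<Longrightarrow> p \<noteq> q \<Longrightarrow> \<exists>k. ev p k \<noteq> ev q k"
    and sum: "(\<Sum>p\<in>P. v p) \<in> U"
  shows "p \<in> P \<Longrightarrow> v p \<in> U"
  using P eigen separated sum
proof (induction P arbitrary: v p rule: finite_induct)
  case (insert q P)
  have in_U: "v r \<in> U" if r: "r \<in> P" for r
  proof -
    obtain k where k: "ev r k \<noteq> ev q k" using insert.prems(3)[of r q] r insert.hyps by auto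
    let ?d = "\<lambda>p. ev p k - ev q k"
    have "(\<Sum>p\<in>insert q P. scale (?d p) (v p)) \<in> U"
      using insert.prems(2,4)
      by (intro sum_scale_eigenvalue_diff_in_subspace[OF U linear stable]) blast+
    then have sum_P: "(\<Sum>p\<in>P. scale (?d p) (v p)) \<in> U" using insert.hyps by simp
    have "scale (?d r) (v r) \<in> U"
    proof (rule insert.IH[of r "\<lambda>p. scale (?d p) (v p)"])
      fix p l assume "p \<in> P"
      interpret f': Vector_Spaces.linear scale scale "f l" by (rule linear)
      have "scale (?d p) (f l (v p) - scale (ev p l) (v p)) \<in> U"
        using insert.prems(2) \<open>p \<in> P\<close> by (intro subspace_scale[OF U]) simp
      then show "f l (scale (?d p) (v p)) - scale (ev p l) (scale (?d p) (v p)) \<in> U"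
        by (simp add: f'.scale scale_right_diff_distrib mult.commute)
    qed (use r sum_P insert.prems(3) in auto)
    then have "scale (inverse (?d r)) (scale (?d r) (v r)) \<in> U" by (rule subspace_scale[OF U])
    then show ?thesis using k by simp
  qed
  then have "(\<Sum>p\<in>P. v p) \<in> U" by (rule subspace_sum[OF U])
  then have "v q \<in> U" using subspace_diff[OF U insert.prems(4)] insert.hyps by force
  then show ?case using in_U insert.prems(1) by blast
qed simp

end

subsection \<open>The algebra and its intertwiners\<close>

locale ddaha = extended_affine_weyl N for N :: nat +
  fixes sc :: "complex \<Rightarrow> 'h::ring_1" and T :: "W \<Rightarrow> 'h" and Xe :: "nat \<Rightarrow> 'h" and Xc :: 'h
  assumes ddaha: "DDAHA N sc T Xe Xc"
begin

abbreviation X :: "tvec \<Rightarrow> 'h" where "X \<equiv> Xlin N sc Xe Xc"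
abbreviation \<Phi> :: "nat \<Rightarrow> 'h" where "\<Phi> \<equiv> phi_s N sc T Xe Xc"

lemma sc_add [rule_format]: "\<forall>a b. sc (a + b) = sc a + sc b"
  and sc_mult [rule_format]: "\<forall>a b. sc (a * b) = sc a * sc b"
  and sc_1 [simp]: "sc 1 = 1"
  and sc_commute [rule_format]: "\<forall>a h. sc a * h = h * sc a"
  and T_idW [simp]: "T idW = 1"
  and T_wmul [rule_format]:
    "\<forall>u v. inW N u \<longrightarrow> inW N v \<longrightarrow> T (wmul u v) = T u * T v"
  and Xe_commute [rule_format]: "\<forall>i\<in>{1..N}. \<forall>j\<in>{1..N}. Xe i * Xe j = Xe j * Xe i"
  and Xe_Xc [rule_format]: "\<forall>i\<in>{1..N}. Xe i * Xc = Xc * Xe i"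
  and T_s_X_diff [rule_format]: "\<forall>i<N. \<forall>xi.
    T (s i) * X xi - X (act_t N (s i) xi) * T (s i) = - sc (rootval (\<alpha> i) xi)"
  and T_piW_X [rule_format]: "\<forall>xi. T (piW N) * X xi = X (act_t N (piW N) xi) * T (piW N)"
  and PBW_independent [rule_format]: "\<forall>F a. finite F \<and> F \<subseteq> {w. inW N w} \<times> Monos N \<and>
    (\<Sum>p\<in>F. sc (a p) * (T (fst p) * Xmono N Xe Xc (snd p))) = 0 \<longrightarrow> (\<forall>p\<in>F. a p = 0)"
  and PBW_spanning [rule_format]: "\<forall>h. \<exists>F a. finite F \<and> F \<subseteq> {w. inW N w} \<times> Monos N \<and>
    h = (\<Sum>p\<in>F. sc (a p) * (T (fst p) * Xmono N Xe Xc (snd p)))"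
  using ddaha[unfolded DDAHA_def] by - (elim conjE, assumption)+

lemma sc_left_commute: "h * (sc a * k) = sc a * (h * k)"
  by (metis sc_commute mult.assoc)

sublocale H: vector_space "\<lambda>a h. sc a * h"
  by unfold_locales (simp_all add: sc_add sc_mult distrib_left distrib_right mult.assoc)

lemma linear_mult_left: "Vector_Spaces.linear (\<lambda>a h. sc a * h) (\<lambda>a h. sc a * h) (\<lambda>k. h * k)"
  by unfold_locales (simp_all add: distrib_left sc_left_commute)

lemma mult_in_subspace_if_span:
  assumes "m \<in> H.span S" "H.subspace U" "\<And>g. g \<in> S \<Longrightarrow> h * g \<in> U"
  shows "h * m \<in> U"
proof -
  interpret mult: Vector_Spaces.linear "\<lambda>a h. sc a * h" "\<lambda>a h. sc a * h" "\<lambda>k. h * k"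
    by (rule linear_mult_left)
  have "H.span S \<subseteq> {k. h * k \<in> U}"
    using assms(3) by (intro H.span_minimal mult.subspace_linear_preimage[OF assms(2)]) blast
  then show ?thesis using assms(1) by blast
qed

lemma sc_0 [simp]: "sc 0 = 0"
  using H.scale_zero_left[of 1] by simp

lemma sc_minus: "sc (- a) = - sc a"
  using H.scale_minus_left[of a 1] by simp

lemma sc_diff: "sc (a - b) = sc a - sc b"
  using H.scale_left_diff_distrib[of a b 1] by simp

lemmas pull_sc = sc_left_commute[of "T w" for w] sc_left_commute[of "X xi" for xi]
  sc_left_commute[of "\<Phi> i" for i]

lemma X_commutes_if_generators_commute:
  assumes "\<And>i. i \<in> {1..N} \<Longrightarrow> Xe i * h = h * Xe i" "Xc * h = h * Xc"
  shows "X xi * h = h * X xi"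
proof -
  have "sc a * Xe i * h = h * (sc a * Xe i)" if "i \<in> {1..N}" for i a
    using assms(1)[OF that] by (simp add: mult.assoc sc_left_commute)
  moreover have "sc a * Xc * h = h * (sc a * Xc)" for a
    using assms(2) by (simp add: mult.assoc sc_left_commute)
  ultimately show ?thesis
    by (simp add: Xlin_def distrib_left distrib_right sum_distrib_left sum_distrib_right)
qed

lemma X_commute: "X xi * X eta = X eta * X xi"
proof (rule X_commutes_if_generators_commute)
  fix i assume i: "i \<in> {1..N}"
  show "Xe i * X eta = X eta * Xe i"
    by (rule X_commutes_if_generators_commute[symmetric]) (use i Xe_commute Xe_Xc in auto)
next
  show "Xc * X eta = X eta * Xc"
    by (rule X_commutes_if_generators_commute[symmetric]) (use Xe_Xc in auto)
qed

lemma X_diff_scale: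
  assumes "\<And>j. j \<in> {1..N} \<Longrightarrow> fst xi j = fst eta j - r * fst th j" "snd xi = snd eta - r * snd th"
  shows "X xi = X eta - sc r * X th"
proof -
  have "(\<Sum>i\<in>{1..N}. sc (fst xi i) * Xe i)
      = (\<Sum>i\<in>{1..N}. sc (fst eta i) * Xe i - sc r * (sc (fst th i) * Xe i))"
    using assms(1) by (intro sum.cong) (simp_all add: sc_diff left_diff_distrib)
  then show ?thesis
    unfolding Xlin_def assms(2)
    by (simp add: sum_subtractf sum_distrib_left sc_diff left_diff_distrib distrib_left)
qed

lemma X_act_t_s:
  "i < N \<Longrightarrow> X (act_t N (s i) xi) = X xi - sc (rootval (\<alpha> i) xi) * X (coroot (\<alpha> i))"
  by (rule X_diff_scale) (simp_all add: act_t_s)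

lemma T_s_X: "i < N \<Longrightarrow> T (s i) * X xi = X (act_t N (s i) xi) * T (s i) - sc (rootval (\<alpha> i) xi)"
  using T_s_X_diff[of i xi] by (simp add: algebra_simps)

lemma X_T_s:
  assumes "i < N"
  shows "X xi * T (s i)
    = T (s i) * X (act_t N (s i) xi) + sc (rootval (\<alpha> i) (act_t N (s i) xi))"
  using T_s_X[OF assms, of "act_t N (s i) xi"] assms by simp

lemma T_s_T_s: "i < N \<Longrightarrow> T (s i) * T (s i) = 1"
  by (simp flip: T_wmul)

lemma T_winv_T: "inW N w \<Longrightarrow> T (winv w) * T w = 1"
  by (simp flip: T_wmul)

lemma T_s_wmul_diff_one:
  "inW N w \<Longrightarrow> i < N \<Longrightarrow> T (wmul (s i) w) - 1 = T (s i) * (T w - 1) + (T (s i) - 1)"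
  by (simp add: T_wmul right_diff_distrib)

lemma T_diff_T_wmul_s:
  "inW N w \<Longrightarrow> j < N \<Longrightarrow> T w - T (wmul w (s j)) = T (wmul w (s j)) * (T (s j) - 1)"
  using T_wmul[of "wmul w (s j)" "s j"] by (simp add: right_diff_distrib)

lemma T_pi_pow_X: "T (pi_pow k) * X xi = X (act_t N (pi_pow k) xi) * T (pi_pow k)"
proof -
  let ?p = "piW N"
  have "inW N (pi_pow k) \<and> (\<forall>xi. T (pi_pow k) * X xi = X (act_t N (pi_pow k) xi) * T (pi_pow k))"
  proof (induction k rule: wpowi_induct)
    case (succ k v)
    have "T (wmul ?p v) * X xi = X (act_t N (wmul ?p v) xi) * T (wmul ?p v)" for xi
    proof -
      have "T (wmul ?p v) * X xi = T ?p * X (act_t N v xi) * T v"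
        using succ by (simp add: T_wmul mult.assoc)
      also have "\<dots> = X (act_t N ?p (act_t N v xi)) * T ?p * T v" by (simp add: T_piW_X)
      finally show ?thesis using succ by (simp add: T_wmul mult.assoc act_t_wmul)
    qed
    then show ?case using succ by simp
  next
    case (pred k v)
    let ?q = "winv (piW N)"
    have "T (wmul ?q v) * X xi = X (act_t N (wmul ?q v) xi) * T (wmul ?q v)" for xi
    proof -
      have "T (wmul ?q v) * X xi = T ?q * X (act_t N ?p (act_t N ?q (act_t N v xi))) * T v"
        using pred by (simp add: T_wmul mult.assoc)
      also have "\<dots> = T ?q * (X (act_t N ?p (act_t N ?q (act_t N v xi))) * T ?p) * T (wmul ?q v)"
        using pred T_wmul[of ?p "wmul ?q v"] by (simp add: mult.assoc)
      also have "\<dots> = T ?q * T ?p * X (act_t N ?q (act_t N v xi)) * T (wmul ?q v)"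
        by (simp only: T_piW_X[symmetric] mult.assoc)
      finally show ?thesis using pred by (simp add: T_winv_T act_t_wmul)
    qed
    then show ?case using pred by simp
  qed simp
  then show ?thesis by blast
qed

lemma \<Phi>_eq: "\<Phi> i = 1 + T (s i) * X (coroot (\<alpha> i))"
  by (simp add: phi_s_def)

lemma \<Phi>_X:
  assumes "i < N"
  shows "\<Phi> i * X xi = X (act_t N (s i) xi) * \<Phi> i"
proof -
  let ?a = "X (coroot (\<alpha> i))" and ?X' = "X (act_t N (s i) xi)" and ?r = "sc (rootval (\<alpha> i) xi)"
  have "\<Phi> i * X xi = X xi + T (s i) * X xi * ?a"
    by (simp add: \<Phi>_eq distrib_right mult.assoc X_commute[of xi])
  also have "\<dots> = X xi + (?X' * T (s i) - ?r) * ?a" by (simp add: T_s_X[OF assms])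
  also have "\<dots> = (X xi - ?r * ?a) + ?X' * T (s i) * ?a" by (simp add: algebra_simps)
  also have "\<dots> = ?X' * \<Phi> i" by (simp add: X_act_t_s[OF assms] \<Phi>_eq distrib_left mult.assoc)
  finally show ?thesis .
qed

lemma \<Phi>_\<Phi>:
  assumes "i < N"
  shows "\<Phi> i * \<Phi> i = 1 - X (coroot (\<alpha> i)) * X (coroot (\<alpha> i))"
proof -
  let ?a = "X (coroot (\<alpha> i))" and ?S = "T (s i)"
  have two: "rootval (\<alpha> i) (coroot (\<alpha> i)) = 2" "\<And>h. sc 2 * h = h + h"
    using N_ge_2 sc_add[of 1 1] by (auto simp: rootval_def coroot_def simple_root_def mult_2)
  have "X (act_t N (s i) (coroot (\<alpha> i))) = - ?a" by (simp add: X_act_t_s[OF assms] two)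
  then have "?S * ?a = - (?a * ?S) - (1 + 1)"
    using T_s_X[OF assms, of "coroot (\<alpha> i)"] two(2)[of 1] by (simp add: two(1))
  then have a_S: "?a * ?S = - (?S * ?a) - (1 + 1)" by simp
  have "?S * ?a * (?S * ?a) = ?S * (?a * ?S) * ?a" by (simp add: mult.assoc)
  also have "\<dots> = - (?S * ?S * ?a * ?a) - (?S * ?a + ?S * ?a)"
    unfolding a_S by (simp only: right_diff_distrib left_diff_distrib distrib_left distrib_right
        mult.assoc mult_minus_left mult_minus_right mult_1 mult_1_right)
  finally have "?S * ?a * (?S * ?a) = - (?a * ?a) - (?S * ?a + ?S * ?a)"
    by (simp add: T_s_T_s[OF assms])
  then show ?thesis by (simp add: \<Phi>_eq distrib_left distrib_right)
qed

definition \<Phi>_prod :: "nat list \<Rightarrow> 'h" where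
  "\<Phi>_prod js = prod_list (map \<Phi> js)"

lemma \<Phi>_prod_Nil [simp]: "\<Phi>_prod [] = 1"
  by (simp add: \<Phi>_prod_def)

lemma \<Phi>_prod_Cons [simp]: "\<Phi>_prod (i # js) = \<Phi> i * \<Phi>_prod js"
  by (simp add: \<Phi>_prod_def)

definition \<Phi>_expr :: "int \<times> nat list \<Rightarrow> 'h" where
  "\<Phi>_expr e = T (pi_pow (fst e)) * \<Phi>_prod (snd e)"

end

subsection \<open>Weight vectors modulo a left ideal\<close>

text \<open>The locale covers the whole algebra acting on the standard module as well as its subalgebra
  generated by the finite Weyl group and t-bar acting on a module induced from a parabolic
  subalgebra of it.\<close>

locale weight_module = ddaha N sc T Xe Xc
  for N :: nat and sc :: "complex \<Rightarrow> 'h::ring_1" and T :: "W \<Rightarrow> 'h"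
    and Xe :: "nat \<Rightarrow> 'h" and Xc :: 'h +
  fixes A :: "'h set" and G :: "W set" and I :: "nat set" and V :: "tvec set"
    and J :: "'h set" and z :: tvec
  assumes sc_A: "sc a \<in> A" and add_A: "x \<in> A \<Longrightarrow> y \<in> A \<Longrightarrow> x + y \<in> A"
    and mult_A: "x \<in> A \<Longrightarrow> y \<in> A \<Longrightarrow> x * y \<in> A"
    and T_A: "w \<in> G \<Longrightarrow> T w \<in> A" and X_A: "xi \<in> V \<Longrightarrow> X xi \<in> A"
    and inW_G: "w \<in> G \<Longrightarrow> inW N w" and idW_G: "idW \<in> G"
    and wmul_G: "v \<in> G \<Longrightarrow> w \<in> G \<Longrightarrow> wmul v w \<in> G" and winv_G: "w \<in> G \<Longrightarrow> winv w \<in> G"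
    and I_less: "i \<in> I \<Longrightarrow> i < N" and s_G: "i \<in> I \<Longrightarrow> s i \<in> G"
    and ex_reduced_expr_G: "w \<in> G \<Longrightarrow> \<exists>k js. pi_pow k \<in> G \<and> set js \<subseteq> I \<and> reduced_expr N w (k, js)"
    and coroot_V: "i \<in> I \<Longrightarrow> coroot (\<alpha> i) \<in> V"
    and act_t_V: "w \<in> G \<Longrightarrow> xi \<in> V \<Longrightarrow> act_t N w xi \<in> V"
    and zero_J: "0 \<in> J" and add_J: "j \<in> J \<Longrightarrow> j' \<in> J \<Longrightarrow> j + j' \<in> J"
    and mult_J: "x \<in> A \<Longrightarrow> j \<in> J \<Longrightarrow> x * j \<in> J"
    and X_diff_J: "xi \<in> V \<Longrightarrow> X xi - sc (zeta_eval N z xi) \<in> J"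
begin

lemma subspace_J: "H.subspace J"
  by (rule H.subspaceI) (auto intro: zero_J add_J mult_J sc_A)

lemmas scale_J = H.subspace_scale[OF subspace_J] and neg_J = H.subspace_neg[OF subspace_J]
  and diff_J = H.subspace_diff[OF subspace_J] and sum_J = H.subspace_sum[OF subspace_J]

lemma scale_in_J_iff: "a \<noteq> 0 \<Longrightarrow> sc a * x \<in> J \<longleftrightarrow> x \<in> J"
  using scale_J[of "sc a * x" "inverse a"] scale_J[of x a] by auto

lemma diff_in_J_imp_iff: "x - y \<in> J \<Longrightarrow> x \<in> J \<longleftrightarrow> y \<in> J"
  using add_J[of "x - y" y] diff_J[of x "x - y"] by auto

lemma J_subset_span: "J \<subseteq> H.span (S \<union> J)"
  using H.span_superset by blast

lemma \<Phi>_A: "i \<in> I \<Longrightarrow> \<Phi> i \<in> A"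
  unfolding \<Phi>_eq using sc_A[of 1] by (auto intro!: add_A mult_A T_A s_G X_A coroot_V)

definition weight_space :: "W \<Rightarrow> 'h set" where
  "weight_space y = {v. \<forall>xi\<in>V. X xi * v - sc (zeta_eval N (act_dual y z) xi) * v \<in> J}"

lemma weight_spaceD:
  "v \<in> weight_space y \<Longrightarrow> xi \<in> V \<Longrightarrow> X xi * v - sc (zeta_eval N (act_dual y z) xi) * v \<in> J"
  by (simp add: weight_space_def)

lemma one_in_weight_space: "1 \<in> weight_space idW"
  by (simp add: weight_space_def X_diff_J)

lemma subspace_weight_space: "H.subspace (weight_space y)"
proof -
  let ?f = "\<lambda>xi v. X xi * v - sc (zeta_eval N (act_dual y z) xi) * v"
  have "H.subspace {v. ?f xi v \<in> J}" for xi
  proof (rule module_hom.subspace_linear_preimage[OF _ subspace_J])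
    show "module_hom (\<lambda>a h. sc a * h) (\<lambda>a h. sc a * h) (?f xi)"
      by unfold_locales
        (simp_all add: distrib_left right_diff_distrib pull_sc mult.commute)
  qed
  then have "H.subspace (\<Inter>xi\<in>V. {v. ?f xi v \<in> J})" by (intro H.subspace_Int) blast
  moreover have "weight_space y = (\<Inter>xi\<in>V. {v. ?f xi v \<in> J})" by (auto simp: weight_space_def)
  ultimately show ?thesis by simp
qed

lemma intertwiner_mult_in_weight_space:
  assumes h: "h \<in> A" and u: "u \<in> G" and intertwines: "\<And>xi. h * X xi = X (act_t N u xi) * h"
    and y: "inW N y" and v: "v \<in> weight_space y"
  shows "h * v \<in> weight_space (wmul u y)"
  unfolding weight_space_def
proof (intro CollectI ballI)
  fix xi assume xi: "xi \<in> V"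
  let ?xi = "act_t N (winv u) xi" and ?e = "zeta_eval N (act_dual (wmul u y) z) xi"
  have e: "?e = zeta_eval N (act_dual y z) ?xi"
    by (rule zeta_eval_act_dual_wmul[OF inW_G[OF u] y])
  have "X xi * h = h * X ?xi" using intertwines[of ?xi] inW_G[OF u] by simp
  then have "X xi * (h * v) = h * (X ?xi * v)" by (simp flip: mult.assoc)
  then have "X xi * (h * v) - sc ?e * (h * v) = h * (X ?xi * v - sc ?e * v)"
    by (simp add: right_diff_distrib sc_left_commute[of h])
  also have "\<dots> \<in> J"
    unfolding e using v xi act_t_V[OF winv_G[OF u]] by (intro mult_J[OF h] weight_spaceD)
  finally show "X xi * (h * v) - sc ?e * (h * v) \<in> J" .
qed

lemma \<Phi>_mult_in_weight_space:
  "i \<in> I \<Longrightarrow> inW N y \<Longrightarrow> v \<in> weight_space y \<Longrightarrow> \<Phi> i * v \<in> weight_space (wmul (s i) y)"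
  by (intro intertwiner_mult_in_weight_space \<Phi>_A s_G \<Phi>_X I_less)

lemma T_pi_pow_mult_in_weight_space:
  "pi_pow k \<in> G \<Longrightarrow> inW N y \<Longrightarrow> v \<in> weight_space y \<Longrightarrow>
    T (pi_pow k) * v \<in> weight_space (wmul (pi_pow k) y)"
  by (intro intertwiner_mult_in_weight_space T_A T_pi_pow_X)

lemma coroot_mult_weight_vector:
  assumes "i \<in> I" "v \<in> weight_space y"
  shows "X (coroot (\<alpha> i)) * v - sc (pair (act_dual y z) (\<alpha> i)) * v \<in> J"
  using weight_spaceD[OF assms(2) coroot_V[OF assms(1)]]
  by (simp add: zeta_eval_coroot I_less[OF assms(1)])

lemma \<Phi>_mult_weight_vector:
  assumes "i \<in> I" "v \<in> weight_space y"
  shows "\<Phi> i * v - v - sc (pair (act_dual y z) (\<alpha> i)) * (T (s i) * v) \<in> J"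
proof -
  have "T (s i) * (X (coroot (\<alpha> i)) * v - sc (pair (act_dual y z) (\<alpha> i)) * v) \<in> J"
    by (intro mult_J T_A s_G coroot_mult_weight_vector assms)
  then show ?thesis by (simp add: \<Phi>_eq distrib_right right_diff_distrib mult.assoc pull_sc)
qed

lemma \<Phi>_\<Phi>_mult_weight_vector:
  assumes i: "i \<in> I" and v: "v \<in> weight_space y"
  shows "\<Phi> i * (\<Phi> i * v) - sc (1 - (pair (act_dual y z) (\<alpha> i))\<^sup>2) * v \<in> J"
proof -
  let ?a = "X (coroot (\<alpha> i))" and ?p = "pair (act_dual y z) (\<alpha> i)"
  have "?a * v - sc ?p * v \<in> J" using coroot_mult_weight_vector[OF i v] .
  then have "?a * (?a * v - sc ?p * v) + sc ?p * (?a * v - sc ?p * v) \<in> J"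
    by (intro add_J scale_J mult_J X_A coroot_V i)
  then have "- (?a * (?a * v) - sc (?p\<^sup>2) * v) \<in> J"
    by (intro neg_J) (simp add: right_diff_distrib pull_sc power2_eq_square)
  moreover have "\<Phi> i * (\<Phi> i * v) = v - ?a * (?a * v)"
    using \<Phi>_\<Phi>[OF I_less[OF i]] by (simp add: left_diff_distrib flip: mult.assoc)
  ultimately show ?thesis by (simp add: sc_diff left_diff_distrib)
qed

lemma simple_prod_G: "set js \<subseteq> I \<Longrightarrow> simple_prod js \<in> G"
  by (induction js) (auto intro: idW_G wmul_G s_G)

lemma \<Phi>_prod_mult_in_weight_space:
  "set js \<subseteq> I \<Longrightarrow> inW N y \<Longrightarrow> v \<in> weight_space y \<Longrightarrow>
    \<Phi>_prod js * v \<in> weight_space (wmul (simple_prod js) y)"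
proof (induction js)
  case (Cons i js)
  have "inW N (simple_prod js)" using Cons.prems simple_prod_G inW_G by simp
  then show ?case
    using Cons \<Phi>_mult_in_weight_space[of i "wmul (simple_prod js) y"] I_less[of i]
    by (simp add: mult.assoc wmul_assoc)
qed simp

definition reduced_expr_in :: "W \<Rightarrow> int \<times> nat list \<Rightarrow> bool" where
  "reduced_expr_in w e \<longleftrightarrow> reduced_expr N w e \<and> set (snd e) \<subseteq> I \<and> pi_pow (fst e) \<in> G"

lemma reduced_expr_inD:
  assumes "reduced_expr_in w e"
  shows "w = wmul (pi_pow (fst e)) (simple_prod (snd e))" "length (snd e) = len N w"
    "set (snd e) \<subseteq> I" "pi_pow (fst e) \<in> G"
  using assms by (auto simp: reduced_expr_in_def reduced_expr_def word_eq_simple_prod)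

lemma \<Phi>_expr_in_weight_space:
  assumes "reduced_expr_in w e"
  shows "\<Phi>_expr e \<in> weight_space w"
proof -
  note e = reduced_expr_inD[OF assms]
  have "\<Phi>_prod (snd e) \<in> weight_space (simple_prod (snd e))"
    using \<Phi>_prod_mult_in_weight_space[OF e(3) inW_idW one_in_weight_space] by simp
  from T_pi_pow_mult_in_weight_space[OF e(4) _ this] show ?thesis
    unfolding \<Phi>_expr_def by (subst e(1)) (use e(3) simple_prod_G inW_G in blast)
qed

lemma T_mult_span_T:
  assumes "u \<in> G" "m \<in> H.span (T ` G \<union> J)"
  shows "T u * m \<in> H.span (T ` G \<union> J)"
proof (rule mult_in_subspace_if_span[OF assms(2)])
  fix g assume "g \<in> T ` G \<union> J"
  then have "T u * g \<in> T ` G \<union> J"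
    using assms(1) by (auto simp: inW_G wmul_G simp flip: T_wmul intro: mult_J T_A)
  then show "T u * g \<in> H.span (T ` G \<union> J)" by (rule H.span_base)
qed simp

lemma X_mult_T_simple_prod:
  "set js \<subseteq> I \<Longrightarrow> xi \<in> V \<Longrightarrow> X xi * T (simple_prod js) \<in> H.span (T ` G \<union> J)"
proof (induction js arbitrary: xi)
  case Nil
  let ?e = "sc (zeta_eval N z xi)"
  have "?e * 1 \<in> H.span (T ` G \<union> J)"
    using idW_G by (intro H.span_scale H.span_base) (auto intro: image_eqI[of _ _ idW])
  moreover have "X xi - ?e \<in> H.span (T ` G \<union> J)" using X_diff_J Nil by (intro H.span_base) simp
  ultimately have "?e * 1 + (X xi - ?e) \<in> H.span (T ` G \<union> J)" by (rule H.span_add)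
  then show ?case by simp
next
  case (Cons i js)
  let ?u = "simple_prod js" and ?eta = "act_t N (s i) xi"
  have i: "i \<in> I" "i < N" and js: "set js \<subseteq> I" using Cons.prems I_less by auto
  have u: "?u \<in> G" using simple_prod_G js .
  have "X xi * T (simple_prod (i # js))
      = T (s i) * (X ?eta * T ?u) + sc (rootval (\<alpha> i) ?eta) * T ?u"
    using u i X_T_s[OF i(2)] by (simp add: T_wmul inW_G distrib_right flip: mult.assoc)
  also have "\<dots> \<in> H.span (T ` G \<union> J)"
    using Cons.IH[OF js act_t_V[OF s_G[OF i(1)] Cons.prems(2)]] u s_G[OF i(1)]
    by (intro H.span_add H.span_scale T_mult_span_T) (auto intro: H.span_base)
  finally show ?case .
qed

lemma X_mult_T:
  assumes w: "w \<in> G" and xi: "xi \<in> V"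
  shows "X xi * T w \<in> H.span (T ` G \<union> J)"
proof -
  obtain k js where k: "pi_pow k \<in> G" and js: "set js \<subseteq> I" and "reduced_expr N w (k, js)"
    using ex_reduced_expr_G[OF w] by blast
  then have w_eq: "w = wmul (pi_pow k) (simple_prod js)"
    by (simp add: reduced_expr_def word_eq_simple_prod)
  let ?xi = "act_t N (winv (pi_pow k)) xi"
  have "X xi * T w = T (pi_pow k) * (X ?xi * T (simple_prod js))"
    using T_pi_pow_X[of k ?xi] simple_prod_G[OF js]
    by (simp add: w_eq T_wmul inW_G flip: mult.assoc)
  then show ?thesis
    using T_mult_span_T[OF k X_mult_T_simple_prod[OF js act_t_V[OF winv_G[OF k] xi]]] by simp
qed

lemma subalg_subset_span_T: "subalg sc (T ` G \<union> X ` V) \<subseteq> H.span (T ` G \<union> J)"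
proof
  fix h assume h: "h \<in> subalg sc (T ` G \<union> X ` V)"
  have "h * m \<in> H.span (T ` G \<union> J)" if "m \<in> H.span (T ` G \<union> J)" for m
    using h that
  proof (induction arbitrary: m rule: subalg.induct)
    case (2 g)
    then consider (T) u where "u \<in> G" "g = T u" | (X) xi where "xi \<in> V" "g = X xi" by blast
    then show ?case
    proof cases
      case X
      show ?thesis
      proof (rule mult_in_subspace_if_span[OF \<open>m \<in> _\<close>])
        fix b assume "b \<in> T ` G \<union> J"
        then show "g * b \<in> H.span (T ` G \<union> J)"
          using X X_mult_T mult_J[OF X_A] J_subset_span by blast
      qed simp
    qed (use 2 T_mult_span_T in blast)
  qed (auto simp: distrib_right mult.assoc intro: H.span_scale H.span_add)
  moreover have "1 \<in> H.span (T ` G \<union> J)"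
    using idW_G by (intro H.span_base) (auto intro: image_eqI[of _ _ idW])
  ultimately show "h \<in> H.span (T ` G \<union> J)" by fastforce
qed

definition len_filtration :: "nat \<Rightarrow> 'h set" where
  "len_filtration n = H.span (T ` {v \<in> G. len N v < n} \<union> J)"

lemma subspace_len_filtration: "H.subspace (len_filtration n)"
  unfolding len_filtration_def by simp

lemma T_in_len_filtration: "v \<in> G \<Longrightarrow> len N v < n \<Longrightarrow> T v \<in> len_filtration n"
  unfolding len_filtration_def by (rule H.span_base) blast

lemma J_subset_len_filtration: "J \<subseteq> len_filtration n"
  unfolding len_filtration_def by (rule J_subset_span)

lemma len_filtration_mono: "m \<le> n \<Longrightarrow> len_filtration m \<subseteq> len_filtration n"
  unfolding len_filtration_def by (rule H.span_mono) auto

lemma T_mult_len_filtration: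
  assumes u: "u \<in> G" and m: "m \<in> len_filtration n"
    and len: "\<And>v. v \<in> G \<Longrightarrow> len N v < n \<Longrightarrow> len N (wmul u v) < n'"
  shows "T u * m \<in> len_filtration n'"
  using m unfolding len_filtration_def[of n]
proof (rule mult_in_subspace_if_span[OF _ subspace_len_filtration])
  fix g assume "g \<in> T ` {v \<in> G. len N v < n} \<union> J"
  then consider (T) v where "v \<in> G" "len N v < n" "g = T v" | (J) "g \<in> J" by blast
  then show "T u * g \<in> len_filtration n'"
  proof cases
    case T
    then show ?thesis
      using T_in_len_filtration[OF wmul_G[OF u] len] u by (simp add: inW_G flip: T_wmul)
  next
    case J
    then show ?thesis using mult_J[OF T_A[OF u]] J_subset_len_filtration by blast
  qed
qed

end

locale regular_weight_module = weight_module +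
  assumes pair_nonzero: "y \<in> G \<Longrightarrow> i \<in> I \<Longrightarrow> pair (act_dual y z) (\<alpha> i) \<noteq> 0"
begin

lemma \<Phi>_prod_triangular:
  "set js \<subseteq> I \<Longrightarrow> \<exists>c. c \<noteq> 0 \<and> \<Phi>_prod js - sc c * T (simple_prod js) \<in> len_filtration (length js)"
proof (induction js)
  case Nil
  show ?case using H.subspace_0[OF subspace_len_filtration] by (intro exI[of _ 1]) simp
next
  case (Cons i js)
  let ?P = "\<Phi>_prod js" and ?u = "simple_prod js" and ?n = "length js"
  have i: "i \<in> I" "i < N" and js: "set js \<subseteq> I" using Cons.prems I_less by auto
  have u: "?u \<in> G" "inW N ?u" using simple_prod_G[OF js] inW_G by auto
  obtain c where c: "c \<noteq> 0" and lower: "?P - sc c * T ?u \<in> len_filtration ?n"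
    using Cons.IH js by blast
  note add_filtration = H.subspace_add[OF subspace_len_filtration]
    and scale_filtration = H.subspace_scale[OF subspace_len_filtration]
  define p where "p = pair (act_dual ?u z) (\<alpha> i)"
  have p: "p \<noteq> 0" using pair_nonzero u i by (simp add: p_def)
  have "set js \<subseteq> {..<N}" using js I_less by auto
  then have len_u: "len N ?u < Suc ?n" using len_simple_prod_le by (simp add: less_Suc_eq_le)
  have "?P = (?P - sc c * T ?u) + sc c * T ?u" by simp
  also have "\<dots> \<in> len_filtration (Suc ?n)"
    using lower len_filtration_mono[of ?n "Suc ?n"] T_in_len_filtration[OF u(1) len_u]
    by (intro add_filtration scale_filtration) auto
  finally have P: "?P \<in> len_filtration (Suc ?n)" .
  have T_lower: "T (s i) * (?P - sc c * T ?u) \<in> len_filtration (Suc ?n)"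
    using len_s_wmul_le[OF _ i(2)] inW_G le_less_trans
    by (intro T_mult_len_filtration[OF s_G[OF i(1)] lower]) fastforce
  have "?P \<in> weight_space ?u"
    using \<Phi>_prod_mult_in_weight_space[OF js inW_idW one_in_weight_space] by simp
  then have "\<Phi> i * ?P - ?P - sc p * (T (s i) * ?P) \<in> len_filtration (Suc ?n)"
    unfolding p_def by (intro subsetD[OF J_subset_len_filtration] \<Phi>_mult_weight_vector i)
  then have "(\<Phi> i * ?P - ?P - sc p * (T (s i) * ?P)) + ?P + sc p * (T (s i) * (?P - sc c * T ?u))
      \<in> len_filtration (Suc ?n)"
    using P T_lower by (intro add_filtration scale_filtration)
  moreover have "sc p * (T (s i) * (sc c * T ?u)) = sc (p * c) * T (simple_prod (i # js))"
    using u i by (simp add: T_wmul pull_sc)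
  ultimately
  have "\<Phi>_prod (i # js) - sc (p * c) * T (simple_prod (i # js)) \<in> len_filtration (Suc ?n)"
    by (simp add: right_diff_distrib del: simple_prod_Cons)
  then show ?case using p c by (intro exI[of _ "p * c"]) simp
qed

lemma \<Phi>_expr_triangular:
  assumes "reduced_expr_in w e"
  shows "\<exists>c. c \<noteq> 0 \<and> \<Phi>_expr e - sc c * T w \<in> len_filtration (len N w)"
proof -
  let ?p = "pi_pow (fst e)" and ?js = "snd e"
  note e = reduced_expr_inD[OF assms]
  obtain c where c: "c \<noteq> 0"
    and lower: "\<Phi>_prod ?js - sc c * T (simple_prod ?js) \<in> len_filtration (len N w)"
    using \<Phi>_prod_triangular[OF e(3)] e(2) by auto
  have "T ?p * (\<Phi>_prod ?js - sc c * T (simple_prod ?js)) \<in> len_filtration (len N w)"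
    by (rule T_mult_len_filtration[OF e(4) lower]) (simp add: len_pi_pow_wmul inW_G)
  moreover have "T w = T ?p * T (simple_prod ?js)"
    using e simple_prod_G[OF e(3)] inW_G by (metis T_wmul)
  ultimately have "\<Phi>_expr e - sc c * T w \<in> len_filtration (len N w)"
    by (simp add: \<Phi>_expr_def right_diff_distrib pull_sc)
  then show ?thesis using c by blast
qed

lemma T_in_span_\<Phi>_expr:
  assumes e: "\<And>w. w \<in> Adm \<Longrightarrow> reduced_expr_in w (e w)"
    and descent: "\<And>w. w \<in> G \<Longrightarrow> w \<notin> Adm \<Longrightarrow>
      \<exists>i\<in>I. neg_root N (wroot w (\<alpha> i)) \<and> T (s i) - 1 \<in> J"
  shows "w \<in> G \<Longrightarrow> T w \<in> H.span ((\<lambda>w. \<Phi>_expr (e w)) ` Adm \<union> J)" (is "_ \<Longrightarrow> _ \<in> ?Z")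
proof (induction "len N w" arbitrary: w rule: less_induct)
  case less
  show ?case
  proof (cases "w \<in> Adm")
    case True
    obtain c where c: "c \<noteq> 0" and lower: "\<Phi>_expr (e w) - sc c * T w \<in> len_filtration (len N w)"
      using \<Phi>_expr_triangular[OF e[OF True]] by blast
    have "len_filtration (len N w) \<subseteq> ?Z"
      unfolding len_filtration_def using less.hyps J_subset_span by (intro H.span_minimal) auto
    then have "\<Phi>_expr (e w) - sc c * T w \<in> ?Z" using lower by blast
    moreover have "\<Phi>_expr (e w) \<in> ?Z" using True by (intro H.span_base) blast
    ultimately have "sc c * T w \<in> ?Z" using H.span_diff by fastforce
    then have "sc (inverse c) * (sc c * T w) \<in> ?Z" by (rule H.span_scale)
    then show ?thesis using c by simp
  next
    case False
    then obtain i where i: "i \<in> I" "neg_root N (wroot w (\<alpha> i))" "T (s i) - 1 \<in> J"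
      using descent less.prems by blast
    let ?w = "wmul w (s i)"
    have w: "inW N w" "?w \<in> G" using less.prems i inW_G wmul_G s_G by auto
    have "T w - T ?w \<in> J"
      using mult_J[OF T_A[OF w(2)] i(3)] w(1) i(1) I_less by (simp add: T_diff_T_wmul_s)
    moreover have "T ?w \<in> ?Z"
      using less.hyps[of ?w] w len_wmul_s_if_neg[OF w(1) I_less[OF i(1)] i(2)] by simp
    ultimately have "(T w - T ?w) + T ?w \<in> ?Z" using J_subset_span by (intro H.span_add) blast+
    then show ?thesis by simp
  qed
qed

lemma subalg_subset_span_\<Phi>_expr:
  assumes "\<And>w. w \<in> Adm \<Longrightarrow> reduced_expr_in w (e w)"
    and "\<And>w. w \<in> G \<Longrightarrow> w \<notin> Adm \<Longrightarrow>
      \<exists>i\<in>I. neg_root N (wroot w (\<alpha> i)) \<and> T (s i) - 1 \<in> J"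
  shows "subalg sc (T ` G \<union> X ` V) \<subseteq> H.span ((\<lambda>w. \<Phi>_expr (e w)) ` Adm \<union> J)"
proof -
  have "T ` G \<union> J \<subseteq> H.span ((\<lambda>w. \<Phi>_expr (e w)) ` Adm \<union> J)"
    using T_in_span_\<Phi>_expr[OF assms] J_subset_span by blast
  then show ?thesis using subalg_subset_span_T H.span_minimal by blast
qed

end

lemma generator_in_lideal: "1 \<in> A \<Longrightarrow> g \<in> G \<Longrightarrow> g \<in> lideal A G"
  using lideal.intros(2)[of 1 A g G] by simp

lemma mult_in_lideal:
  assumes "\<And>a b. a \<in> A \<Longrightarrow> b \<in> A \<Longrightarrow> a * b \<in> A"
  shows "x \<in> lideal A G \<Longrightarrow> a \<in> A \<Longrightarrow> a * x \<in> lideal A G"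
proof (induction rule: lideal.induct)
  case (2 b g)
  then show ?case using lideal.intros(2)[of "a * b" A g G] assms by (simp add: mult.assoc)
qed (auto simp: distrib_left intro: lideal.intros)

lemma prod_list_commute:
  fixes h :: "'a::monoid_mult"
  assumes "\<And>x. x \<in> set xs \<Longrightarrow> x * h = h * x"
  shows "prod_list xs * h = h * prod_list xs"
  using assms
proof (induction xs)
  case (Cons x xs)
  have "prod_list xs * h = h * prod_list xs" using Cons by simp
  then have "prod_list (x # xs) * h = (x * h) * prod_list xs" by (simp add: mult.assoc)
  also have "x * h = h * x" using Cons.prems by simp
  finally show ?case by (simp add: mult.assoc)
qed simp

subsection \<open>Generic weights\<close>

locale generic_standard = ddaha N sc T Xe Xc + parabolic N \<beta>
  for N :: nat and sc :: "complex \<Rightarrow> 'h::ring_1" and T :: "W \<Rightarrow> 'h" and Xe :: "nat \<Rightarrow> 'h" and Xc :: 'h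
    and \<beta> :: "nat list" +
  fixes \<zeta> :: tvec
  assumes t_dual: "t_dual_g N \<beta> \<zeta>" and generic: "generic N \<beta> \<zeta>" and level: "snd \<zeta> \<noteq> 0"
begin

lemma pair_simple_root: "j \<in> Pi\<^sub>\<beta> \<Longrightarrow> pair \<zeta> (\<alpha> j) = -1"
  using t_dual Pi_g_range[of j N \<beta>] unfolding t_dual_g_def by (simp add: simple_root_finite)

lemma pair_nonzero_if_in_R:
  assumes "a \<in> R\<^sub>\<beta>"
  shows "pair \<zeta> a \<noteq> 0"
proof -
  obtain p q k where pqk: "a = (p,q,k)" by (cases a)
  have pq: "k = 0" "1 \<le> p" "p < q" "q \<le> N" "{p..<q} \<subseteq> Pi\<^sub>\<beta>"
    using assms block_eq_iff[of p q] by (auto simp: pqk Rbar_g_pos_iff)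
  have "fst \<zeta> q - fst \<zeta> p = (\<Sum>l=p..<q. fst \<zeta> (Suc l) - fst \<zeta> l)"
    using sum_Suc_diff'[of p q "fst \<zeta>"] pq(3) by simp
  also have "\<dots> = (\<Sum>l=p..<q. 1)"
  proof (rule sum.cong)
    fix l assume l: "l \<in> {p..<q}"
    then have "pair \<zeta> (\<alpha> l) = -1" using pair_simple_root pq(5) by blast
    then show "fst \<zeta> (Suc l) - fst \<zeta> l = 1"
      using l pq(2) by (simp add: simple_root_finite pair_def algebra_simps)
  qed simp
  also have "\<dots> = of_nat (q - p)" by simp
  finally have "fst \<zeta> q - fst \<zeta> p \<noteq> 0" using pq(3) by simp
  then show ?thesis by (simp add: pqk pq(1) pair_def)
qed

lemma pair_pos_root:
  assumes "pos_root N a"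
  shows "pair \<zeta> a \<noteq> 0" "(pair \<zeta> a)\<^sup>2 = 1 \<Longrightarrow> a \<in> R\<^sub>\<beta>"
  using generic[unfolded generic_def, rule_format, of a] assms pair_nonzero_if_in_R[of a]
  by (auto simp: power2_eq_1_iff)

lemma pair_root:
  assumes "is_root N a"
  shows "pair \<zeta> a \<noteq> 0" "(pair \<zeta> a)\<^sup>2 = 1 \<Longrightarrow> a \<in> R\<^sub>\<beta> \<or> opp_root a \<in> R\<^sub>\<beta>"
proof -
  consider "pos_root N a" | "pos_root N (opp_root a)" using assms by (auto simp: neg_root_def)
  then have "pair \<zeta> a \<noteq> 0 \<and> ((pair \<zeta> a)\<^sup>2 = 1 \<longrightarrow> a \<in> R\<^sub>\<beta> \<or> opp_root a \<in> R\<^sub>\<beta>)"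
    using pair_pos_root[of a] pair_pos_root[of "opp_root a"] by cases (auto simp: pair_opp_root)
  then show "pair \<zeta> a \<noteq> 0" "(pair \<zeta> a)\<^sup>2 = 1 \<Longrightarrow> a \<in> R\<^sub>\<beta> \<or> opp_root a \<in> R\<^sub>\<beta>" by auto
qed

lemma pair_act_dual_nonzero: "inW N y \<Longrightarrow> i < N \<Longrightarrow> pair (act_dual y \<zeta>) (\<alpha> i) \<noteq> 0"
  using pair_root(1) by (simp add: pair_act_dual)

lemma restricted_weights_inject:
  assumes u: "inW N u" and v: "inW N v"
    and eq: "\<And>a. zeta_eval N (act_dual u \<zeta>) (a, 0) = zeta_eval N (act_dual v \<zeta>) (a, 0)"
  shows "u = v"
proof -
  have inv_eq: "inv (fst u) j = inv (fst v) j \<and> snd u j = snd v j" if j: "j \<in> {1..N}" for j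
  proof -
    have "zeta_eval N z (\<lambda>i. if i = j then 1 else 0, 0) = fst z j" for z
      using j by (simp add: zeta_eval_def if_distrib[of "(*) _"] cong: if_cong)
    then have coord: "fst \<zeta> (inv (fst u) j) + snd \<zeta> * of_int (snd u j)
        = fst \<zeta> (inv (fst v) j) + snd \<zeta> * of_int (snd v j)"
      using eq[of "\<lambda>i. if i = j then 1 else 0"] by (simp add: act_dual_def)
    have "inv (fst u) j = inv (fst v) j"
    proof (rule ccontr)
      let ?a = "(inv (fst u) j, inv (fst v) j, snd u j - snd v j)"
      assume "inv (fst u) j \<noteq> inv (fst v) j"
      then have "is_root N ?a"
        using inv_fst_inW_in_range_iff u v j by (simp add: is_root_def del: atLeastAtMost_iff)
      moreover have "pair \<zeta> ?a = 0" using coord by (simp add: pair_def algebra_simps)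
      ultimately show False using pair_root(1) by blast
    qed
    then show ?thesis using coord level by simp
  qed
  show ?thesis
  proof (rule window_inject[OF u v])
    fix i assume i: "i \<in> {1..N}"
    then have j: "fst u i \<in> {1..N}" using fst_inW_in_range_iff[OF u] by blast
    have "inv (fst v) (fst u i) = i" using inv_eq[OF j] u by simp
    then have "fst v i = fst u i" using fst_inW_inv_f[OF v, of "fst u i"] by simp
    then show "window u i = window v i" using inv_eq[OF j] by (simp add: window_def)
  qed
qed

end

subsection \<open>The standard module is nonzero\<close>

context ddaha
begin

definition unit_vec :: "nat \<Rightarrow> tvec" where
  "unit_vec i = (\<lambda>j. if j = i then 1 else 0, 0)"

lemma X_unit_vec:
  assumes "i \<in> {1..N}"
  shows "X (unit_vec i) = Xe i"
proof -
  have "X (unit_vec i) = (\<Sum>j\<in>{1..N}. sc (if j = i then 1 else 0) * Xe j)"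
    by (simp add: Xlin_def unit_vec_def)
  also have "\<dots> = (\<Sum>j\<in>{1..N}. if j = i then Xe j else 0)" by (rule sum.cong) auto
  finally show ?thesis using assms by simp
qed

lemma X_central: "X (\<lambda>_. 0, 1) = Xc"
  by (simp add: Xlin_def)

lemma mult_Xmono_induct:
  assumes "P h" and mult_X: "\<And>h xi. P h \<Longrightarrow> P (h * X xi)"
  shows "P (h * Xmono N Xe Xc m)"
proof -
  have power: "P (h * X xi ^ n)" if "P h" for h xi n
  proof (induction n)
    case (Suc n)
    from mult_X[OF this] show ?case by (simp add: mult.assoc power_Suc2 del: power_Suc)
  qed (use that in simp)
  have "P (h * prod_list (map (\<lambda>i. Xe i ^ m i) ks))" if "P h" "set ks \<subseteq> {1..N}" for h ks
    using that
  proof (induction ks arbitrary: h)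
    case (Cons k ks)
    have "P (h * Xe k ^ m k)"
      using power[OF Cons.prems(1), of "unit_vec k"] X_unit_vec Cons.prems(2) by simp
    from Cons.IH[OF this] Cons.prems(2) show ?case by (simp add: mult.assoc)
  qed simp
  from this[OF assms(1), of "[1..<N+1]"]
  have "P (h * prod_list (map (\<lambda>i. Xe i ^ m i) [1..<N+1]))" by fastforce
  from power[OF this, of "(\<lambda>_. 0, 1)" "m 0"] show ?thesis
    by (simp add: Xmono_def X_central mult.assoc del: upt_Suc)
qed

lemma Xmono_Xe:
  assumes i: "i \<in> {1..N}"
  shows "Xmono N Xe Xc m * Xe i = Xmono N Xe Xc (m(i := Suc (m i)))"
proof -
  let ?m = "m(i := Suc (m i))" and ?prod = "\<lambda>m ks. prod_list (map (\<lambda>k. Xe k ^ m k) ks)"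
  define vs where "vs = [Suc i..<N+1]"
  have "[1..<N+1] = [1..<i] @ i # vs"
    using i upt_conv_Cons[of i "N+1"] upt_add_eq_append[of 1 i "N + 1 - i"] by (simp add: vs_def)
  then have Xmono:
    "Xmono N Xe Xc m' = ?prod m' [1..<i] * (Xe i ^ m' i * ?prod m' vs) * Xc ^ m' 0" for m'
    by (simp only: Xmono_def) simp
  have same: "?prod ?m ks = ?prod m ks" if "i \<notin> set ks" for ks
    using that by (intro arg_cong[of _ _ prod_list] map_cong) auto
  have "Xc ^ m 0 * Xe i = Xe i * Xc ^ m 0"
    using Xe_Xc[OF i] by (intro power_commuting_commutes) simp
  then have "?prod m vs * (Xc ^ m 0 * Xe i) = (?prod m vs * Xe i) * Xc ^ m 0"
    by (simp add: mult.assoc)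
  also have "?prod m vs * Xe i = Xe i * ?prod m vs"
    using i by (intro prod_list_commute)
      (auto simp: vs_def intro!: power_commuting_commutes Xe_commute)
  finally have "?prod m vs * (Xc ^ m 0 * Xe i) = Xe i * (?prod m vs * Xc ^ m 0)"
    by (simp add: mult.assoc)
  then have "Xmono N Xe Xc m * Xe i
      = ?prod m [1..<i] * ((Xe i ^ m i * Xe i) * ?prod m vs) * Xc ^ m 0"
    by (simp add: Xmono mult.assoc)
  also have "Xe i ^ m i * Xe i = Xe i ^ ?m i" by (simp add: power_Suc2 del: power_Suc)
  also have "?prod m [1..<i] = ?prod ?m [1..<i]" by (rule same[symmetric]) simp
  also have "?prod m vs = ?prod ?m vs" by (rule same[symmetric]) (simp add: vs_def)
  finally show ?thesis using i by (simp add: Xmono)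
qed

lemma Xmono_Xc: "Xmono N Xe Xc m * Xc = Xmono N Xe Xc (m(0 := Suc (m 0)))"
proof -
  have same: "map (\<lambda>i. Xe i ^ (m(0 := Suc (m 0))) i) [1..<N+1] = map (\<lambda>i. Xe i ^ m i) [1..<N+1]"
    by auto
  show ?thesis unfolding Xmono_def same by (simp add: mult.assoc power_Suc2 del: power_Suc upt_Suc)
qed

definition PBW :: "W \<times> (nat \<Rightarrow> nat) \<Rightarrow> 'h" where
  "PBW p = T (fst p) * Xmono N Xe Xc (snd p)"

abbreviation PBW_index :: "(W \<times> (nat \<Rightarrow> nat)) set" where
  "PBW_index \<equiv> {w. inW N w} \<times> Monos N"

lemma PBW_coefficients_zero:
  "finite F \<Longrightarrow> F \<subseteq> PBW_index \<Longrightarrow> (\<Sum>p\<in>F. sc (a p) * PBW p) = 0 \<Longrightarrow> p \<in> F \<Longrightarrow> a p = 0"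
  unfolding PBW_def by (rule PBW_independent) blast

lemma inj_on_PBW: "inj_on PBW PBW_index"
proof (rule inj_onI, rule ccontr)
  fix p q assume pq: "p \<in> PBW_index" "q \<in> PBW_index" "PBW p = PBW q" "p \<noteq> q"
  let ?a = "\<lambda>r. if r = p then 1 else - 1"
  have "(\<Sum>r\<in>{p, q}. sc (?a r) * PBW r) = 0" using pq(3,4) by (simp add: sc_minus)
  then show False using PBW_coefficients_zero[of "{p, q}" ?a p] pq(1,2) by auto
qed

lemma independent_PBW: "H.independent (PBW ` PBW_index)"
  unfolding H.dependent_explicit
proof
  assume "\<exists>t u. finite t \<and> t \<subseteq> PBW ` PBW_index \<and> (\<Sum>v\<in>t. sc (u v) * v) = 0 \<and> (\<exists>v\<in>t. u v \<noteq> 0)"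
  then obtain t u v where t: "finite t" "t \<subseteq> PBW ` PBW_index" "(\<Sum>v\<in>t. sc (u v) * v) = 0"
    and v: "v \<in> t" "u v \<noteq> 0" by blast
  obtain F where F: "F \<subseteq> PBW_index" "inj_on PBW F" "t = PBW ` F"
    using t(2) by (auto simp: subset_image_inj)
  have "(\<Sum>p\<in>F. sc (u (PBW p)) * PBW p) = 0" using t(3) F by (simp add: sum.reindex)
  then have "u (PBW p) = 0" if "p \<in> F" for p
    using PBW_coefficients_zero[of F "\<lambda>p. u (PBW p)"] F t(1) that finite_image_iff by blast
  then show False using v F(3) by blast
qed

lemma span_PBW: "H.span (PBW ` PBW_index) = UNIV"
proof -
  have "h \<in> H.span (PBW ` PBW_index)" for h
  proof -
    obtain F a where F: "finite F" "F \<subseteq> PBW_index" "h = (\<Sum>p\<in>F. sc (a p) * PBW p)"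
      using PBW_spanning[of h] unfolding PBW_def by blast
    have "(\<Sum>p\<in>F. sc (a p) * PBW p) \<in> H.span (PBW ` PBW_index)"
      using F(2) by (intro H.span_sum H.span_scale H.span_base) blast
    then show ?thesis using F(3) by simp
  qed
  then show ?thesis by blast
qed

lemma subspace_eq_UNIV_if_PBW:
  assumes "H.subspace S" "\<And>w m. inW N w \<Longrightarrow> m \<in> Monos N \<Longrightarrow> T w * Xmono N Xe Xc m \<in> S"
  shows "S = UNIV"
proof -
  have "H.span (PBW ` PBW_index) \<subseteq> S" using assms by (intro H.span_minimal) (auto simp: PBW_def)
  then show ?thesis unfolding span_PBW by blast
qed

lemma subalg_all: "subalg sc (T ` {w. inW N w} \<union> range X) = UNIV" (is "?S = _")
proof (rule subspace_eq_UNIV_if_PBW)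
  show "H.subspace ?S"
    using subalg.intros(1)[of sc 0] by (intro H.subspaceI) (auto intro: subalg.intros)
  fix w m assume "inW N w"
  then have "T w \<in> ?S" by (intro subalg.intros(2)) blast
  moreover have "h * X xi \<in> ?S" if "h \<in> ?S" for h xi
    by (rule subalg.intros(4)[OF that subalg.intros(2)]) blast
  ultimately show "T w * Xmono N Xe Xc m \<in> ?S" by (rule mult_Xmono_induct)
qed

end

context generic_standard
begin

abbreviation J :: "'h set" where "J \<equiv> Jideal N sc T Xe Xc \<beta> \<zeta>"

definition \<zeta>_mono :: "(nat \<Rightarrow> nat) \<Rightarrow> complex" where
  "\<zeta>_mono m = (\<Prod>i\<in>{1..N}. fst \<zeta> i ^ m i) * snd \<zeta> ^ m 0"

lemma \<zeta>_mono_Xe: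
  assumes i: "i \<in> {1..N}"
  shows "\<zeta>_mono (m(i := Suc (m i))) = \<zeta>_mono m * fst \<zeta> i"
proof -
  have "(\<Prod>j\<in>{1..N} - {i}. fst \<zeta> j ^ (m(i := Suc (m i))) j) = (\<Prod>j\<in>{1..N} - {i}. fst \<zeta> j ^ m j)"
    by (intro prod.cong) auto
  then have "(\<Prod>j\<in>{1..N}. fst \<zeta> j ^ (m(i := Suc (m i))) j) = fst \<zeta> i * (\<Prod>j\<in>{1..N}. fst \<zeta> j ^ m j)"
    unfolding prod.remove[OF finite_atLeastAtMost i] by simp
  then show ?thesis unfolding \<zeta>_mono_def using i by simp
qed

lemma \<zeta>_mono_Xc: "\<zeta>_mono (m(0 := Suc (m 0))) = \<zeta>_mono m * snd \<zeta>"
proof -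
  have "(\<Prod>j\<in>{1..N}. fst \<zeta> j ^ (m(0 := Suc (m 0))) j) = (\<Prod>j\<in>{1..N}. fst \<zeta> j ^ m j)"
    by (intro prod.cong) auto
  then show ?thesis unfolding \<zeta>_mono_def by simp
qed

definition \<chi> :: "'h \<Rightarrow> complex" where
  "\<chi> = (SOME f. Vector_Spaces.linear (\<lambda>a h. sc a * h) (*) f \<and>
    (\<forall>w m. inW N w \<longrightarrow> m \<in> Monos N \<longrightarrow> f (T w * Xmono N Xe Xc m) = \<zeta>_mono m))"

lemma
  shows linear_\<chi>: "Vector_Spaces.linear (\<lambda>a h. sc a * h) (*) \<chi>"
    and \<chi>_PBW: "inW N w \<Longrightarrow> m \<in> Monos N \<Longrightarrow> \<chi> (T w * Xmono N Xe Xc m) = \<zeta>_mono m"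
proof -
  interpret H_C: vector_space_pair "\<lambda>a h. sc a * h" "(*) :: complex \<Rightarrow> complex \<Rightarrow> complex"
    by unfold_locales (simp_all add: algebra_simps)
  obtain f where f: "Vector_Spaces.linear (\<lambda>a h. sc a * h) (*) f"
    "\<forall>b\<in>PBW ` PBW_index. f b = \<zeta>_mono (snd (inv_into PBW_index PBW b))"
    using H_C.linear_independent_extend[OF independent_PBW,
        of "\<lambda>b. \<zeta>_mono (snd (inv_into PBW_index PBW b))"] by blast
  have "f (T w * Xmono N Xe Xc m) = \<zeta>_mono m" if "inW N w" "m \<in> Monos N" for w m
    using f(2) that inv_into_f_f[OF inj_on_PBW, of "(w, m)"] by (auto simp: PBW_def)
  with f(1) have "\<exists>f. Vector_Spaces.linear (\<lambda>a h. sc a * h) (*) f \<and>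
    (\<forall>w m. inW N w \<longrightarrow> m \<in> Monos N \<longrightarrow> f (T w * Xmono N Xe Xc m) = \<zeta>_mono m)" by blast
  from someI_ex[OF this] show "Vector_Spaces.linear (\<lambda>a h. sc a * h) (*) \<chi>"
    "inW N w \<Longrightarrow> m \<in> Monos N \<Longrightarrow> \<chi> (T w * Xmono N Xe Xc m) = \<zeta>_mono m"
    unfolding \<chi>_def by blast+
qed

lemmas module_hom_\<chi> = linear_\<chi>[folded module_hom_iff_linear]
lemmas \<chi>_add = module_hom.add[OF module_hom_\<chi>] and \<chi>_diff = module_hom.diff[OF module_hom_\<chi>]
  and \<chi>_scale = module_hom.scale[OF module_hom_\<chi>] and \<chi>_sum = module_hom.sum[OF module_hom_\<chi>]
  and \<chi>_0 = module_hom.zero[OF module_hom_\<chi>]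

lemma \<chi>_T:
  assumes "inW N w"
  shows "\<chi> (T w) = 1"
proof -
  have "(\<lambda>_. 0) \<in> Monos N" "Xmono N Xe Xc (\<lambda>_. 0) = 1" "\<zeta>_mono (\<lambda>_. 0) = 1"
    by (simp_all add: Monos_def Xmono_def \<zeta>_mono_def map_replicate_const)
  then show ?thesis using \<chi>_PBW[OF assms, of "\<lambda>_. 0"] by simp
qed

lemma \<chi>_mult_X: "\<chi> (h * X xi) = \<chi> h * zeta_eval N \<zeta> xi"
proof -
  let ?S = "{h. \<chi> (h * X xi) = \<chi> h * zeta_eval N \<zeta> xi}"
  have "?S = UNIV"
  proof (rule subspace_eq_UNIV_if_PBW)
    show "H.subspace ?S"
      by (rule H.subspaceI) (simp_all add: distrib_right mult.assoc \<chi>_0 \<chi>_add \<chi>_scale)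
    fix w m assume w: "inW N w" and m: "m \<in> Monos N"
    let ?B = "T w * Xmono N Xe Xc m"
    have up: "m(i := Suc (m i)) \<in> Monos N" if "i \<le> N" for i using m that by (auto simp: Monos_def)
    have Xe: "\<chi> (?B * Xe i) = \<zeta>_mono m * fst \<zeta> i" if "i \<in> {1..N}" for i
      using \<chi>_PBW[OF w up[of i]] that by (simp add: mult.assoc Xmono_Xe \<zeta>_mono_Xe)
    have Xc: "\<chi> (?B * Xc) = \<zeta>_mono m * snd \<zeta>"
      using \<chi>_PBW[OF w up[of 0]] by (simp add: mult.assoc Xmono_Xc \<zeta>_mono_Xc)
    have "?B * X xi = (\<Sum>i\<in>{1..N}. sc (fst xi i) * (?B * Xe i)) + sc (snd xi) * (?B * Xc)"
      by (simp only: Xlin_def distrib_left sum_distrib_left sc_left_commute[of ?B])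
    then have "\<chi> (?B * X xi)
        = (\<Sum>i\<in>{1..N}. fst xi i * (\<zeta>_mono m * fst \<zeta> i)) + snd xi * (\<zeta>_mono m * snd \<zeta>)"
      by (simp only: \<chi>_add \<chi>_sum \<chi>_scale Xc) (simp add: Xe)
    also have "\<dots> = \<chi> ?B * zeta_eval N \<zeta> xi"
      by (simp add: \<chi>_PBW[OF w m] zeta_eval_def distrib_left sum_distrib_left mult_ac)
    finally show "?B \<in> ?S" by simp
  qed
  then show ?thesis by blast
qed

lemma \<chi>_X_kernel: "\<chi> (h * (X xi - sc (zeta_eval N \<zeta> xi))) = 0"
proof -
  have "h * (X xi - sc (zeta_eval N \<zeta> xi)) = h * X xi - sc (zeta_eval N \<zeta> xi) * h"
    by (simp add: right_diff_distrib sc_commute)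
  then show ?thesis by (simp add: \<chi>_diff \<chi>_scale \<chi>_mult_X)
qed

lemma \<chi>_s_kernel:
  assumes i: "i \<in> Pi\<^sub>\<beta>"
  shows "\<chi> (h * (T (s i) - 1)) = 0"
proof -
  have iN: "i < N" using Pi_g_range[OF i] by simp
  let ?S = "{h. \<chi> (h * (T (s i) - 1)) = 0}"
  have mult_X: "h * X xi \<in> ?S" if "h \<in> ?S" for h xi
  proof -
    let ?eta = "act_t N (s i) xi"
    let ?e = "zeta_eval N \<zeta> ?eta"
    have "zeta_eval N \<zeta> xi = ?e + rootval (\<alpha> i) ?eta"
      using zeta_eval_act_t_s[OF iN, of \<zeta> ?eta] pair_simple_root[OF i] iN by simp
    then have "X xi * (T (s i) - 1)
        = T (s i) * (X ?eta - sc ?e) - (X xi - sc (zeta_eval N \<zeta> xi)) + sc ?e * (T (s i) - 1)"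
      using X_T_s[OF iN, of xi] by (simp add: sc_add sc_commute algebra_simps)
    then have "h * X xi * (T (s i) - 1) = h * T (s i) * (X ?eta - sc ?e)
        - h * (X xi - sc (zeta_eval N \<zeta> xi)) + sc ?e * (h * (T (s i) - 1))"
      by (simp only: mult.assoc distrib_left right_diff_distrib[of h] sc_left_commute[of h])
    then show ?thesis using that by (simp add: \<chi>_add \<chi>_diff \<chi>_scale \<chi>_X_kernel)
  qed
  have "?S = UNIV"
  proof (rule subspace_eq_UNIV_if_PBW)
    show "H.subspace ?S"
      by (rule H.subspaceI) (simp_all add: distrib_right mult.assoc \<chi>_0 \<chi>_add \<chi>_scale)
    fix w m assume w: "inW N w"
    have "T w * (T (s i) - 1) = T (wmul w (s i)) - T w"
      using w iN by (simp add: T_wmul right_diff_distrib)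
    then have "T w \<in> ?S" using w iN by (simp add: \<chi>_diff \<chi>_T)
    then show "T w * Xmono N Xe Xc m \<in> ?S"
      using mult_X by (rule mult_Xmono_induct[of "\<lambda>h. h \<in> ?S"])
  qed
  then show ?thesis by blast
qed

lemma \<chi>_Wbar_g_kernel: "w \<in> Wbar_g N \<beta> \<Longrightarrow> \<chi> (h * (T w - 1)) = 0"
proof (induction arbitrary: h rule: Wbar_g.induct)
  case (2 i w)
  have "inW N w" "i < N" using inWbar_Wbar_g[OF 2(2)] Pi_g_range[OF 2(1)] by auto
  then have "h * (T (wmul (s i) w) - 1) = h * T (s i) * (T w - 1) + h * (T (s i) - 1)"
    by (simp only: T_s_wmul_diff_one distrib_left mult.assoc)
  then show ?case using 2(3)[of "h * T (s i)"] \<chi>_s_kernel[OF 2(1), of h] by (simp add: \<chi>_add)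
qed (simp add: \<chi>_0)

lemma one_notin_J: "1 \<notin> J"
proof
  have "\<chi> x = 0" if "x \<in> J" for x
    using that unfolding Jideal_def
    by (induction rule: lideal.induct) (auto simp: \<chi>_0 \<chi>_add \<chi>_Wbar_g_kernel \<chi>_X_kernel)
  moreover assume "1 \<in> J"
  ultimately show False using \<chi>_T[OF inW_idW] by auto
qed

sublocale Y: regular_weight_module N sc T Xe Xc UNIV "{w. inW N w}" "{..<N}" UNIV J \<zeta>
proof unfold_locales
  fix w assume "w \<in> {w. inW N w}"
  then obtain e where e: "reduced_expr N w e" using reduced_expr_exists by blast
  then show "\<exists>k js. pi_pow k \<in> {w. inW N w} \<and> set js \<subseteq> {..<N} \<and> reduced_expr N w (k, js)"
    by (cases e) (auto simp: reduced_expr_def)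
next
  fix xi show "X xi - sc (zeta_eval N \<zeta> xi) \<in> J"
    unfolding Jideal_def by (rule generator_in_lideal) blast+
next
  fix x j assume "j \<in> J"
  then show "x * j \<in> J" unfolding Jideal_def by (intro mult_in_lideal) auto
next
  fix y i assume "y \<in> {w. inW N w}" "i \<in> {..<N}"
  then show "pair (act_dual y \<zeta>) (\<alpha> i) \<noteq> 0" using pair_act_dual_nonzero by simp
qed (auto simp: Jideal_def intro: lideal.intros)

end

context generic_standard
begin

subsection \<open>The weight basis of the standard module\<close>

abbreviation \<phi> :: "W \<Rightarrow> 'h" where "\<phi> \<equiv> phi_w N sc T Xe Xc"

definition reduced_word :: "W \<Rightarrow> int \<times> nat list" where
  "reduced_word w = (SOME e. reduced_expr N w e)"

lemma \<phi>_eq_\<Phi>_expr: "\<phi> w = \<Phi>_expr (reduced_word w)"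
  by (simp add: phi_w_def \<Phi>_expr_def \<Phi>_prod_def reduced_word_def Let_def)

lemma reduced_word_in:
  assumes "inW N w"
  shows "Y.reduced_expr_in w (reduced_word w)"
  using someI_ex[OF reduced_expr_exists[OF assms]]
  by (auto simp: Y.reduced_expr_in_def reduced_word_def reduced_expr_def)

lemma \<phi>_in_weight_space: "inW N w \<Longrightarrow> \<phi> w \<in> Y.weight_space w"
  unfolding \<phi>_eq_\<Phi>_expr by (rule Y.\<Phi>_expr_in_weight_space[OF reduced_word_in])

lemma scaled_\<phi>_in_weight_space: "inW N w \<Longrightarrow> sc a * \<phi> w \<in> Y.weight_space w"
  by (intro H.subspace_scale[OF Y.subspace_weight_space] \<phi>_in_weight_space)

lemma T_s_diff_one_in_J: "i \<in> Pi\<^sub>\<beta> \<Longrightarrow> T (s i) - 1 \<in> J"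
  unfolding Jideal_def using s_in_Wbar_g by (intro generator_in_lideal) blast+

lemma span_\<phi>: "H.span (\<phi> ` Wmin N \<beta> \<union> J) = UNIV"
proof -
  have "subalg sc (T ` {w. inW N w} \<union> range X)
      \<subseteq> H.span ((\<lambda>w. \<Phi>_expr (reduced_word w)) ` Wmin N \<beta> \<union> J)"
  proof (rule Y.subalg_subset_span_\<Phi>_expr)
    show "Y.reduced_expr_in w (reduced_word w)" if "w \<in> Wmin N \<beta>" for w
      using reduced_word_in that by simp
    fix w assume w: "w \<in> {w. inW N w}" "w \<notin> Wmin N \<beta>"
    then obtain j where "j \<in> Pi\<^sub>\<beta>" "neg_root N (wroot w (\<alpha> j))"
      using ex_neg_simple_root unfolding Wmin_iff by blast
    then show "\<exists>i\<in>{..<N}. neg_root N (wroot w (\<alpha> i)) \<and> T (s i) - 1 \<in> J"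
      using T_s_diff_one_in_J Pi_g_range by blast
  qed
  then show ?thesis using subalg_all by (auto simp: \<phi>_eq_\<Phi>_expr)
qed

lemma weight_components_in_subspace:
  assumes U: "H.subspace U" "J \<subseteq> U" "\<And>a u. u \<in> U \<Longrightarrow> X (a, 0) * u \<in> U"
    and P: "finite P" and v: "\<And>p. p \<in> P \<Longrightarrow> v p \<in> Y.weight_space (y p)"
    and y: "\<And>p. p \<in> P \<Longrightarrow> inW N (y p)" "inj_on y P"
    and sum: "(\<Sum>p\<in>P. v p) \<in> U"
  shows "p \<in> P \<Longrightarrow> v p \<in> U"
proof (rule H.eigencomponents_in_subspace[where f = "\<lambda>a h. X (a, 0) * h"
      and ev = "\<lambda>p a. zeta_eval N (act_dual (y p) \<zeta>) (a, 0)",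
      OF U(1) linear_mult_left U(3) P _ _ sum])
  fix p a assume "p \<in> P"
  then show "X (a, 0) * v p - sc (zeta_eval N (act_dual (y p) \<zeta>) (a, 0)) * v p \<in> U"
    using Y.weight_spaceD[OF v] U(2) by blast
next
  fix p q assume pq: "p \<in> P" "q \<in> P" "p \<noteq> q"
  then have "y p \<noteq> y q" using y(2) by (auto simp: inj_on_def)
  then show "\<exists>a. zeta_eval N (act_dual (y p) \<zeta>) (a, 0) \<noteq> zeta_eval N (act_dual (y q) \<zeta>) (a, 0)"
    using restricted_weights_inject y(1) pq by blast
qed

lemma weight_vector_multiple_of_\<phi>:
  assumes v: "v \<in> Y.weight_space y" and y: "inW N y" and v_notin: "v \<notin> J"
  obtains a where "y \<in> Wmin N \<beta>" "a \<noteq> 0" "v - sc a * \<phi> y \<in> J"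
proof -
  obtain F a where F: "finite F" "F \<subseteq> Wmin N \<beta>" and v_diff: "v - (\<Sum>w\<in>F. sc (a w) * \<phi> w) \<in> J"
    using H.span_image_mod_subspace[OF Y.subspace_J, of v \<phi> "Wmin N \<beta>"] span_\<phi> by blast
  let ?f = "\<lambda>w. (if w = y then v else 0) + (if w \<in> F then sc (- a w) * \<phi> w else 0)"
  have "(\<Sum>w\<in>insert y F. if w \<in> F then sc (- a w) * \<phi> w else 0) = (\<Sum>w\<in>F. sc (- a w) * \<phi> w)"
    using F(1) by (intro sum.mono_neutral_cong_right) auto
  then have "(\<Sum>w\<in>insert y F. ?f w) = v - (\<Sum>w\<in>F. sc (a w) * \<phi> w)"
    using F(1) by (simp add: sum.distrib sum_negf sc_minus del: sum.insert)
  then have sum: "(\<Sum>w\<in>insert y F. ?f w) \<in> J" using v_diff by simp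
  have weight: "?f w \<in> Y.weight_space w" if "w \<in> insert y F" for w
  proof (rule H.subspace_add[OF Y.subspace_weight_space])
    have zero: "0 \<in> Y.weight_space w" by (rule H.subspace_0[OF Y.subspace_weight_space])
    show "(if w = y then v else 0) \<in> Y.weight_space w" using v zero by simp
    show "(if w \<in> F then sc (- a w) * \<phi> w else 0) \<in> Y.weight_space w"
      using scaled_\<phi>_in_weight_space[of w "- a w"] F(2) zero by auto
  qed
  have "?f y \<in> J"
    by (rule weight_components_in_subspace[OF Y.subspace_J, where P = "insert y F" and y = "\<lambda>w. w"])
      (use weight sum F y Y.mult_J in auto)
  then have "y \<in> F" and "v - sc (a y) * \<phi> y \<in> J"
    using v_notin by (auto simp: sc_minus split: if_splits)
  moreover from this(2) have "a y \<noteq> 0" using v_notin by auto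
  ultimately show ?thesis using that F(2) by blast
qed

lemma \<Phi>_mult_notin_J:
  assumes y: "y \<in> Wmin N \<beta>" and i: "i < N" and s_y: "wmul (s i) y \<in> Wmin N \<beta>"
    and v: "v \<in> Y.weight_space y" "v \<notin> J"
  shows "\<Phi> i * v \<notin> J"
proof
  assume in_J: "\<Phi> i * v \<in> J"
  let ?a = "wroot (winv y) (\<alpha> i)" and ?c = "1 - (pair (act_dual y \<zeta>) (\<alpha> i))\<^sup>2"
  have iy: "inW N y" using y by simp
  have "?a \<notin> R\<^sub>\<beta>" using s_wmul_in_Wmin_iff[OF y i] s_y by blast
  then have "(pair \<zeta> ?a)\<^sup>2 \<noteq> 1"
    using pair_root(2)[of ?a] opp_root_wroot_winv_notin_R[OF y i] iy i by auto
  then have c: "?c \<noteq> 0" by (simp add: pair_act_dual[OF iy])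
  have "\<Phi> i * (\<Phi> i * v) \<in> J" using Y.mult_J in_J by simp
  then have "sc ?c * v \<in> J"
    using Y.diff_in_J_imp_iff[OF Y.\<Phi>_\<Phi>_mult_weight_vector[OF _ v(1), of i]] i by simp
  then show False using Y.scale_in_J_iff[OF c] v(2) by blast
qed

lemma \<Phi>_prod_mult_notin_J:
  assumes x: "x \<in> Wmin N \<beta>" and v: "v \<in> Y.weight_space x" "v \<notin> J"
  shows "set js \<subseteq> {..<N} \<Longrightarrow> len N (simple_prod js) = length js \<Longrightarrow>
    wmul (simple_prod js) x \<in> Wmin N \<beta> \<Longrightarrow> \<Phi>_prod js * v \<notin> J"
proof (induction js)
  case (Cons i js)
  have i: "i < N" and js: "set js \<subseteq> {..<N}" using Cons.prems by auto
  have ix: "inW N x" and iu: "inW N (simple_prod js)" using x js by auto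
  note reduced = reduced_simple_prod_ConsD[OF Cons.prems(1,2)]
  have s_eq: "wmul (s i) (wmul (simple_prod (i # js)) x) = wmul (simple_prod js) x"
    "wmul (s i) (wmul (simple_prod js) x) = wmul (simple_prod (i # js)) x"
    using i iu ix by (simp_all add: wmul_assoc)
  have y: "wmul (simple_prod js) x \<in> Wmin N \<beta>"
    using s_wmul_in_Wmin_if_neg[OF x _ Cons.prems(3) i reduced(2)] i iu s_eq(1) by simp
  have "\<Phi> i * (\<Phi>_prod js * v) \<notin> J"
  proof (rule \<Phi>_mult_notin_J[OF y i])
    show "wmul (s i) (wmul (simple_prod js) x) \<in> Wmin N \<beta>" unfolding s_eq(2) by (rule Cons.prems(3))
    show "\<Phi>_prod js * v \<in> Y.weight_space (wmul (simple_prod js) x)"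
      using Y.\<Phi>_prod_mult_in_weight_space js ix v(1) by blast
    show "\<Phi>_prod js * v \<notin> J" using Cons.IH js reduced(1) y by blast
  qed
  then show ?case by (simp add: mult.assoc)
qed (use v in simp)

lemma \<phi>_notin_J:
  assumes w: "w \<in> Wmin N \<beta>"
  shows "\<phi> w \<notin> J"
proof
  assume in_J: "\<phi> w \<in> J"
  let ?p = "pi_pow (fst (reduced_word w))" and ?js = "snd (reduced_word w)"
  have "Y.reduced_expr_in w (reduced_word w)" using reduced_word_in w by simp
  note e = Y.reduced_expr_inD[OF this]
  have iu: "inW N (simple_prod ?js)" using e(3) by simp
  have "simple_prod ?js \<in> Wmin N \<beta>"
  proof (rule WminI[OF iu])
    fix a assume a: "a \<in> R\<^sub>\<beta>"
    have "pos_root N (wroot ?p (wroot (simple_prod ?js) a))"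
      using WminD[OF w a] e(1) wroot_wmul[OF inW_pi_pow] by metis
    then show "pos_root N (wroot (simple_prod ?js) a)"
      using pos_root_wroot_pi_pow iu is_root_if_pos[OF pos_root_if_in_R[OF a]] by simp
  qed
  moreover have "len N (simple_prod ?js) = length ?js"
    using e(2) arg_cong[OF e(1), of "len N"] len_pi_pow_wmul[OF iu] by simp
  ultimately have "\<Phi>_prod ?js * 1 \<notin> J"
    using \<Phi>_prod_mult_notin_J[OF idW_in_Wmin Y.one_in_weight_space one_notin_J e(3)] by simp
  moreover have "T (winv ?p) * \<phi> w = \<Phi>_prod ?js"
    by (simp add: \<phi>_eq_\<Phi>_expr \<Phi>_expr_def T_winv_T flip: mult.assoc)
  ultimately show False using Y.mult_J[OF UNIV_I in_J, of "T (winv ?p)"] by simp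
qed

subsection \<open>The summands\<close>

abbreviation Hb :: "'h set" where "Hb \<equiv> Hbar N sc T Xe Xc"

lemma Hbar_eq_subalg: "Hb = subalg sc (T ` {w. inWbar N w} \<union> X ` {xi. snd xi = 0})"
proof -
  have "{T w | w. inWbar N w} = T ` {w. inWbar N w}" by blast
  moreover have "{X (a, 0) | a. True} = X ` {xi. snd xi = 0}" by (auto simp: image_iff)
  ultimately show ?thesis unfolding Hbar_def by simp
qed

lemma Hbar_sc: "sc a \<in> Hb"
  and Hbar_add: "x \<in> Hb \<Longrightarrow> y \<in> Hb \<Longrightarrow> x + y \<in> Hb"
  and Hbar_mult: "x \<in> Hb \<Longrightarrow> y \<in> Hb \<Longrightarrow> x * y \<in> Hb"
  unfolding Hbar_def by (auto intro: subalg.intros)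

lemma subspace_Hbar: "H.subspace Hb"
  by (rule H.subspaceI) (use Hbar_sc[of 0] Hbar_sc Hbar_add Hbar_mult in auto)

lemma Hbar_T: "inWbar N w \<Longrightarrow> T w \<in> Hb"
  and Hbar_X: "snd xi = 0 \<Longrightarrow> X xi \<in> Hb"
  unfolding Hbar_eq_subalg by (rule subalg.intros(2); blast)+

lemma Hbar_1: "1 \<in> Hb"
  using Hbar_sc[of 1] by simp

lemma snd_coroot_finite: "1 \<le> i \<Longrightarrow> snd (coroot (\<alpha> i)) = 0"
  by (simp add: simple_root_finite coroot_def)

lemma Hbar_\<Phi>: "1 \<le> i \<Longrightarrow> i < N \<Longrightarrow> \<Phi> i \<in> Hb"
  unfolding \<Phi>_eq by (intro Hbar_add Hbar_1 Hbar_mult Hbar_T Hbar_X inWbar_s snd_coroot_finite)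

definition submodule :: "'h set \<Rightarrow> bool" where
  "submodule U \<longleftrightarrow> J \<subseteq> U \<and> (\<forall>u\<in>U. \<forall>v\<in>U. u + v \<in> U) \<and> (\<forall>a\<in>Hb. \<forall>u\<in>U. a * u \<in> U)"

lemma submoduleD:
  assumes "submodule U"
  shows "J \<subseteq> U" "u \<in> U \<Longrightarrow> v \<in> U \<Longrightarrow> u + v \<in> U" "a \<in> Hb \<Longrightarrow> u \<in> U \<Longrightarrow> a * u \<in> U"
  using assms by (auto simp: submodule_def)

lemma subspace_submodule:
  assumes "submodule U"
  shows "H.subspace U"
  by (rule H.subspaceI) (use submoduleD[OF assms] Y.zero_J Hbar_sc in auto)

definition summand :: "W \<Rightarrow> 'h set" where
  "summand x = {h * \<phi> x + j | h j. h \<in> Hb \<and> j \<in> J}"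

lemma submodule_summand: "submodule (summand x)"
  unfolding submodule_def
proof (intro conjI ballI subsetI)
  fix j assume "j \<in> J"
  then have "j = sc 0 * \<phi> x + j \<and> sc 0 \<in> Hb \<and> j \<in> J" using Hbar_sc[of 0] by simp
  then show "j \<in> summand x" unfolding summand_def by blast
next
  fix u v assume "u \<in> summand x" "v \<in> summand x"
  then obtain h j h' j' where u: "u = h * \<phi> x + j" "h \<in> Hb" "j \<in> J"
    and v: "v = h' * \<phi> x + j'" "h' \<in> Hb" "j' \<in> J" unfolding summand_def by blast
  have "u + v = (h + h') * \<phi> x + (j + j')" by (simp add: u v distrib_right)
  then show "u + v \<in> summand x" unfolding summand_def using u v Hbar_add Y.add_J by blast
next
  fix a u assume a: "a \<in> Hb" and "u \<in> summand x"
  then obtain h j where u: "u = h * \<phi> x + j" "h \<in> Hb" "j \<in> J" unfolding summand_def by blast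
  have "a * u = (a * h) * \<phi> x + a * j" by (simp add: u distrib_left mult.assoc)
  then show "a * u \<in> summand x" unfolding summand_def using a u Hbar_mult Y.mult_J by blast
qed

lemma \<phi>_in_summand: "\<phi> x \<in> summand x"
proof -
  have "\<phi> x = 1 * \<phi> x + 0" by simp
  then show ?thesis unfolding summand_def using Hbar_1 Y.zero_J by blast
qed

lemma summand_subset: "submodule U \<Longrightarrow> \<phi> x \<in> U \<Longrightarrow> summand x \<subseteq> U"
  using submoduleD[of U] by (auto simp: summand_def)

lemma \<phi>_s_wmul_in_summand:
  assumes w: "w \<in> Wmin N \<beta>" "wmul (s i) w \<in> Wmin N \<beta>" and i: "1 \<le> i" "i < N"
  shows "\<phi> (wmul (s i) w) \<in> summand w"
proof -
  have iw: "inW N w" using w by simp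
  have "\<Phi> i * \<phi> w \<notin> J"
    using \<Phi>_mult_notin_J[OF w(1) i(2) w(2)] \<phi>_in_weight_space[OF iw] \<phi>_notin_J[OF w(1)] by blast
  moreover have "\<Phi> i * \<phi> w \<in> Y.weight_space (wmul (s i) w)"
    using Y.\<Phi>_mult_in_weight_space \<phi>_in_weight_space iw i by simp
  ultimately obtain a where a: "a \<noteq> 0" "\<Phi> i * \<phi> w - sc a * \<phi> (wmul (s i) w) \<in> J"
    using weight_vector_multiple_of_\<phi>[of "\<Phi> i * \<phi> w" "wmul (s i) w"] iw i by auto
  note summand = submoduleD[OF submodule_summand[of w]]
    subspace_submodule[OF submodule_summand[of w]]
  have "\<Phi> i * \<phi> w \<in> summand w" using summand(3) Hbar_\<Phi> i \<phi>_in_summand by blast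
  from H.subspace_diff[OF summand(4) this subsetD[OF summand(1) a(2)]]
  have "sc a * \<phi> (wmul (s i) w) \<in> summand w" by simp
  then have "sc (inverse a) * (sc a * \<phi> (wmul (s i) w)) \<in> summand w"
    by (rule H.subspace_scale[OF summand(4)])
  then show ?thesis using a(1) by simp
qed

lemma ex_Xbeta_same_summand:
  assumes "w \<in> Wmin N \<beta>"
  shows "\<exists>x\<in>Xbeta N \<beta>. \<exists>u. inWbar N u \<and> w = wmul u x \<and> summand w = summand x"
  using assms
proof (induction rule: Wmin_climb_induct)
  case (Xbeta x)
  then show ?case by (intro bexI[of _ x] exI[of _ idW]) simp_all
next
  case (step w i)
  then obtain x u where x: "x \<in> Xbeta N \<beta>" and u: "inWbar N u" "wmul (s i) w = wmul u x"
    and same: "summand (wmul (s i) w) = summand x" by blast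
  have iw: "inW N w" and ix: "inW N x" using step.hyps(1) Wmin_if_Xbeta[OF x] by simp_all
  have "w = wmul (s i) (wmul u x)" using step.hyps(3) iw u(2) by (metis s_s_cancel)
  also have "\<dots> = wmul (wmul (s i) u) x" using step.hyps(3) u(1) ix by (simp add: wmul_assoc)
  finally have w: "w = wmul (wmul (s i) u) x" .
  have "summand w = summand (wmul (s i) w)"
  proof
    show "summand w \<subseteq> summand (wmul (s i) w)"
      using \<phi>_s_wmul_in_summand[of "wmul (s i) w" i] step.hyps iw
      by (intro summand_subset submodule_summand) simp
    show "summand (wmul (s i) w) \<subseteq> summand w"
      using \<phi>_s_wmul_in_summand step.hyps by (intro summand_subset submodule_summand) simp
  qed
  then show ?case using x w u(1) same step.hyps(2,3)
    by (intro bexI[of _ x] exI[of _ "wmul (s i) u"]) simp_all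
qed

lemma summand_eq_if_same_coset:
  assumes x: "x \<in> Xbeta N \<beta>" and u: "inWbar N u" and ux: "wmul u x \<in> Wmin N \<beta>"
  shows "summand (wmul u x) = summand x"
proof -
  obtain x' u' where "x' \<in> Xbeta N \<beta>" "inWbar N u'" "wmul u x = wmul u' x'"
    and same: "summand (wmul u x) = summand x'"
    using ex_Xbeta_same_summand[OF ux] by blast
  then have "x' = x" using wmul_Xbeta_inject(1)[OF x _ u] by simp
  then show ?thesis using same by simp
qed

subsection \<open>The sum decomposition\<close>

lemma summands_span:
  "\<exists>F c. finite F \<and> F \<subseteq> Xbeta N \<beta> \<and> (\<forall>x\<in>F. c x \<in> Hb) \<and> h - (\<Sum>x\<in>F. c x * \<phi> x) \<in> J"
proof -
  obtain F a where F: "finite F" "F \<subseteq> Wmin N \<beta>" and h: "h - (\<Sum>w\<in>F. sc (a w) * \<phi> w) \<in> J"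
    using H.span_image_mod_subspace[OF Y.subspace_J, of h \<phi> "Wmin N \<beta>"] span_\<phi> by blast
  have "\<exists>x g. x \<in> Xbeta N \<beta> \<and> g \<in> Hb \<and> \<phi> w - g * \<phi> x \<in> J" if w: "w \<in> F" for w
  proof -
    obtain x where x: "x \<in> Xbeta N \<beta>" "summand w = summand x"
      using ex_Xbeta_same_summand F(2) w by blast
    then have "\<phi> w \<in> summand x" using \<phi>_in_summand by blast
    then obtain g j where g: "g \<in> Hb" and "\<phi> w = g * \<phi> x + j" "j \<in> J" unfolding summand_def by blast
    then have "\<phi> w - g * \<phi> x \<in> J" by simp
    then show ?thesis using x(1) g by blast
  qed
  then obtain x g where x: "\<And>w. w \<in> F \<Longrightarrow> x w \<in> Xbeta N \<beta>" and g: "\<And>w. w \<in> F \<Longrightarrow> g w \<in> Hb"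
    and \<phi>: "\<And>w. w \<in> F \<Longrightarrow> \<phi> w - g w * \<phi> (x w) \<in> J" by metis
  define c where "c y = (\<Sum>w\<in>{w \<in> F. x w = y}. sc (a w) * g w)" for y
  have "(\<Sum>w\<in>F. sc (a w) * g w * \<phi> (x w))
      = (\<Sum>y\<in>x ` F. \<Sum>w\<in>{w \<in> F. x w = y}. sc (a w) * g w * \<phi> (x w))"
    by (rule sum.image_gen[OF F(1)])
  also have "\<dots> = (\<Sum>y\<in>x ` F. c y * \<phi> y)"
    unfolding c_def sum_distrib_right by (intro sum.cong) auto
  finally have regroup: "(\<Sum>y\<in>x ` F. c y * \<phi> y) = (\<Sum>w\<in>F. sc (a w) * g w * \<phi> (x w))" by simp
  have "(\<Sum>w\<in>F. sc (a w) * (\<phi> w - g w * \<phi> (x w))) \<in> J"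
    by (intro Y.sum_J Y.scale_J \<phi>)
  from Y.add_J[OF h this] have "h - (\<Sum>y\<in>x ` F. c y * \<phi> y) \<in> J"
    by (simp add: regroup right_diff_distrib sum_subtractf mult.assoc)
  moreover have "c y \<in> Hb" for y
    unfolding c_def by (intro H.subspace_sum[OF subspace_Hbar] Hbar_mult Hbar_sc g) simp
  moreover have "finite (x ` F)" "x ` F \<subseteq> Xbeta N \<beta>" using F(1) x by auto
  ultimately show ?thesis by blast
qed

definition Wmin_coset :: "W \<Rightarrow> W set" where
  "Wmin_coset x = {w \<in> Wmin N \<beta>. \<exists>u. inWbar N u \<and> w = wmul u x}"

lemma Wmin_coset_subset_Wmin: "Wmin_coset x \<subseteq> Wmin N \<beta>"
  unfolding Wmin_coset_def by blast

lemma inW_Wmin_coset: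
  assumes "w \<in> Wmin_coset x"
  shows "inW N w"
  by (rule inW_Wmin[OF subsetD[OF Wmin_coset_subset_Wmin assms]])

lemma s_wmul_in_coset:
  assumes w: "w \<in> Wmin_coset x" and x: "inW N x" and i: "1 \<le> i" "i < N"
  shows "\<exists>u. inWbar N u \<and> wmul (s i) w = wmul u x"
proof -
  obtain u where u: "inWbar N u" "w = wmul u x" using w unfolding Wmin_coset_def by blast
  then have "wmul (s i) w = wmul (wmul (s i) u) x" using x i by (simp add: wmul_assoc)
  moreover have "inWbar N (wmul (s i) u)" using u(1) i by simp
  ultimately show ?thesis by blast
qed

definition coset_span :: "W \<Rightarrow> 'h set" where
  "coset_span x = H.span (\<phi> ` Wmin_coset x \<union> J)"

lemma subspace_coset_span: "H.subspace (coset_span x)"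
  unfolding coset_span_def by simp

lemma \<phi>_in_coset_span: "w \<in> Wmin_coset x \<Longrightarrow> \<phi> w \<in> coset_span x"
  unfolding coset_span_def by (intro H.span_base) blast

lemma J_subset_coset_span: "J \<subseteq> coset_span x"
  unfolding coset_span_def by (rule Y.J_subset_span)

lemma coset_span_iff_if_diff_in_J:
  assumes "m - m' \<in> J"
  shows "m \<in> coset_span x \<longleftrightarrow> m' \<in> coset_span x"
  using H.span_add_eq2[of "m - m'" _ m'] assms J_subset_coset_span unfolding coset_span_def
  by fastforce

lemma mult_in_coset_span:
  assumes "m \<in> coset_span x" and "\<And>w. w \<in> Wmin_coset x \<Longrightarrow> h * \<phi> w \<in> coset_span x"
  shows "h * m \<in> coset_span x"
proof (rule mult_in_subspace_if_span[OF assms(1)[unfolded coset_span_def] subspace_coset_span])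
  fix g assume "g \<in> \<phi> ` Wmin_coset x \<union> J"
  then show "h * g \<in> coset_span x" using assms(2) Y.mult_J J_subset_coset_span by blast
qed

lemma \<Phi>_mult_\<phi>_in_coset_span:
  assumes w: "w \<in> Wmin_coset x" and x: "inW N x" and i: "1 \<le> i" "i < N"
  shows "\<Phi> i * \<phi> w \<in> coset_span x"
proof (cases "\<Phi> i * \<phi> w \<in> J")
  case False
  have iw: "inW N w" by (rule inW_Wmin_coset[OF w])
  have "\<Phi> i * \<phi> w \<in> Y.weight_space (wmul (s i) w)"
    using Y.\<Phi>_mult_in_weight_space[OF _ iw \<phi>_in_weight_space[OF iw]] i by simp
  moreover have "inW N (wmul (s i) w)" using iw i by simp
  ultimately obtain a where "wmul (s i) w \<in> Wmin N \<beta>"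
    and diff: "\<Phi> i * \<phi> w - sc a * \<phi> (wmul (s i) w) \<in> J"
    using weight_vector_multiple_of_\<phi>[OF _ _ False] by blast
  then have "wmul (s i) w \<in> Wmin_coset x"
    using s_wmul_in_coset[OF w x i] unfolding Wmin_coset_def by blast
  then have "sc a * \<phi> (wmul (s i) w) \<in> coset_span x"
    by (intro H.subspace_scale[OF subspace_coset_span] \<phi>_in_coset_span)
  then show ?thesis using coset_span_iff_if_diff_in_J[OF diff] by blast
qed (use J_subset_coset_span in blast)

lemma T_s_mult_coset_span:
  assumes x: "inW N x" and i: "1 \<le> i" "i < N" and m: "m \<in> coset_span x"
  shows "T (s i) * m \<in> coset_span x"
proof (rule mult_in_coset_span[OF m])
  fix w assume w: "w \<in> Wmin_coset x"
  have iw: "inW N w" by (rule inW_Wmin_coset[OF w])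
  let ?p = "pair (act_dual w \<zeta>) (\<alpha> i)"
  have "\<Phi> i * \<phi> w - \<phi> w \<in> coset_span x"
    by (intro H.subspace_diff[OF subspace_coset_span] \<Phi>_mult_\<phi>_in_coset_span \<phi>_in_coset_span
        w x i)
  moreover have "\<Phi> i * \<phi> w - \<phi> w - sc ?p * (T (s i) * \<phi> w) \<in> J"
    using Y.\<Phi>_mult_weight_vector[OF _ \<phi>_in_weight_space[OF iw]] i by simp
  ultimately have "sc ?p * (T (s i) * \<phi> w) \<in> coset_span x"
    using coset_span_iff_if_diff_in_J by blast
  then have "sc (inverse ?p) * (sc ?p * (T (s i) * \<phi> w)) \<in> coset_span x"
    by (rule H.subspace_scale[OF subspace_coset_span])
  then show "T (s i) * \<phi> w \<in> coset_span x" using pair_act_dual_nonzero[OF iw i(2)] by simp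
qed

lemma T_mult_coset_span:
  assumes x: "inW N x" and w: "inWbar N w" and m: "m \<in> coset_span x"
  shows "T w * m \<in> coset_span x"
proof -
  obtain js where js: "set js \<subseteq> {1..<N}" and w_eq: "w = simple_prod js"
    using reduced_expr_finite_exists[OF w] by (auto simp: reduced_expr_def word_eq_simple_prod)
  have "T (simple_prod js) * m \<in> coset_span x" using js
  proof (induction js)
    case (Cons i js)
    have "inW N (simple_prod js)" using Cons.prems by (intro inW_simple_prod) auto
    then show ?case
      using Cons T_s_mult_coset_span[OF x, of i "T (simple_prod js) * m"]
      by (simp add: T_wmul mult.assoc)
  qed (use m in simp)
  then show ?thesis by (simp add: w_eq)
qed

lemma X_mult_coset_span:
  assumes m: "m \<in> coset_span x"
  shows "X xi * m \<in> coset_span x"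
proof (rule mult_in_coset_span[OF m])
  fix w assume w: "w \<in> Wmin_coset x"
  let ?c = "sc (zeta_eval N (act_dual w \<zeta>) xi)"
  have "\<phi> w \<in> Y.weight_space w" by (rule \<phi>_in_weight_space[OF inW_Wmin_coset[OF w]])
  then have "X xi * \<phi> w - ?c * \<phi> w \<in> J" by (rule Y.weight_spaceD) simp
  moreover have "?c * \<phi> w \<in> coset_span x"
    by (intro H.subspace_scale[OF subspace_coset_span] \<phi>_in_coset_span w)
  ultimately show "X xi * \<phi> w \<in> coset_span x" using coset_span_iff_if_diff_in_J by blast
qed

lemma submodule_coset_span:
  assumes x: "inW N x"
  shows "submodule (coset_span x)"
proof -
  have "h * m \<in> coset_span x" if "h \<in> Hb" "m \<in> coset_span x" for h m
    using that unfolding Hbar_eq_subalg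
  proof (induction arbitrary: m rule: subalg.induct)
    case (2 g)
    then consider w where "inWbar N w" "g = T w" | xi where "g = X xi" by blast
    then show ?case
      by cases (simp_all add: T_mult_coset_span[OF x _ 2(2)] X_mult_coset_span[OF 2(2)])
  qed (auto simp: distrib_right mult.assoc
      intro: H.subspace_scale[OF subspace_coset_span] H.subspace_add[OF subspace_coset_span])
  then show ?thesis
    by (simp add: submodule_def J_subset_coset_span H.subspace_add[OF subspace_coset_span])
qed

lemma summand_subset_coset_span:
  assumes "x \<in> Wmin N \<beta>"
  shows "summand x \<subseteq> coset_span x"
proof (rule summand_subset[OF submodule_coset_span \<phi>_in_coset_span])
  have "inWbar N idW \<and> x = wmul idW x" by simp
  then show "x \<in> Wmin_coset x" using assms unfolding Wmin_coset_def by blast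
qed (use assms in simp)

lemma summand_weight_expansion:
  assumes "x \<in> Xbeta N \<beta>" "m \<in> summand x"
  shows "\<exists>F a. finite F \<and> F \<subseteq> Wmin_coset x \<and> m - (\<Sum>w\<in>F. sc (a w) * \<phi> w) \<in> J"
proof -
  have "m \<in> H.span (\<phi> ` Wmin_coset x \<union> J)"
    using summand_subset_coset_span[OF Wmin_if_Xbeta] assms unfolding coset_span_def by blast
  then show ?thesis by (rule H.span_image_mod_subspace[OF Y.subspace_J])
qed

lemma coset_expansions_direct:
  assumes F: "finite F" "F \<subseteq> Xbeta N \<beta>"
    and G: "\<And>x. x \<in> F \<Longrightarrow> finite (G x)" "\<And>x. x \<in> F \<Longrightarrow> G x \<subseteq> Wmin_coset x"
    and sum: "(\<Sum>x\<in>F. \<Sum>w\<in>G x. sc (a x w) * \<phi> w) \<in> J"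
    and x: "x \<in> F"
  shows "(\<Sum>w\<in>G x. sc (a x w) * \<phi> w) \<in> J"
proof -
  let ?P = "SIGMA x:F. G x" and ?v = "\<lambda>p. sc (a (fst p) (snd p)) * \<phi> (snd p)"
  have coset: "snd p \<in> Wmin_coset (fst p)" "fst p \<in> Xbeta N \<beta>"
    if p: "p \<in> ?P" for p
  proof -
    have "fst p \<in> F" "snd p \<in> G (fst p)" using p by auto
    then show "snd p \<in> Wmin_coset (fst p)" "fst p \<in> Xbeta N \<beta>" using G(2) F(2) by blast+
  qed
  have sum_P: "(\<Sum>p\<in>?P. ?v p) \<in> J"
    using sum sum.Sigma[of F G "\<lambda>x w. sc (a x w) * \<phi> w"] F(1) G(1) by (simp add: case_prod_beta)
  have v: "?v p \<in> J" if p: "p \<in> ?P" for p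
  proof (rule weight_components_in_subspace[OF Y.subspace_J subset_refl _ _ _ _ _ sum_P p])
    show "finite ?P" using F(1) G(1) by blast
    show "?v p \<in> Y.weight_space (snd p)" "inW N (snd p)" if "p \<in> ?P" for p
      using inW_Wmin_coset[OF coset(1)[OF that]] scaled_\<phi>_in_weight_space by simp_all
    show "inj_on snd ?P"
    proof (rule inj_onI)
      fix p q assume p: "p \<in> ?P" and q: "q \<in> ?P" and eq: "snd p = snd q"
      obtain u u' where "inWbar N u" "inWbar N u'" "wmul u (fst p) = wmul u' (fst q)"
        using coset(1)[OF p] coset(1)[OF q] eq unfolding Wmin_coset_def by force
      then have "fst p = fst q" using wmul_Xbeta_inject(1) coset(2) p q by blast
      then show "p = q" using eq by (simp add: prod_eq_iff)
    qed
  qed (use Y.mult_J in blast)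
  have "sc (a x w) * \<phi> w \<in> J" if "w \<in> G x" for w using v[of "(x, w)"] x that by simp
  then show ?thesis by (rule Y.sum_J)
qed

lemma summands_direct:
  assumes F: "finite F" "F \<subseteq> Xbeta N \<beta>" "\<forall>x\<in>F. c x \<in> Hb" and sum: "(\<Sum>x\<in>F. c x * \<phi> x) \<in> J"
    and x: "x \<in> F"
  shows "c x * \<phi> x \<in> J"
proof -
  have "\<forall>x\<in>F. \<exists>G a. finite G \<and> G \<subseteq> Wmin_coset x \<and> c x * \<phi> x - (\<Sum>w\<in>G. sc (a w) * \<phi> w) \<in> J"
  proof
    fix x assume x: "x \<in> F"
    have "c x * \<phi> x \<in> summand x"
      using submoduleD(3)[OF submodule_summand] \<phi>_in_summand F(3) x by blast
    moreover have "x \<in> Xbeta N \<beta>" using F(2) x by blast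
    ultimately show "\<exists>G a. finite G \<and> G \<subseteq> Wmin_coset x \<and> c x * \<phi> x - (\<Sum>w\<in>G. sc (a w) * \<phi> w) \<in> J"
      by (rule summand_weight_expansion[rotated])
  qed
  then obtain G a where G: "\<And>x. x \<in> F \<Longrightarrow> finite (G x)" "\<And>x. x \<in> F \<Longrightarrow> G x \<subseteq> Wmin_coset x"
    and expansion: "\<And>x. x \<in> F \<Longrightarrow> c x * \<phi> x - (\<Sum>w\<in>G x. sc (a x w) * \<phi> w) \<in> J"
    unfolding bchoice_iff by blast
  have "(\<Sum>x\<in>F. c x * \<phi> x - (\<Sum>w\<in>G x. sc (a x w) * \<phi> w)) \<in> J" by (rule Y.sum_J[OF expansion])
  then have "(\<Sum>x\<in>F. \<Sum>w\<in>G x. sc (a x w) * \<phi> w) \<in> J"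
    using sum Y.diff_in_J_imp_iff unfolding sum_subtractf by blast
  then have "(\<Sum>w\<in>G x. sc (a x w) * \<phi> w) \<in> J"
    using coset_expansions_direct[OF F(1,2) G, where a = a] x by blast
  then show ?thesis using Y.diff_in_J_imp_iff[OF expansion[OF x]] by blast
qed

lemma summand_irreducible:
  assumes x: "x \<in> Xbeta N \<beta>"
  shows "irred_quot Hb J (summand x)"
proof -
  have "U = summand x" if U: "submodule U" "U \<subseteq> summand x" and "U \<noteq> J" for U
  proof -
    note U_closed = submoduleD[OF U(1)] and subspace_U = subspace_submodule[OF U(1)]
    obtain m where m: "m \<in> U" "m \<notin> J" using U_closed(1) \<open>U \<noteq> J\<close> by blast
    obtain F a where F: "finite F" "F \<subseteq> Wmin_coset x"
      and expansion: "m - (\<Sum>w\<in>F. sc (a w) * \<phi> w) \<in> J"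
      using summand_weight_expansion[OF x subsetD[OF U(2) m(1)]] by blast
    have "(\<Sum>w\<in>F. sc (a w) * \<phi> w) \<notin> J" using Y.diff_in_J_imp_iff[OF expansion] m(2) by blast
    then obtain w where w: "w \<in> F" "sc (a w) * \<phi> w \<notin> J"
      using Y.sum_J[of F "\<lambda>w. sc (a w) * \<phi> w"] by blast
    from H.subspace_diff[OF subspace_U m(1) subsetD[OF U_closed(1) expansion]]
    have sum: "(\<Sum>w\<in>F. sc (a w) * \<phi> w) \<in> U" by simp
    have "sc (a w) * \<phi> w \<in> U"
    proof (rule weight_components_in_subspace[OF subspace_U U_closed(1) _ F(1) _ _ _ sum w(1)])
      show "X (b, 0) * u \<in> U" if "u \<in> U" for b u using U_closed(3)[OF Hbar_X that] by simp
      show "inW N w" if "w \<in> F" for w using F(2) that inW_Wmin_coset by blast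
      then show "sc (a w) * \<phi> w \<in> Y.weight_space w" if "w \<in> F" for w
        using that scaled_\<phi>_in_weight_space by blast
    qed simp
    then have "sc (inverse (a w)) * (sc (a w) * \<phi> w) \<in> U" by (rule H.subspace_scale[OF subspace_U])
    moreover have "a w \<noteq> 0" using w(2) Y.zero_J by auto
    ultimately have "summand w \<subseteq> U" using summand_subset[OF U(1)] by simp
    moreover obtain u where "inWbar N u" "w = wmul u x" "w \<in> Wmin N \<beta>"
      using w(1) F(2) unfolding Wmin_coset_def by blast
    then have "summand w = summand x" using summand_eq_if_same_coset[OF x] by blast
    ultimately show ?thesis using U(2) by blast
  qed
  moreover have "\<not> summand x \<subseteq> J" using \<phi>_in_summand \<phi>_notin_J[OF Wmin_if_Xbeta[OF x]] by blast
  ultimately show ?thesis unfolding irred_quot_def submodule_def by blast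
qed

subsection \<open>The summands as induced modules\<close>

lemma zeta_eval_finite: "snd xi = 0 \<Longrightarrow> zeta_eval N (fst z, 0) xi = zeta_eval N z xi"
  by (simp add: zeta_eval_def)

lemma T_s_diff_one_mult_\<phi>:
  assumes x: "x \<in> Xbeta N \<beta>" and i: "i \<in> Pi_g N (beta_of N \<beta> x)"
  shows "(T (s i) - 1) * \<phi> x \<in> J"
proof -
  have x_min: "x \<in> Wmin N \<beta>" and ix: "inW N x" using Wmin_if_Xbeta[OF x] by simp_all
  obtain a where a: "a \<in> R\<^sub>\<beta>" "wroot x a = \<alpha> i" and range: "1 \<le> i" "i < N"
    using i unfolding Pi_g_beta_of by blast
  have in_R: "wroot (winv x) (\<alpha> i) \<in> R\<^sub>\<beta>" using a ix by (metis wroot_winv_cancel(2))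
  obtain j where "j \<in> Pi\<^sub>\<beta>" "wroot (winv x) (\<alpha> i) = \<alpha> j"
    using simple_root_if_image_simple[OF x_min range in_R] by blast
  then have pair: "pair (act_dual x \<zeta>) (\<alpha> i) = -1"
    using pair_simple_root by (simp add: pair_act_dual[OF ix])
  have "\<Phi> i * \<phi> x \<in> Y.weight_space (wmul (s i) x)"
    using Y.\<Phi>_mult_in_weight_space[OF _ ix \<phi>_in_weight_space[OF ix]] range by simp
  moreover have "wmul (s i) x \<notin> Wmin N \<beta>" using s_wmul_in_Wmin_iff[OF x_min range(2)] in_R by blast
  ultimately have "\<Phi> i * \<phi> x \<in> J"
    using weight_vector_multiple_of_\<phi> ix range by (metis inW_s inW_wmul)
  moreover have "\<Phi> i * \<phi> x - \<phi> x - sc (-1) * (T (s i) * \<phi> x) \<in> J"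
    using Y.\<Phi>_mult_weight_vector[OF _ \<phi>_in_weight_space[OF ix], of i] range by (simp add: pair)
  ultimately have "(\<Phi> i * \<phi> x - \<phi> x - sc (-1) * (T (s i) * \<phi> x)) - \<Phi> i * \<phi> x \<in> J"
    by (rule Y.diff_J[rotated])
  then show ?thesis by (simp add: sc_minus left_diff_distrib)
qed

lemma T_diff_one_mult_\<phi>:
  assumes x: "x \<in> Xbeta N \<beta>" and w: "w \<in> Wbar_g N (beta_of N \<beta> x)"
  shows "(T w - 1) * \<phi> x \<in> J"
  using w
proof (induction rule: Wbar_g.induct)
  case (2 i w)
  have "inW N w" "i < N" using inWbar_Wbar_g[OF 2(2)] Pi_g_range[OF 2(1)] by auto
  then have "(T (wmul (s i) w) - 1) * \<phi> x = T (s i) * ((T w - 1) * \<phi> x) + (T (s i) - 1) * \<phi> x"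
    by (simp only: T_s_wmul_diff_one distrib_right mult.assoc)
  then show ?case
    using Y.add_J[OF Y.mult_J[OF UNIV_I 2(3)] T_s_diff_one_mult_\<phi>[OF x 2(1)]] by simp
qed (simp add: Y.zero_J)

abbreviation Jb :: "nat list \<Rightarrow> W \<Rightarrow> 'h set" where
  "Jb g x \<equiv> Jbar N sc T Xe Xc g (fst (act_dual x \<zeta>))"

lemma Jbar_mult_\<phi>:
  assumes x: "x \<in> Xbeta N \<beta>" and h: "h \<in> Jb (beta_of N \<beta> x) x"
  shows "h * \<phi> x \<in> J"
  using h unfolding Jbar_def
proof (induction rule: lideal.induct)
  case (2 a g)
  let ?z = "act_dual x \<zeta>"
  have ix: "inW N x" using Wmin_if_Xbeta[OF x] by simp
  have "(X (b, 0) - sc (zeta_eval N (fst ?z, 0) (b, 0))) * \<phi> x \<in> J" for b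
    using Y.weight_spaceD[OF \<phi>_in_weight_space[OF ix], of "(b, 0)"]
    by (simp add: zeta_eval_finite left_diff_distrib)
  then have "g * \<phi> x \<in> J" using 2(2) T_diff_one_mult_\<phi>[OF x] by blast
  then show ?case using Y.mult_J by (simp add: mult.assoc)
qed (auto simp: distrib_right intro: Y.zero_J Y.add_J)

lemma finite_regular_weight_module:
  assumes ix: "inW N x"
  shows "regular_weight_module N sc T Xe Xc Hb {w. inWbar N w} {1..<N} {xi. snd xi = 0}
    (Jb g x) (act_dual x \<zeta>)"
proof unfold_locales
  let ?z = "act_dual x \<zeta>"
  fix xi :: tvec assume xi: "xi \<in> {xi. snd xi = 0}"
  then have "xi = (fst xi, 0)" by (simp add: prod_eq_iff)
  then have "X xi - sc (zeta_eval N ?z xi)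
      \<in> {X (a, 0) - sc (zeta_eval N (fst ?z, 0) (a, 0)) | a. True}"
    using zeta_eval_finite[of xi ?z] xi by (metis (mono_tags, lifting) mem_Collect_eq)
  then show "X xi - sc (zeta_eval N ?z xi) \<in> Jb g x"
    unfolding Jbar_def by (intro generator_in_lideal Hbar_1) blast
next
  fix y j assume "y \<in> Hb" "j \<in> Jb g x"
  then show "y * j \<in> Jb g x"
    unfolding Jbar_def using Hbar_mult by (intro mult_in_lideal) auto
next
  fix w and xi :: tvec assume "w \<in> {w. inWbar N w}" "xi \<in> {xi. snd xi = 0}"
  then show "act_t N w xi \<in> {xi. snd xi = 0}" by (simp add: act_t_def Let_def inWbar_def)
next
  fix w assume "w \<in> {w. inWbar N w}"
  then show "\<exists>k js. pi_pow k \<in> {w. inWbar N w} \<and> set js \<subseteq> {1..<N} \<and> reduced_expr N w (k, js)"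
    using reduced_expr_finite_exists[of w] by (intro exI[of _ 0]) simp
next
  fix y i assume "y \<in> {w. inWbar N w}" "i \<in> {1..<N}"
  then show "pair (act_dual y (act_dual x \<zeta>)) (\<alpha> i) \<noteq> 0"
    using pair_act_dual_nonzero[of "wmul y x" i] ix by (simp add: act_dual_wmul)
qed (auto simp: Hbar_sc Hbar_add Hbar_mult Hbar_T Hbar_X snd_coroot_finite Jbar_def
    intro: lideal.intros)

definition finite_reduced_word :: "W \<Rightarrow> nat list" where
  "finite_reduced_word u = (SOME js. set js \<subseteq> {1..<N} \<and> reduced_expr N u (0, js))"

lemma finite_reduced_word:
  assumes "inWbar N u"
  shows "set (finite_reduced_word u) \<subseteq> {1..<N}" "reduced_expr N u (0, finite_reduced_word u)"
  using someI_ex[OF reduced_expr_finite_exists[OF assms]] by (auto simp: finite_reduced_word_def)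

lemma Hbar_expansion_mod_Jbar:
  assumes x: "x \<in> Xbeta N \<beta>" and h: "h \<in> Hb"
  shows "\<exists>F a. finite F \<and> F \<subseteq> {u. inWbar N u \<and> wmul u x \<in> Wmin N \<beta>} \<and>
    h - (\<Sum>u\<in>F. sc (a u) * \<Phi>_prod (finite_reduced_word u)) \<in> Jb (beta_of N \<beta> x) x"
proof -
  let ?g = "beta_of N \<beta> x" and ?Adm = "{u. inWbar N u \<and> wmul u x \<in> Wmin N \<beta>}"
  let ?Jbar = "Jb ?g x"
  have ix: "inW N x" using Wmin_if_Xbeta[OF x] by simp
  interpret B: regular_weight_module N sc T Xe Xc Hb "{w. inWbar N w}" "{1..<N}" "{xi. snd xi = 0}"
    ?Jbar "act_dual x \<zeta>"
    by (rule finite_regular_weight_module[OF ix])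
  have "subalg sc (T ` {w. inWbar N w} \<union> X ` {xi. snd xi = 0})
      \<subseteq> H.span ((\<lambda>u. \<Phi>_expr (0, finite_reduced_word u)) ` ?Adm \<union> ?Jbar)"
  proof (rule B.subalg_subset_span_\<Phi>_expr)
    show "B.reduced_expr_in u (0, finite_reduced_word u)" if "u \<in> ?Adm" for u
      using finite_reduced_word[of u] that unfolding B.reduced_expr_in_def by simp
    fix u assume "u \<in> {w. inWbar N w}" "u \<notin> ?Adm"
    then obtain j where j: "j \<in> Pi_g N ?g" "neg_root N (wroot u (\<alpha> j))"
      using ex_neg_simple_root_beta_of[OF x] by blast
    have "T (s j) - 1 \<in> ?Jbar"
      unfolding Jbar_def using s_in_Wbar_g[OF j(1)] by (intro generator_in_lideal Hbar_1) blast
    then show "\<exists>i\<in>{1..<N}. neg_root N (wroot u (\<alpha> i)) \<and> T (s i) - 1 \<in> ?Jbar"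
      using j Pi_g_range[OF j(1)] by auto
  qed
  then have "h \<in> H.span ((\<lambda>u. \<Phi>_prod (finite_reduced_word u)) ` ?Adm \<union> ?Jbar)"
    using h by (auto simp: Hbar_eq_subalg \<Phi>_expr_def)
  then show ?thesis by (rule H.span_image_mod_subspace[OF B.subspace_J])
qed

lemma summand_annihilator:
  assumes x: "x \<in> Xbeta N \<beta>" and h: "h \<in> Hb"
  shows "h \<in> Jb (beta_of N \<beta> x) x \<longleftrightarrow> h * \<phi> x \<in> J" (is "h \<in> ?Jbar \<longleftrightarrow> _")
proof
  assume h\<phi>: "h * \<phi> x \<in> J"
  have x_min: "x \<in> Wmin N \<beta>" and ix: "inW N x" using Wmin_if_Xbeta[OF x] by simp_all
  obtain F a where F: "finite F" "F \<subseteq> {u. inWbar N u \<and> wmul u x \<in> Wmin N \<beta>}"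
    and expansion: "h - (\<Sum>u\<in>F. sc (a u) * \<Phi>_prod (finite_reduced_word u)) \<in> ?Jbar"
    using Hbar_expansion_mod_Jbar[OF x h] by blast
  let ?v = "\<lambda>u. \<Phi>_prod (finite_reduced_word u) * \<phi> x"
  have "h * \<phi> x - (\<Sum>u\<in>F. sc (a u) * ?v u) \<in> J"
    using Jbar_mult_\<phi>[OF x expansion] by (simp add: left_diff_distrib sum_distrib_right mult.assoc)
  then have sum: "(\<Sum>u\<in>F. sc (a u) * ?v u) \<in> J" using Y.diff_in_J_imp_iff h\<phi> by blast
  have word: "set (finite_reduced_word u) \<subseteq> {..<N}" "simple_prod (finite_reduced_word u) = u"
    "len N u = length (finite_reduced_word u)" "inW N u" "wmul u x \<in> Wmin N \<beta>" if "u \<in> F" for u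
    using finite_reduced_word[of u] that F(2) by (auto simp: reduced_expr_def word_eq_simple_prod)
  have weight: "?v u \<in> Y.weight_space (wmul u x)" if "u \<in> F" for u
    using Y.\<Phi>_prod_mult_in_weight_space[OF word(1)[OF that] ix \<phi>_in_weight_space[OF ix]]
    by (simp add: word(2)[OF that])
  have "a u = 0" if u: "u \<in> F" for u
  proof -
    have "inj_on (\<lambda>u. wmul u x) F" using word(4) wmul_right_cancel[OF ix] by (auto intro: inj_onI)
    then have "sc (a u) * ?v u \<in> J"
      using F(1) weight word(4) ix H.subspace_scale[OF Y.subspace_weight_space] Y.mult_J
      by (intro weight_components_in_subspace[OF Y.subspace_J subset_refl _ _ _ _ _ sum u]) auto
    moreover have "?v u \<notin> J"
      using \<Phi>_prod_mult_notin_J[OF x_min \<phi>_in_weight_space[OF ix] \<phi>_notin_J[OF x_min] word(1)[OF u]]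
        word(2,3,5)[OF u] by simp
    ultimately show "a u = 0" using Y.scale_in_J_iff by blast
  qed
  then show "h \<in> ?Jbar" using expansion by simp
qed (rule Jbar_mult_\<phi>[OF x])

end

theorem theorem2p23:
  fixes N :: nat and sc :: "complex \<Rightarrow> 'h::ring_1" and T :: "W \<Rightarrow> 'h"
    and Xe :: "nat \<Rightarrow> 'h" and Xc :: 'h and \<beta> :: "nat list" and \<zeta> :: tvec
  assumes "2 \<le> N"
    and "DDAHA N sc T Xe Xc"
    and "is_opart N \<beta>"
    and "t_dual_g N \<beta> \<zeta>"
    and "generic N \<beta> \<zeta>"
    and "snd \<zeta> \<noteq> 0"
  shows
    \<comment> \<open>Y = sum of the Hbar phi_x 1\<close>
    "(\<forall>h. \<exists>F c. finite F \<and> F \<subseteq> Xbeta N \<beta> \<and> (\<forall>x\<in>F. c x \<in> Hbar N sc T Xe Xc) \<and>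
        h - (\<Sum>x\<in>F. c x * phi_w N sc T Xe Xc x) \<in> Jideal N sc T Xe Xc \<beta> \<zeta>)
   \<and> \<comment> \<open>the sum is direct\<close>
     (\<forall>F c. finite F \<and> F \<subseteq> Xbeta N \<beta> \<and> (\<forall>x\<in>F. c x \<in> Hbar N sc T Xe Xc) \<and>
        (\<Sum>x\<in>F. c x * phi_w N sc T Xe Xc x) \<in> Jideal N sc T Xe Xc \<beta> \<zeta>
        \<longrightarrow> (\<forall>x\<in>F. c x * phi_w N sc T Xe Xc x \<in> Jideal N sc T Xe Xc \<beta> \<zeta>))
   \<and> \<comment> \<open>each summand is irreducible and isomorphic to Ybar_{beta(x)}(zbar) via 1 |-> phi_x 1\<close>
     (\<forall>x \<in> Xbeta N \<beta>.
        irred_quot (Hbar N sc T Xe Xc) (Jideal N sc T Xe Xc \<beta> \<zeta>)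
          {h * phi_w N sc T Xe Xc x + j | h j. h \<in> Hbar N sc T Xe Xc \<and> j \<in> Jideal N sc T Xe Xc \<beta> \<zeta>}
      \<and> (\<forall>h \<in> Hbar N sc T Xe Xc.
           h \<in> Jbar N sc T Xe Xc (beta_of N \<beta> x) (fst (act_dual x \<zeta>))
           \<longleftrightarrow> h * phi_w N sc T Xe Xc x \<in> Jideal N sc T Xe Xc \<beta> \<zeta>))"
proof -
  interpret generic_standard N sc T Xe Xc \<beta> \<zeta> by unfold_locales (fact assms)+
  show ?thesis
  proof (intro conjI allI ballI impI)
    show "\<exists>F c. finite F \<and> F \<subseteq> Xbeta N \<beta> \<and> (\<forall>x\<in>F. c x \<in> Hb) \<and> h - (\<Sum>x\<in>F. c x * \<phi> x) \<in> J" for h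
      by (rule summands_span)
  next
    fix F c x
    assume "finite F \<and> F \<subseteq> Xbeta N \<beta> \<and> (\<forall>x\<in>F. c x \<in> Hb) \<and> (\<Sum>x\<in>F. c x * \<phi> x) \<in> J" "x \<in> F"
    then show "c x * \<phi> x \<in> J" using summands_direct by blast
  next
    fix x assume x: "x \<in> Xbeta N \<beta>"
    show "irred_quot Hb J {h * \<phi> x + j | h j. h \<in> Hb \<and> j \<in> J}"
      using summand_irreducible[OF x] unfolding summand_def .
    show "h \<in> Jb (beta_of N \<beta> x) x \<longleftrightarrow> h * \<phi> x \<in> J" if "h \<in> Hb" for h
      by (rule summand_annihilator[OF x that])
  qed
qed

end
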